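(* For ${\rm APP}=\{{\rm APP}_d\}_{d\in\mathbb N}$ in the average case setting with the absolute error criterion and for fixed $s,t>0$, ${\rm APP}$ is EXP-$(s,t)$-WT for $\Lambda^{\rm all}$ iff it is EXP-$(s,t)$-WT for $\Lambda^{\rm std}$. In particular, ${\rm APP}$ is EXP-WT for $\Lambda^{\rm all}$ iff it is EXP-WT for $\Lambda^{\rm std}$.
   Context: Setting (average case approximation). For each $d\in\mathbb N$: $D_d\subset\mathbb R^d$ is a Borel set of positive Lebesgue measure, $\rho_d$ is a probability density on $D_d$, and $G_d=L_2(D_d,\rho_d(x)\,dx)$. $F_d$ is a separable Banach space of real-valued functions on $D_d$, continuously embedded in $G_d$, such that every point evaluation $f\mapsto f(x)$, $x\in D_d$, is a continuous linear functional on $F_d$; $F_d$ carries a zero-mean Gaussian measure $\mu_d$. ${\rm APP}_d:F_d\to G_d$, ${\rm APP}_d f=f$. $\Lambda^{\rm all}$ is the class of all continuous linear functionals on $F_d$, $\Lambda^{\rm std}$ the class of point evaluations. For $\Lambda\in\{\Lambda^{\rm all},\Lambda^{\rm std}\}$, an algorithm is $A_{n,d}f=\phi_{n,d}(L_1(f),\dots,L_n(f))$ with $L_i\in\Lambda$ and $\phi_{n,d}:\mathbb R^n\to G_d$ measurable; its average case error is $e^{\rm avg}(A_{n,d})=\big(\int_{F_d}\|f-A_{n,d}f\|_{G_d}^2\,\mu_d(df)\big)^{1/2}$, and $e^{\rm avg}(n,d;\Lambda)$ is the infimum of $e^{\rm avg}(A_{n,d})$ over all such algorithms using $n$ functionals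 from $\Lambda$ (for $n=0$, $A_{0,d}=0$). Absolute-error information complexity: $n^{\rm ABS}(\varepsilon,d;\Lambda)=\min\{n\ge0:\ e^{\rm avg}(n,d;\Lambda)\le\varepsilon\}$. EXP-$(s,t)$-WT for $\Lambda$: $\lim_{\varepsilon^{-1}+d\to\infty}\frac{\ln n^{\rm ABS}(\varepsilon,d;\Lambda)}{(1+\ln\varepsilon^{-1})^{s}+d^{t}}=0$, where the limit means: for every $\eta>0$ there is $M$ such that the quotient is $<\eta$ for all $d\in\mathbb N$, $\varepsilon\in(0,1)$ with $\varepsilon^{-1}+d>M$. EXP-WT is EXP-$(1,1)$-WT. *)

theory Defs
  imports "HOL-Probability.Probability"
begin

(* Points of R^d are represented as extensional functions nat => real on {..<d};
   Lebesgue (Borel) measure on R^d is the product of d copies of lborel. *)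
definition lebesgue_d :: "nat \<Rightarrow> (nat \<Rightarrow> real) measure" where
  "lebesgue_d d = PiM {..<d} (\<lambda>_. lborel)"

(* the measure rho_d(x) dx on D_d; G_d = L_2 of this measure *)
definition G_meas :: "(nat \<Rightarrow> (nat \<Rightarrow> real) set) \<Rightarrow> (nat \<Rightarrow> (nat \<Rightarrow> real) \<Rightarrow> real)
    \<Rightarrow> nat \<Rightarrow> (nat \<Rightarrow> real) measure" where
  "G_meas D \<rho> d = density (restrict_space (lebesgue_d d) (D d)) (\<lambda>x. ennreal (\<rho> d x))"

definition cont_lin_functional :: "'f::real_normed_vector set \<Rightarrow> ('f \<Rightarrow> real) \<Rightarrow> bool" where
  "cont_lin_functional S L \<longleftrightarrow>
     (\<forall>f\<in>S. \<forall>g\<in>S. L (f + g) = L f + L g) \<and>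
     (\<forall>c. \<forall>f\<in>S. L (c *\<^sub>R f) = c * L f) \<and>
     (\<exists>K. \<forall>f\<in>S. \<bar>L f\<bar> \<le> K * norm f)"

definition centered_gaussian_real :: "real measure \<Rightarrow> bool" where
  "centered_gaussian_real M \<longleftrightarrow>
     M = return borel 0 \<or> (\<exists>\<sigma>>0. M = density lborel (normal_density 0 \<sigma>))"

definition zero_mean_gaussian :: "'f::real_normed_vector set \<Rightarrow> 'f measure \<Rightarrow> bool" where
  "zero_mean_gaussian S \<mu> \<longleftrightarrow>
     prob_space \<mu> \<and> sets \<mu> = sets (restrict_space borel S) \<and>
     (\<forall>L. cont_lin_functional S L \<longrightarrow> centered_gaussian_real (distr \<mu> borel L))"

(* The standing assumptions of the setting, for every d >= 1.
   F d is a closed separable linear subspace of the Banach space 'f (hence a separable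
   Banach space); evl d f is the function on D d represented by f. *)
definition APP_setting ::
  "(nat \<Rightarrow> (nat \<Rightarrow> real) set) \<Rightarrow> (nat \<Rightarrow> (nat \<Rightarrow> real) \<Rightarrow> real) \<Rightarrow> (nat \<Rightarrow> 'f::banach set)
   \<Rightarrow> (nat \<Rightarrow> 'f \<Rightarrow> (nat \<Rightarrow> real) \<Rightarrow> real) \<Rightarrow> (nat \<Rightarrow> 'f measure) \<Rightarrow> bool" where
  "APP_setting D \<rho> F evl \<mu> \<longleftrightarrow> (\<forall>d\<ge>1.
     \<comment> \<open>D_d Borel subset of R^d of positive Lebesgue measure\<close>
     D d \<in> sets (lebesgue_d d) \<and> emeasure (lebesgue_d d) (D d) > 0 \<and>
     \<comment> \<open>rho_d probability density on D_d\<close>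
     \<rho> d \<in> borel_measurable (restrict_space (lebesgue_d d) (D d)) \<and>
     (\<forall>x\<in>D d. \<rho> d x \<ge> 0) \<and>
     (\<integral>\<^sup>+ x. ennreal (\<rho> d x) \<partial>restrict_space (lebesgue_d d) (D d)) = 1 \<and>
     \<comment> \<open>F_d separable Banach space\<close>
     subspace (F d) \<and> closed (F d) \<and>
     (\<exists>C. countable C \<and> C \<subseteq> F d \<and> F d \<subseteq> closure C) \<and>
     \<comment> \<open>F_d is a linear space of real functions on D_d\<close>
     (\<forall>f\<in>F d. \<forall>g\<in>F d. \<forall>x\<in>D d. evl d (f + g) x = evl d f x + evl d g x) \<and>
     (\<forall>c. \<forall>f\<in>F d. \<forall>x\<in>D d. evl d (c *\<^sub>R f) x = c * evl d f x) \<and>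
     (\<forall>f\<in>F d. \<forall>g\<in>F d. (\<forall>x\<in>D d. evl d f x = evl d g x) \<longrightarrow> f = g) \<and>
     \<comment> \<open>continuous embedding into G_d\<close>
     (\<forall>f\<in>F d. evl d f \<in> borel_measurable (restrict_space (lebesgue_d d) (D d))) \<and>
     (\<exists>C. \<forall>f\<in>F d. (\<integral>\<^sup>+ x. ennreal ((evl d f x)\<^sup>2) \<partial>G_meas D \<rho> d) \<le> ennreal ((C * norm f)\<^sup>2)) \<and>
     \<comment> \<open>point evaluations are continuous\<close>
     (\<forall>x\<in>D d. \<exists>K. \<forall>f\<in>F d. \<bar>evl d f x\<bar> \<le> K * norm f) \<and>
     \<comment> \<open>zero-mean Gaussian measure on F_d\<close>
     zero_mean_gaussian (F d) (\<mu> d))"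

definition Lambda_all :: "(nat \<Rightarrow> 'f::real_normed_vector set) \<Rightarrow> nat \<Rightarrow> ('f \<Rightarrow> real) set" where
  "Lambda_all F d = {L. cont_lin_functional (F d) L}"

definition Lambda_std :: "(nat \<Rightarrow> (nat \<Rightarrow> real) set) \<Rightarrow> (nat \<Rightarrow> 'f \<Rightarrow> (nat \<Rightarrow> real) \<Rightarrow> real)
    \<Rightarrow> nat \<Rightarrow> ('f \<Rightarrow> real) set" where
  "Lambda_std D evl d = {L. \<exists>x\<in>D d. L = (\<lambda>f. evl d f x)}"

definition alg_err_sq ::
  "(nat \<Rightarrow> (nat \<Rightarrow> real) set) \<Rightarrow> (nat \<Rightarrow> (nat \<Rightarrow> real) \<Rightarrow> real)
   \<Rightarrow> (nat \<Rightarrow> 'f \<Rightarrow> (nat \<Rightarrow> real) \<Rightarrow> real) \<Rightarrow> (nat \<Rightarrow> 'f measure)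
   \<Rightarrow> nat \<Rightarrow> nat \<Rightarrow> (nat \<Rightarrow> 'f \<Rightarrow> real) \<Rightarrow> ((nat \<Rightarrow> real) \<Rightarrow> (nat \<Rightarrow> real) \<Rightarrow> real) \<Rightarrow> ennreal" where
  "alg_err_sq D \<rho> evl \<mu> d n L \<phi> =
     (\<integral>\<^sup>+ f. (\<integral>\<^sup>+ x. ennreal ((evl d f x - \<phi> (\<lambda>i\<in>{..<n}. L i f) x)\<^sup>2) \<partial>G_meas D \<rho> d) \<partial>\<mu> d)"

definition avg_err_sq ::
  "(nat \<Rightarrow> (nat \<Rightarrow> real) set) \<Rightarrow> (nat \<Rightarrow> (nat \<Rightarrow> real) \<Rightarrow> real)
   \<Rightarrow> (nat \<Rightarrow> 'f \<Rightarrow> (nat \<Rightarrow> real) \<Rightarrow> real) \<Rightarrow> (nat \<Rightarrow> 'f measure)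
   \<Rightarrow> (nat \<Rightarrow> ('f \<Rightarrow> real) set) \<Rightarrow> nat \<Rightarrow> nat \<Rightarrow> ennreal" where
  "avg_err_sq D \<rho> evl \<mu> \<Lambda> d n =
     (INF (L, \<phi>) \<in> {(L, \<phi>). (\<forall>i<n. L i \<in> \<Lambda> d) \<and>
          (\<lambda>(y, x). \<phi> y x) \<in> borel_measurable
              (PiM {..<n} (\<lambda>_. lborel) \<Otimes>\<^sub>M restrict_space (lebesgue_d d) (D d)) \<and>
          (n = 0 \<longrightarrow> \<phi> = (\<lambda>y x. 0))}.
        alg_err_sq D \<rho> evl \<mu> d n L \<phi>)"

definition n_ABS ::
  "(nat \<Rightarrow> (nat \<Rightarrow> real) set) \<Rightarrow> (nat \<Rightarrow> (nat \<Rightarrow> real) \<Rightarrow> real)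
   \<Rightarrow> (nat \<Rightarrow> 'f \<Rightarrow> (nat \<Rightarrow> real) \<Rightarrow> real) \<Rightarrow> (nat \<Rightarrow> 'f measure)
   \<Rightarrow> (nat \<Rightarrow> ('f \<Rightarrow> real) set) \<Rightarrow> real \<Rightarrow> nat \<Rightarrow> nat" where
  "n_ABS D \<rho> evl \<mu> \<Lambda> \<epsilon> d = (LEAST n. avg_err_sq D \<rho> evl \<mu> \<Lambda> d n \<le> ennreal (\<epsilon>\<^sup>2))"

(* EXP-(s,t)-WT (the information complexity must be finite; ln 0 = 0 in Isabelle,
   which is harmless since the paper's convention ln 0 = -infinity also satisfies < eta) *)
definition EXP_WT ::
  "real \<Rightarrow> real \<Rightarrow> (nat \<Rightarrow> (nat \<Rightarrow> real) set) \<Rightarrow> (nat \<Rightarrow> (nat \<Rightarrow> real) \<Rightarrow> real)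
   \<Rightarrow> (nat \<Rightarrow> 'f \<Rightarrow> (nat \<Rightarrow> real) \<Rightarrow> real) \<Rightarrow> (nat \<Rightarrow> 'f measure)
   \<Rightarrow> (nat \<Rightarrow> ('f \<Rightarrow> real) set) \<Rightarrow> bool" where
  "EXP_WT s t D \<rho> evl \<mu> \<Lambda> \<longleftrightarrow>
     (\<forall>d\<ge>1. \<forall>\<epsilon>. 0 < \<epsilon> \<and> \<epsilon> < 1 \<longrightarrow> (\<exists>n. avg_err_sq D \<rho> evl \<mu> \<Lambda> d n \<le> ennreal (\<epsilon>\<^sup>2))) \<and>
     (\<forall>\<eta>>0. \<exists>M. \<forall>d\<ge>1. \<forall>\<epsilon>. 0 < \<epsilon> \<and> \<epsilon> < 1 \<and> 1 / \<epsilon> + real d > M \<longrightarrow>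
        ln (real (n_ABS D \<rho> evl \<mu> \<Lambda> \<epsilon> d)) /
          ((1 + ln (1 / \<epsilon>)) powr s + real d powr t) < \<eta>)"

end

(* An algorithm with n arbitrary functionals is, up to averaging, no better than the Gaussian
   regression on these functionals, which is linear: the error of the regression at a point is
   uncorrelated with the information, hence independent of it. So the approximants may be taken in
   the span of m <= n functions that are orthonormal in L_2. On such a span, least squares with
   weights 1/omega at N >= 8 (m+1)^2 suitable points, omega being the (regularised, normalised)
   Christoffel function, is stable, and its squared average case error is at most 10 times that of
   the best approximation. Therefore
       n(eps, d; std) <= 8 (n(eps/4, d; all) + 1)^2,
   and constants in eps as well as powers of n are invisible to EXP-(s,t)-WT. It matters here that
   the bound involves no initial error, which may grow arbitrarily fast with d. *)
theory Submission
  imports Defs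
begin

text \<open>The Gaussian hypothesis speaks of the laws of single functionals only, so "uncorrelated,
  hence independent" has to be rebuilt from one-dimensional laws: the trigonometric moments of the
  regression error against the information vanish, and uniqueness of Fourier transforms turns this
  into orthogonality to nonlinear functions of the information. A second obstacle is that the
  regression coefficients, as functions of the point, must lie in L_2. The embedding controls only
  one f at a time, so the integrability of the pointwise variance is extracted from the Gaussian
  fourth moment. One set of points can serve all f because only the mean square of the residual over
  f enters, and that is a single function of the point. The points must make it small and the least
  squares stable at once; both aims go into one potential. The square in
  \<open>8 * (m + 1)\<^sup>2\<close> stems from controlling a matrix by its Frobenius norm. The
  factor 10 is 2 + 4 * 2: least squares costs 2 for the L_2 residual and 4 for the discrete one,
  which is at most twice the L_2 one on average. Since 10 < 16, dividing eps by 4 suffices and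
  leaves room for an infimum that is not attained.\<close>

section \<open>Gram-Schmidt orthogonalisation for a semidefinite form\<close>

text \<open>The form may be degenerate, so a vector is recovered only up to a remainder of zero
  form: null almost everywhere for an L_2 product, null at the sample points for an empirical one.
  Working with functions instead of classes keeps point values meaningful. Membership of the
  remainder in \<open>S\<close> is part of the conclusion because the properties of \<open>S\<close>
  are applied to it later.\<close>

lemma gram_schmidt_semidefinite:
  fixes B :: "('a \<Rightarrow> real) \<Rightarrow> ('a \<Rightarrow> real) \<Rightarrow> real"
    and n :: nat
  assumes closed: "\<And>a b f g. f \<in> S \<Longrightarrow> g \<in> S \<Longrightarrow> (\<lambda>x. a * f x + b * g x) \<in> S"
    and sym: "\<And>f g. f \<in> S \<Longrightarrow> g \<in> S \<Longrightarrow> B f g = B g f"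
    and lin: "\<And>a b f g h. f \<in> S \<Longrightarrow> g \<in> S \<Longrightarrow> h \<in> S \<Longrightarrow>
                B (\<lambda>x. a * f x + b * g x) h = a * B f h + b * B g h"
    and nonneg: "\<And>f. f \<in> S \<Longrightarrow> 0 \<le> B f f"
    and u: "\<forall>i<n. u i \<in> S"
  shows "\<exists>m\<le>n. \<exists>v a. (\<forall>j<m. v j \<in> S) \<and>
           (\<forall>i<m. \<forall>j<m. B (v i) (v j) = (if i = j then 1 else 0)) \<and>
           (\<forall>i<n. (\<lambda>x. u i x - (\<Sum>j<m. a i j * v j x)) \<in> S \<and>
              B (\<lambda>x. u i x - (\<Sum>j<m. a i j * v j x)) (\<lambda>x. u i x - (\<Sum>j<m. a i j * v j x)) = 0)"
  using u
proof (induction n)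
  case 0
  then show ?case by auto
next
  case (Suc n)
  have "\<forall>i<n. u i \<in> S" using Suc.prems by simp
  from Suc.IH[OF this] obtain m v a where m: "m \<le> n"
    and v: "\<And>j. j < m \<Longrightarrow> v j \<in> S"
    and on: "\<And>i j. i < m \<Longrightarrow> j < m \<Longrightarrow> B (v i) (v j) = (if i = j then 1 else 0)"
    and a: "\<And>i. i < n \<Longrightarrow> (\<lambda>x. u i x - (\<Sum>j<m. a i j * v j x)) \<in> S"
      "\<And>i. i < n \<Longrightarrow> B (\<lambda>x. u i x - (\<Sum>j<m. a i j * v j x)) (\<lambda>x. u i x - (\<Sum>j<m. a i j * v j x)) = 0"
    by (elim exE conjE) blast
  define c where "c j = B (u n) (v j)" for j
  define r where "r k = (\<lambda>x. u n x - (\<Sum>j<k. c j * v j x))" for k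
  have un: "u n \<in> S" using Suc.prems by simp
  have rS: "r k \<in> S \<and> (\<forall>i<m. B (r k) (v i) = (if i < k then 0 else c i))" if "k \<le> m" for k
    using that
  proof (induction k)
    case 0
    then show ?case using un by (simp add: r_def c_def)
  next
    case (Suc k)
    have eq: "r (Suc k) = (\<lambda>x. 1 * r k x + (- c k) * v k x)"
      by (auto simp: r_def)
    from Suc have rk: "r k \<in> S" and rk': "\<And>i. i < m \<Longrightarrow> B (r k) (v i) = (if i < k then 0 else c i)"
      and vk: "v k \<in> S" using v by auto
    have "r (Suc k) \<in> S"
      unfolding eq by (rule closed[OF rk vk])
    moreover have "B (r (Suc k)) (v i) = (if i < Suc k then 0 else c i)" if "i < m" for i
      unfolding eq lin[OF rk vk v[OF that]] using that Suc.prems on rk' by (auto simp: less_Suc_eq)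
    ultimately show ?case by blast
  qed
  have rmS: "r m \<in> S" and orth: "\<And>i. i < m \<Longrightarrow> B (r m) (v i) = 0"
    using rS[of m] by auto
  show ?case
  \<comment> \<open>A residual of zero form cannot be normalised, and it already meets what is asked
    of a remainder; so no new vector is added. This is how \<open>m\<close> may stay below
    \<open>n\<close>.\<close>
  proof (cases "B (r m) (r m) = 0")
    case True
    define a' where "a' i = (if i = n then c else a i)" for i
    have 1: "(\<lambda>x. u i x - (\<Sum>j<m. a' i j * v j x)) \<in> S \<and>
        B (\<lambda>x. u i x - (\<Sum>j<m. a' i j * v j x)) (\<lambda>x. u i x - (\<Sum>j<m. a' i j * v j x)) = 0"
      if "i < Suc n" for i
    proof (cases "i = n")
      case True
      then have "(\<lambda>x. u i x - (\<Sum>j<m. a' i j * v j x)) = r m" by (simp add: r_def a'_def)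
      then show ?thesis using rmS \<open>B (r m) (r m) = 0\<close> by simp
    next
      case False
      then show ?thesis using a[of i] that by (simp add: a'_def)
    qed
    show ?thesis
      using m v on 1 by (intro exI[of _ m] conjI exI[of _ v] exI[of _ a']) auto
  next
    case False
    define \<beta> where "\<beta> = sqrt (B (r m) (r m))"
    have \<beta>: "\<beta> > 0" "\<beta> * \<beta> = B (r m) (r m)"
      using False nonneg[OF rmS] by (auto simp: \<beta>_def)
    define w where "w = (\<lambda>x. (1 / \<beta>) * r m x + 0 * r m x)"
    have wS: "w \<in> S" unfolding w_def by (rule closed[OF rmS rmS])
    have wl: "B w h = B (r m) h / \<beta>" if "h \<in> S" for h
      unfolding w_def lin[OF rmS rmS that] by simp
    have ww: "B w w = 1"
      using wl[OF wS] sym[OF wS rmS] wl[OF rmS] \<beta> by (simp add: field_simps)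
    have wv: "B w (v i) = 0" "B (v i) w = 0" if "i < m" for i
      using wl[OF v[OF that]] orth[OF that] sym[OF wS v[OF that]] by auto
    define v' where "v' j = (if j = m then w else v j)" for j
    define a' where "a' i j = (if i = n then (if j = m then \<beta> else c j) else if j = m then 0 else a i j)" for i j
    have v'S: "v' j \<in> S" if "j < Suc m" for j
      using that v wS by (auto simp: v'_def)
    have on': "B (v' i) (v' j) = (if i = j then 1 else 0)" if "i < Suc m" "j < Suc m" for i j
      using that on ww wv by (auto simp: v'_def)
    have sm: "(\<Sum>j<Suc m. a' i j * v' j x) =
        (if i = n then (\<Sum>j<m. c j * v j x) + r m x else (\<Sum>j<m. a i j * v j x))" for i x
      using \<beta>(1) by (simp add: a'_def v'_def w_def)
    have 1: "(\<lambda>x. u i x - (\<Sum>j<Suc m. a' i j * v' j x)) \<in> S \<and>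
        B (\<lambda>x. u i x - (\<Sum>j<Suc m. a' i j * v' j x)) (\<lambda>x. u i x - (\<Sum>j<Suc m. a' i j * v' j x)) = 0"
      if "i < Suc n" for i
    proof (cases "i = n")
      case True
      then have eq: "(\<lambda>x. u i x - (\<Sum>j<Suc m. a' i j * v' j x)) = (\<lambda>x. 0 * r m x + 0 * r m x)"
        unfolding sm by (auto simp: r_def)
      have "(\<lambda>x. 0 * r m x + 0 * r m x) \<in> S" by (rule closed[OF rmS rmS])
      moreover from this have "B (\<lambda>x. 0 * r m x + 0 * r m x) (\<lambda>x. 0 * r m x + 0 * r m x) = 0"
        by (subst lin[OF rmS rmS]) auto
      ultimately show ?thesis unfolding eq by simp
    next
      case False
      then show ?thesis using a[of i] that unfolding sm by simp
    qed
    show ?thesis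
      using m v'S on' 1 by (intro exI[of _ "Suc m"] conjI exI[of _ v'] exI[of _ a']) auto
  qed
qed

section \<open>Uniqueness of Fourier transforms on finite products\<close>

lemma integrable_mult_bounded:
  fixes W g :: "'a \<Rightarrow> real"
  assumes W: "integrable M W" and g[measurable]: "g \<in> borel_measurable M"
    and bd: "\<And>x. x \<in> space M \<Longrightarrow> \<bar>g x\<bar> \<le> K"
  shows "integrable M (\<lambda>x. W x * g x)"
proof (rule Bochner_Integration.integrable_bound[where f = "\<lambda>x. K * W x"])
  show "integrable M (\<lambda>x. K * W x)" using W by simp
  have [measurable]: "W \<in> borel_measurable M" using W by auto
  show "(\<lambda>x. W x * g x) \<in> borel_measurable M" by measurable
  show "AE x in M. norm (W x * g x) \<le> norm (K * W x)"
  proof (rule AE_I2)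
    fix x assume "x \<in> space M"
    then have "\<bar>g x\<bar> \<le> \<bar>K\<bar>" using bd by fastforce
    then show "norm (W x * g x) \<le> norm (K * W x)"
      using mult_right_mono[of "\<bar>g x\<bar>" "\<bar>K\<bar>" "\<bar>W x\<bar>"] by (simp add: abs_mult mult.commute)
  qed
qed

lemma char_distr_density:
  fixes X :: "'a \<Rightarrow> real"
  assumes p: "integrable M p" and pos: "\<And>x. 0 \<le> p x"
    and X[measurable]: "X \<in> borel_measurable M"
  shows "char (distr (density M (\<lambda>x. ennreal (p x))) borel X) t =
     Complex (\<integral>x. p x * cos (t * X x) \<partial>M) (\<integral>x. p x * sin (t * X x) \<partial>M)"
proof -
  have [measurable]: "p \<in> borel_measurable M" using p by auto
  have 1: "integrable M (\<lambda>x. p x * cos (t * X x))"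
    by (rule integrable_mult_bounded[OF p, where K = 1]) auto
  have 2: "integrable M (\<lambda>x. p x * sin (t * X x))"
    by (rule integrable_mult_bounded[OF p, where K = 1]) auto
  have eq: "p x *\<^sub>R iexp (t * X x) = complex_of_real (p x * cos (t * X x)) + \<i> * complex_of_real (p x * sin (t * X x))" for x
    by (simp add: complex_eq_iff Re_exp Im_exp)
  have "char (distr (density M (\<lambda>x. ennreal (p x))) borel X) t =
      (CLINT x|M. p x *\<^sub>R iexp (t * X x))"
    unfolding char_def
    by (subst integral_distr, simp, simp, subst integral_density) (auto simp: pos)
  also have "\<dots> = complex_of_real (\<integral>x. p x * cos (t * X x) \<partial>M) + \<i> * complex_of_real (\<integral>x. p x * sin (t * X x) \<partial>M)"
    unfolding eq using 1 2 by (simp del: of_real_mult)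
  finally show ?thesis by (simp add: complex_eq_iff)
qed

text \<open>The signed weight is, up to a constant, a difference of two probability densities. Under
  these, \<open>X\<close> has the same characteristic function, so Levy's theorem identifies the two
  laws.\<close>

lemma fourier_uniqueness_real:
  fixes X :: "'a \<Rightarrow> real"
  assumes M: "prob_space M" and W: "integrable M W" and X[measurable]: "X \<in> borel_measurable M"
    and c0: "\<And>b. (\<integral>x. W x * cos (b * X x) \<partial>M) = 0"
    and s0: "\<And>b. (\<integral>x. W x * sin (b * X x) \<partial>M) = 0"
    and A[measurable]: "A \<in> sets borel"
  shows "(\<integral>x. W x * indicator A (X x) \<partial>M) = 0"
proof -
  interpret prob_space M by (rule M)
  have [measurable]: "W \<in> borel_measurable M" using W by auto
  \<comment> \<open>Adding 1 to the positive and negative parts makes the total mass at least 1, so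
    that normalising is possible even if \<open>W\<close> vanishes; the added constant cancels in
    \<open>p - q\<close>.\<close>
  define c where "c = (\<integral>x. max 0 (W x) + 1 \<partial>M)"
  define p where "p x = (max 0 (W x) + 1) / c" for x
  define q where "q x = (max 0 (- W x) + 1) / c" for x
  have i0: "integrable M (\<lambda>x. max 0 (W x) + 1)" "integrable M (\<lambda>x. max 0 (- W x) + 1)"
    using W by auto
  have "c \<ge> (\<integral>x. 1 \<partial>M)"
    unfolding c_def by (rule integral_mono) (use i0 in auto)
  then have c: "c \<ge> 1" by (simp add: prob_space)
  have ip: "integrable M p" "integrable M q"
    using i0 by (simp_all add: p_def[abs_def] q_def[abs_def])
  have pq: "p x - q x = W x / c" for x
    using c by (simp add: p_def q_def field_simps max_def)
  have p0: "0 \<le> p x" "0 \<le> q x" for x using c by (auto simp: p_def q_def)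
  have eqI: "(\<integral>x. p x * g x \<partial>M) = (\<integral>x. q x * g x \<partial>M)"
    if g: "g \<in> borel_measurable M" "\<And>x. \<bar>g x\<bar> \<le> 1" and z: "(\<integral>x. W x * g x \<partial>M) = 0" for g :: "'a \<Rightarrow> real"
  proof -
    have "(\<integral>x. p x * g x \<partial>M) - (\<integral>x. q x * g x \<partial>M) = (\<integral>x. p x * g x - q x * g x \<partial>M)"
      by (rule Bochner_Integration.integral_diff[symmetric]; rule integrable_mult_bounded) (use ip g in auto)
    also have "\<dots> = (\<integral>x. W x * g x / c \<partial>M)"
      by (rule Bochner_Integration.integral_cong) (auto simp: left_diff_distrib[symmetric] pq)
    also have "\<dots> = 0" using z by simp
    finally show ?thesis by simp
  qed
  let ?P = "\<lambda>p. distr (density M (\<lambda>x. ennreal (p x))) borel X"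
  have mass: "(\<integral>x. p x \<partial>M) = 1"
    using c by (simp add: p_def c_def[symmetric])
  \<comment> \<open>Frequency 0 says that \<open>W\<close> has integral 0; hence the constant that
    normalises \<open>p\<close> also normalises \<open>q\<close>.\<close>
  moreover have "(\<integral>x. p x \<partial>M) = (\<integral>x. q x \<partial>M)"
    using eqI[of "\<lambda>_. 1"] c0[of 0] by simp
  ultimately have mass': "(\<integral>x. q x \<partial>M) = 1" by simp
  have rd: "real_distribution (?P r)" if "integrable M r" "\<And>x. 0 \<le> r x" "(\<integral>x. r x \<partial>M) = 1" for r
  proof -
    have [measurable]: "r \<in> borel_measurable M" using that by auto
    have "emeasure (density M (\<lambda>x. ennreal (r x))) (space M) = 1"
      using that by (simp add: emeasure_density nn_integral_eq_integral cong: nn_integral_cong)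
    then have "prob_space (density M (\<lambda>x. ennreal (r x)))"
      by (intro prob_spaceI) simp
    then show ?thesis
      by (intro real_distribution.intro prob_space.prob_space_distr real_distribution_axioms.intro) auto
  qed
  have "char (?P p) = char (?P q)"
    by (rule ext, subst (1 2) char_distr_density) (use ip p0 in \<open>auto intro!: eqI c0 s0\<close>)
  then have "?P p = ?P q"
    by (intro Levy_uniqueness rd ip p0 mass mass')
  then have "measure (?P p) A = measure (?P q) A" by simp
  moreover have "measure (?P r) A = (\<integral>x. r x * indicator A (X x) \<partial>M)"
    if r: "integrable M r" "\<And>x. 0 \<le> r x" for r
  proof -
    have [measurable]: "r \<in> borel_measurable M" using r by auto
    have "measure (?P r) A = (\<integral>x. indicator A x \<partial>?P r)" by simp
    also have "\<dots> = (\<integral>x. r x * indicator A (X x) \<partial>M)"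
      by (subst integral_distr, simp, simp, subst integral_density) (auto simp: r)
    finally show ?thesis .
  qed
  ultimately have "(\<integral>x. p x * indicator A (X x) \<partial>M) = (\<integral>x. q x * indicator A (X x) \<partial>M)"
    using ip p0 by simp
  moreover have "(\<integral>x. p x * indicator A (X x) \<partial>M) - (\<integral>x. q x * indicator A (X x) \<partial>M)
      = (\<integral>x. p x * indicator A (X x) - q x * indicator A (X x) \<partial>M)"
    by (rule Bochner_Integration.integral_diff[symmetric]; rule integrable_mult_bounded[where K=1])
       (use ip in \<open>auto simp: indicator_def\<close>)
  moreover have "\<dots> = (\<integral>x. W x * indicator A (X x) / c \<partial>M)"
    by (rule Bochner_Integration.integral_cong) (auto simp: left_diff_distrib[symmetric] pq)
  ultimately show ?thesis using c by simp
qed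

text \<open>Induction on the coordinates with \<open>W\<close> arbitrary: the indicator of the new
  coordinate is absorbed into the weight. The one-dimensional result is applied to the weights
  \<open>W\<close> times cosine and \<open>W\<close> times sine of the remaining linear
  form.\<close>

lemma fourier_uniqueness_cylinder:
  fixes X :: "'i \<Rightarrow> 'a \<Rightarrow> real"
  assumes M: "prob_space M" and I: "finite I"
    and X: "\<And>i. i \<in> I \<Longrightarrow> X i \<in> borel_measurable M"
    and A: "\<And>i. i \<in> I \<Longrightarrow> A i \<in> sets borel"
    and W: "integrable M W"
    and c0: "\<And>b. (\<integral>x. W x * cos (\<Sum>i\<in>I. b i * X i x) \<partial>M) = 0"
    and s0: "\<And>b. (\<integral>x. W x * sin (\<Sum>i\<in>I. b i * X i x) \<partial>M) = 0"
  shows "(\<integral>x. W x * (\<Prod>i\<in>I. indicator (A i) (X i x)) \<partial>M) = 0"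
  using I X A W c0 s0
proof (induction I arbitrary: W rule: finite_induct)
  case empty
  from empty(4)[of undefined] show ?case by simp
next
  case (insert k I)
  note [measurable] = insert.prems(1)[of k, simplified]
  have Xm[measurable]: "X i \<in> borel_measurable M" if "i \<in> I" for i
    using insert.prems(1) that by simp
  have [measurable]: "W \<in> borel_measurable M" using insert.prems by auto
  note [measurable] = insert.prems(2)[of k, simplified]
  let ?W = "\<lambda>x. W x * indicator (A k) (X k x)"
  let ?S = "\<lambda>b x. \<Sum>i\<in>I. b i * X i x"
  have e: "(\<integral>x. W x * cos (?S b x + c * X k x) \<partial>M) = 0" "(\<integral>x. W x * sin (?S b x + c * X k x) \<partial>M) = 0" for b c
  proof -
    have s: "(\<Sum>i\<in>insert k I. (b(k := c)) i * X i x) = ?S b x + c * X k x" for x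
    proof -
      have "(\<Sum>i\<in>I. (b(k := c)) i * X i x) = ?S b x"
        using insert.hyps by (intro sum.cong) auto
      then show ?thesis using insert.hyps by simp
    qed
    show "(\<integral>x. W x * cos (?S b x + c * X k x) \<partial>M) = 0"
      using insert.prems(4)[of "b(k := c)"] unfolding s .
    show "(\<integral>x. W x * sin (?S b x + c * X k x) \<partial>M) = 0"
      using insert.prems(5)[of "b(k := c)"] unfolding s .
  qed
  have i: "integrable M (\<lambda>x. W x * g (h x))" if "h \<in> borel_measurable M" "g = sin \<or> g = cos" for g h :: "_ \<Rightarrow> real"
  proof (rule integrable_mult_bounded[OF insert.prems(3), where K=1])
    show "(\<lambda>x. g (h x)) \<in> borel_measurable M" using that by auto
  qed (use that in auto)
  \<comment> \<open>The hypotheses for the frequencies \<open>c\<close> and \<open>-c\<close> in the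
    new coordinate are added and subtracted; the addition theorems then separate that coordinate
    from the others.\<close>
  have z: "(\<integral>x. W x * cos (?S b x) * cos (c * X k x) \<partial>M) = 0"
    "(\<integral>x. W x * sin (?S b x) * sin (c * X k x) \<partial>M) = 0"
    "(\<integral>x. W x * sin (?S b x) * cos (c * X k x) \<partial>M) = 0"
    "(\<integral>x. W x * cos (?S b x) * sin (c * X k x) \<partial>M) = 0" for b c
  proof -
    have ic: "integrable M (\<lambda>x. W x * cos (?S b x + c * X k x))" for c by (rule i[where g=cos]) auto
    have isn: "integrable M (\<lambda>x. W x * sin (?S b x + c * X k x))" for c by (rule i[where g=sin]) auto
    have 1: "W x * cos (?S b x) * cos (c * X k x) = (W x * cos (?S b x + c * X k x) + W x * cos (?S b x + (-c) * X k x)) / 2"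
      and 2: "W x * sin (?S b x) * sin (c * X k x) = (W x * cos (?S b x + (-c) * X k x) - W x * cos (?S b x + c * X k x)) / 2"
      and 3: "W x * sin (?S b x) * cos (c * X k x) = (W x * sin (?S b x + c * X k x) + W x * sin (?S b x + (-c) * X k x)) / 2"
      and 4: "W x * cos (?S b x) * sin (c * X k x) = (W x * sin (?S b x + c * X k x) - W x * sin (?S b x + (-c) * X k x)) / 2"
      for x
      by (simp_all only: cos_add sin_add mult_minus_left cos_minus sin_minus) (simp_all add: algebra_simps)
    show "(\<integral>x. W x * cos (?S b x) * cos (c * X k x) \<partial>M) = 0"
      unfolding 1 using ic[of c] ic[of "-c"] e(1)[of b c] e(1)[of b "-c"] by simp
    show "(\<integral>x. W x * sin (?S b x) * sin (c * X k x) \<partial>M) = 0"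
      unfolding 2 using ic[of c] ic[of "-c"] e(1)[of b c] e(1)[of b "-c"] by simp
    show "(\<integral>x. W x * sin (?S b x) * cos (c * X k x) \<partial>M) = 0"
      unfolding 3 using isn[of c] isn[of "-c"] e(2)[of b c] e(2)[of b "-c"] by simp
    show "(\<integral>x. W x * cos (?S b x) * sin (c * X k x) \<partial>M) = 0"
      unfolding 4 using isn[of c] isn[of "-c"] e(2)[of b c] e(2)[of b "-c"] by simp
  qed
  have iW: "integrable M ?W"
    by (rule integrable_mult_bounded[OF insert.prems(3), where K=1]) (auto simp: indicator_def)
  have "(\<integral>x. W x * cos (?S b x) * indicator (A k) (X k x) \<partial>M) = 0" for b
    by (rule fourier_uniqueness_real[OF M]) (auto intro!: i[where g=cos] z)
  then have 1: "(\<integral>x. ?W x * cos (?S b x) \<partial>M) = 0" for b by (simp add: mult_ac)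
  have "(\<integral>x. W x * sin (?S b x) * indicator (A k) (X k x) \<partial>M) = 0" for b
    by (rule fourier_uniqueness_real[OF M]) (auto intro!: i[where g=sin] z)
  then have 2: "(\<integral>x. ?W x * sin (?S b x) \<partial>M) = 0" for b by (simp add: mult_ac)
  have "(\<integral>x. ?W x * (\<Prod>i\<in>I. indicator (A i) (X i x)) \<partial>M) = 0"
    using insert.prems by (intro insert.IH iW 1 2) auto
  then show ?case using insert.hyps by (simp add: mult_ac)
qed

text \<open>In other words, the conditional expectation of \<open>W\<close> given the
  \<open>X i\<close> is 0. The measures whose densities are the positive and the negative part of
  \<open>W\<close> have images under the information map that agree on boxes, hence
  coincide.\<close>

lemma fourier_orthogonal:
  fixes X :: "'i \<Rightarrow> 'a \<Rightarrow> real" and \<psi> :: "('i \<Rightarrow> real) \<Rightarrow> real"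
  assumes M: "prob_space M" and I: "finite I"
    and X: "\<And>i. i \<in> I \<Longrightarrow> X i \<in> borel_measurable M"
    and W: "integrable M W"
    and c0: "\<And>b. (\<integral>x. W x * cos (\<Sum>i\<in>I. b i * X i x) \<partial>M) = 0"
    and s0: "\<And>b. (\<integral>x. W x * sin (\<Sum>i\<in>I. b i * X i x) \<partial>M) = 0"
    and \<psi>[measurable]: "\<psi> \<in> borel_measurable (PiM I (\<lambda>_. lborel))"
    and int: "integrable M (\<lambda>x. W x * \<psi> (\<lambda>i\<in>I. X i x))"
  shows "(\<integral>x. W x * \<psi> (\<lambda>i\<in>I. X i x) \<partial>M) = 0"
proof -
  interpret prob_space M by (rule M)
  have [measurable]: "W \<in> borel_measurable M" using W by auto
  define T where "T x = (\<lambda>i\<in>I. X i x)" for x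
  have T[measurable]: "T \<in> M \<rightarrow>\<^sub>M PiM I (\<lambda>_. lborel)"
    unfolding T_def by (rule measurable_restrict) (use X in simp)
  define p where "p x = max 0 (W x)" for x
  define q where "q x = max 0 (- W x)" for x
  have [measurable]: "p \<in> borel_measurable M" "q \<in> borel_measurable M"
    unfolding p_def[abs_def] q_def[abs_def] by measurable
  have pq: "W x = p x - q x" for x by (simp add: p_def q_def max_def)
  have pos: "0 \<le> p x" "0 \<le> q x" for x by (auto simp: p_def q_def)
  have ip: "integrable M p" "integrable M q" using W by (simp_all add: p_def[abs_def] q_def[abs_def])
  let ?P = "\<lambda>p. distr (density M (\<lambda>x. ennreal (p x))) (PiM I (\<lambda>_. lborel :: real measure)) T"
  have em: "emeasure (?P r) (Pi\<^sub>E I A) = ennreal (\<integral>x. r x * (\<Prod>i\<in>I. indicator (A i) (X i x)) \<partial>M)"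
    if r: "integrable M r" "\<And>x. 0 \<le> r x" and A: "\<And>i. i \<in> I \<Longrightarrow> A i \<in> sets borel" for r A
  proof -
    have [measurable]: "r \<in> borel_measurable M" using r by auto
    have [measurable]: "Pi\<^sub>E I A \<in> sets (PiM I (\<lambda>_. lborel))"
      by (rule sets_PiM_I_finite) (use A I in auto)
    have ind: "indicator (Pi\<^sub>E I A) (T x) = (\<Prod>i\<in>I. indicator (A i) (X i x) :: real)" for x
    proof (cases "\<forall>i\<in>I. X i x \<in> A i")
      case True
      then show ?thesis by (auto simp: T_def indicator_def PiE_def Pi_def)
    next
      case False
      then obtain i where "i \<in> I" "X i x \<notin> A i" by auto
      then have "(\<Prod>i\<in>I. indicator (A i) (X i x) :: real) = 0"
        using I by (auto simp: prod_zero_iff indicator_def)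
      moreover have "T x \<notin> Pi\<^sub>E I A" using \<open>i \<in> I\<close> \<open>X i x \<notin> A i\<close> by (auto simp: T_def PiE_def Pi_def)
      ultimately show ?thesis by simp
    qed
    have i2: "integrable M (\<lambda>x. r x * indicator (Pi\<^sub>E I A) (T x))"
      by (rule integrable_mult_bounded[OF r(1), where K=1]) (auto simp: indicator_def)
    have "emeasure (?P r) (Pi\<^sub>E I A) = (\<integral>\<^sup>+x. indicator (Pi\<^sub>E I A) x \<partial>?P r)" by simp
    also have "\<dots> = (\<integral>\<^sup>+x. ennreal (r x) * indicator (Pi\<^sub>E I A) (T x) \<partial>M)"
      by (subst nn_integral_distr, simp, simp, subst nn_integral_density) auto
    also have "\<dots> = (\<integral>\<^sup>+x. ennreal (r x * indicator (Pi\<^sub>E I A) (T x)) \<partial>M)"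
      by (rule nn_integral_cong) (auto simp: indicator_def)
    also have "\<dots> = ennreal (\<integral>x. r x * indicator (Pi\<^sub>E I A) (T x) \<partial>M)"
      by (rule nn_integral_eq_integral[OF i2]) (use r in auto)
    finally show ?thesis unfolding ind .
  qed
  have "?P p = ?P q"
  proof (rule measure_eqI_PiM_finite[OF I, where M = "\<lambda>_. lborel"])
    fix A assume A: "\<And>i. i \<in> I \<Longrightarrow> A i \<in> sets (lborel :: real measure)"
    then have A': "\<And>i. i \<in> I \<Longrightarrow> A i \<in> sets borel" by simp
    have m[measurable]: "(\<lambda>x. \<Prod>i\<in>I. indicator (A i) (X i x) :: real) \<in> borel_measurable M"
    proof (rule borel_measurable_prod)
      fix i assume "i \<in> I"
      then have [measurable]: "A i \<in> sets borel" "X i \<in> borel_measurable M" using A' X by auto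
      show "(\<lambda>x. indicator (A i) (X i x) :: real) \<in> borel_measurable M" by measurable
    qed
    have b: "\<bar>\<Prod>i\<in>I. indicator (A i) (X i x) :: real\<bar> \<le> 1" for x
      unfolding abs_prod by (rule prod_le_1) (auto simp: indicator_def)
    have "(\<integral>x. W x * (\<Prod>i\<in>I. indicator (A i) (X i x)) \<partial>M) = 0"
      by (rule fourier_uniqueness_cylinder[OF M I X A' W c0 s0])
    moreover have "(\<integral>x. W x * (\<Prod>i\<in>I. indicator (A i) (X i x)) \<partial>M) =
        (\<integral>x. p x * (\<Prod>i\<in>I. indicator (A i) (X i x)) \<partial>M) - (\<integral>x. q x * (\<Prod>i\<in>I. indicator (A i) (X i x)) \<partial>M)"
      unfolding pq left_diff_distrib
      by (rule Bochner_Integration.integral_diff; rule integrable_mult_bounded[OF _ m b]) (use ip in auto)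
    ultimately show "emeasure (?P p) (Pi\<^sub>E I A) = emeasure (?P q) (Pi\<^sub>E I A)"
      using em[OF ip(1) pos(1) A'] em[OF ip(2) pos(2) A'] by simp
  next
    show "range (\<lambda>_::nat. space (PiM I (\<lambda>_. lborel :: real measure))) \<subseteq> prod_algebra I (\<lambda>_. lborel)"
      using I by (auto simp: space_PiM intro!: prod_algebraI_finite)
    have "emeasure (?P p) (space (PiM I (\<lambda>_. lborel))) = ennreal (\<integral>x. p x * (\<Prod>i\<in>I. indicator UNIV (X i x)) \<partial>M)"
      using em[OF ip(1) pos(1), of "\<lambda>_. UNIV"] by (simp add: space_PiM)
    then show "emeasure (?P p) (space (PiM I (\<lambda>_. lborel))) \<noteq> \<infinity>" by simp
  qed auto
  then have "(\<integral>y. \<psi> y \<partial>?P p) = (\<integral>y. \<psi> y \<partial>?P q)" by simp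
  moreover have "(\<integral>y. \<psi> y \<partial>?P r) = (\<integral>x. r x * \<psi> (T x) \<partial>M)"
    if [measurable]: "r \<in> borel_measurable M" and "\<And>x. 0 \<le> r x" for r
    by (subst integral_distr, simp, simp, subst integral_density) (auto simp: that)
  ultimately have "(\<integral>x. p x * \<psi> (T x) \<partial>M) = (\<integral>x. q x * \<psi> (T x) \<partial>M)" using pos by simp
  moreover have "integrable M (\<lambda>x. p x * \<psi> (T x))" "integrable M (\<lambda>x. q x * \<psi> (T x))"
    by (rule Bochner_Integration.integrable_bound[OF int];
        use pos in \<open>auto simp: T_def[symmetric] p_def q_def abs_mult intro!: mult_right_mono AE_I2\<close>)+
  ultimately show ?thesis
    unfolding T_def[symmetric] pq left_diff_distrib by simp
qed

section \<open>Second moments and one-dimensional Gaussian laws\<close>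

lemma integrable_mult_of_squares:
  fixes f g :: "'a \<Rightarrow> real"
  assumes [measurable]: "f \<in> borel_measurable M" "g \<in> borel_measurable M"
    and f: "integrable M (\<lambda>x. (f x)\<^sup>2)" and g: "integrable M (\<lambda>x. (g x)\<^sup>2)"
  shows "integrable M (\<lambda>x. f x * g x)"
proof (rule Bochner_Integration.integrable_bound)
  show "integrable M (\<lambda>x. (f x)\<^sup>2 + (g x)\<^sup>2)" using f g by simp
  show "AE x in M. norm (f x * g x) \<le> norm ((f x)\<^sup>2 + (g x)\<^sup>2)"
  proof (rule AE_I2)
    fix x
    have "2 * \<bar>f x\<bar> * \<bar>g x\<bar> \<le> \<bar>f x\<bar>\<^sup>2 + \<bar>g x\<bar>\<^sup>2" by (rule sum_squares_bound)
    then show "norm (f x * g x) \<le> norm ((f x)\<^sup>2 + (g x)\<^sup>2)"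
      using abs_ge_zero[of "f x * g x"] sum_power2_ge_zero[of "f x" "g x"] unfolding real_norm_def abs_mult power2_abs
      by linarith
  qed
qed measurable

text \<open>Pythagoras. \<open>Y\<close> will be a measurable function of the information about
  which nothing more is known: if the right side is infinite, nothing is to be shown, and otherwise
  \<open>Y\<close> is square integrable as a difference. Orthogonality is therefore requested only
  under integrability of the product.\<close>

lemma nn_integral_square_orthogonal_le:
  fixes Z Y :: "'a \<Rightarrow> real"
  assumes [measurable]: "Z \<in> borel_measurable M" "Y \<in> borel_measurable M"
    and Z: "integrable M (\<lambda>x. (Z x)\<^sup>2)"
    and orth: "integrable M (\<lambda>x. Z x * Y x) \<Longrightarrow> (\<integral>x. Z x * Y x \<partial>M) = 0"
  shows "(\<integral>\<^sup>+x. ennreal ((Z x)\<^sup>2) \<partial>M) \<le> (\<integral>\<^sup>+x. ennreal ((Z x + Y x)\<^sup>2) \<partial>M)"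
proof (cases "(\<integral>\<^sup>+x. ennreal ((Z x + Y x)\<^sup>2) \<partial>M) = \<infinity>")
  case False
  then have i: "integrable M (\<lambda>x. (Z x + Y x)\<^sup>2)"
    by (intro integrableI_nonneg) (auto simp: less_top)
  have Y: "integrable M (\<lambda>x. (Y x)\<^sup>2)"
  proof (rule Bochner_Integration.integrable_bound)
    show "integrable M (\<lambda>x. 2 * (Z x + Y x)\<^sup>2 + 2 * (Z x)\<^sup>2)" using i Z by simp
    have "(Y x)\<^sup>2 \<le> 2 * (Z x + Y x)\<^sup>2 + 2 * (Z x)\<^sup>2" for x
      using zero_le_power2[of "2 * Z x + Y x"] by (simp add: power2_eq_square algebra_simps)
    then show "AE x in M. norm ((Y x)\<^sup>2) \<le> norm (2 * (Z x + Y x)\<^sup>2 + 2 * (Z x)\<^sup>2)"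
      by (auto intro!: AE_I2)
  qed measurable
  have ZY: "integrable M (\<lambda>x. Z x * Y x)" by (rule integrable_mult_of_squares) (use Z Y in auto)
  have "(\<integral>x. (Z x + Y x)\<^sup>2 \<partial>M) = (\<integral>x. (Z x)\<^sup>2 + 2 * (Z x * Y x) + (Y x)\<^sup>2 \<partial>M)"
    by (simp add: power2_eq_square algebra_simps)
  also have "\<dots> = (\<integral>x. (Z x)\<^sup>2 \<partial>M) + (\<integral>x. (Y x)\<^sup>2 \<partial>M)"
    using Z ZY Y orth[OF ZY] by simp
  finally have "(\<integral>x. (Z x)\<^sup>2 \<partial>M) \<le> (\<integral>x. (Z x + Y x)\<^sup>2 \<partial>M)" by simp
  then show ?thesis
    using Z i by (simp add: nn_integral_eq_integral)
qed simp

text \<open>The ratio 3 between fourth moment and squared variance, valid also for the point mass at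
  0, will bound the part of the variance carried by an event of small probability.\<close>

lemma centered_gaussian_moments:
  assumes "centered_gaussian_real N"
  shows "sets N = sets borel" "integrable N (\<lambda>x. x ^ k)"
    "(\<integral>x. x ^ 4 \<partial>N) = 3 * (\<integral>x. x\<^sup>2 \<partial>N)\<^sup>2"
proof -
  have "sets N = sets borel \<and> integrable N (\<lambda>x. x ^ k) \<and> (\<integral>x. x ^ 4 \<partial>N) = 3 * (\<integral>x. x\<^sup>2 \<partial>N)\<^sup>2"
    using assms unfolding centered_gaussian_real_def
  proof (elim disjE exE conjE)
    assume N: "N = return borel 0"
    have "integrable N (\<lambda>x. x ^ k)" unfolding N by (simp add: integrable_iff_bounded nn_integral_return)
    then show ?thesis unfolding N by (simp add: integral_return)
  next
    fix \<sigma> :: real assume \<sigma>: "0 < \<sigma>" and N: "N = density lborel (\<lambda>x. ennreal (normal_density 0 \<sigma> x))"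
    have "integrable N (\<lambda>x. x ^ k)"
      unfolding N using integrable_normal_moment[OF \<sigma>, of 0 k]
      by (simp add: integrable_density)
    moreover have "(\<integral>x. x ^ 4 \<partial>N) = 3 * \<sigma> ^ 4"
      unfolding N using integral_normal_moment_even[OF \<sigma>, of 0 2] \<sigma>
      by (simp add: integral_density fact_numeral power_divide field_simps)
    moreover have "(\<integral>x. x\<^sup>2 \<partial>N) = \<sigma>\<^sup>2"
      unfolding N using integral_normal_moment_even[OF \<sigma>, of 0 1] \<sigma>
      by (simp add: integral_density fact_numeral power_divide)
    ultimately show ?thesis unfolding N by simp
  qed
  then show "sets N = sets borel" "integrable N (\<lambda>x. x ^ k)"
    "(\<integral>x. x ^ 4 \<partial>N) = 3 * (\<integral>x. x\<^sup>2 \<partial>N)\<^sup>2" by auto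
qed

text \<open>Variance 0 singles out the point mass, and a positive variance determines
  \<open>\<sigma> > 0\<close>.\<close>

lemma centered_gaussian_eqI:
  assumes "centered_gaussian_real N" "centered_gaussian_real N'"
    and eq: "(\<integral>x. x\<^sup>2 \<partial>N) = (\<integral>x. x\<^sup>2 \<partial>N')"
  shows "N = N'"
proof -
  have var: "(\<integral>x. x\<^sup>2 \<partial>density lborel (\<lambda>x. ennreal (normal_density 0 \<sigma> x))) = \<sigma>\<^sup>2" if "0 < \<sigma>" for \<sigma> :: real
    using integral_normal_moment_even[OF that, of 0 1] that
    by (simp add: integral_density fact_numeral power_divide)
  have var0: "(\<integral>x. x\<^sup>2 \<partial>return borel (0::real)) = 0"
    by (subst integral_return) auto
  show ?thesis
    using assms unfolding centered_gaussian_real_def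
    by (elim disjE exE conjE) (auto simp: var var0 power2_eq_iff_nonneg)
qed

section \<open>Gaussian measures and linear regression\<close>

lemma cont_lin_functional_add_scale:
  assumes "cont_lin_functional S L" "cont_lin_functional S L'"
  shows "cont_lin_functional S (\<lambda>f. a * L f + b * L' f)"
proof -
  from assms obtain K K' where K: "\<And>f. f \<in> S \<Longrightarrow> \<bar>L f\<bar> \<le> K * norm f" "\<And>f. f \<in> S \<Longrightarrow> \<bar>L' f\<bar> \<le> K' * norm f"
    unfolding cont_lin_functional_def by blast
  have "\<bar>a * L f + b * L' f\<bar> \<le> (\<bar>a\<bar> * K + \<bar>b\<bar> * K') * norm f" if "f \<in> S" for f
  proof -
    have "\<bar>a * L f + b * L' f\<bar> \<le> \<bar>a\<bar> * \<bar>L f\<bar> + \<bar>b\<bar> * \<bar>L' f\<bar>"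
      by (metis abs_mult abs_triangle_ineq)
    also have "\<dots> \<le> \<bar>a\<bar> * (K * norm f) + \<bar>b\<bar> * (K' * norm f)"
      by (intro add_mono mult_left_mono K that) auto
    finally show ?thesis by (simp add: algebra_simps)
  qed
  then have "\<exists>K. \<forall>f\<in>S. \<bar>a * L f + b * L' f\<bar> \<le> K * norm f" by blast
  then show ?thesis
    using assms unfolding cont_lin_functional_def by (simp add: algebra_simps)
qed

lemma cont_lin_functional_zero: "cont_lin_functional S (\<lambda>f. 0)"
  unfolding cont_lin_functional_def by (auto intro: exI[of _ 0])

lemma cont_lin_functional_sum:
  assumes "finite I" "\<And>i. i \<in> I \<Longrightarrow> cont_lin_functional S (L i)"
  shows "cont_lin_functional S (\<lambda>f. \<Sum>i\<in>I. b i * L i f)"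
  using assms
proof (induction I rule: finite_induct)
  case empty
  then show ?case by (simp add: cont_lin_functional_zero)
next
  case (insert k I)
  then show ?case
    using cont_lin_functional_add_scale[of S "L k" "\<lambda>f. \<Sum>i\<in>I. b i * L i f" "b k" 1] by simp
qed

lemma cont_lin_functional_continuous:
  fixes S :: "'f::real_normed_vector set"
  assumes S: "subspace S" and L: "cont_lin_functional S L"
  shows "continuous_on S L"
proof -
  from L obtain K where K: "\<And>f. f \<in> S \<Longrightarrow> \<bar>L f\<bar> \<le> K * norm f"
    unfolding cont_lin_functional_def by blast
  have L_diff: "L f - L g = L (f - g)" if "f \<in> S" "g \<in> S" for f g
  proof -
    have "L (f + (-1) *\<^sub>R g) = L f + L ((-1) *\<^sub>R g)"
      using L that S unfolding cont_lin_functional_def by (metis subspace_scale)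
    also have "L ((-1) *\<^sub>R g) = - L g"
      using L that unfolding cont_lin_functional_def by (metis mult_minus1)
    finally show ?thesis by simp
  qed
  have "\<bar>K\<bar>-lipschitz_on S L"
  proof (rule lipschitz_onI)
    fix f g assume fg: "f \<in> S" "g \<in> S"
    have "\<bar>L (f - g)\<bar> \<le> K * norm (f - g)" by (rule K) (use S fg in \<open>auto intro: subspace_diff\<close>)
    also have "\<dots> \<le> \<bar>K\<bar> * norm (f - g)" by (intro mult_right_mono) auto
    finally show "dist (L f) (L g) \<le> \<bar>K\<bar> * dist f g"
      using L_diff[OF fg] by (simp add: dist_norm)
  qed simp
  then show ?thesis by (rule lipschitz_on_continuous_on)
qed

locale gaussian_space = prob_space M for M :: "'f::real_normed_vector measure" +
  fixes S :: "'f set"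
  assumes subsp: "subspace S" and gauss: "zero_mean_gaussian S M"
begin

abbreviation "Lin \<equiv> cont_lin_functional S"

lemma sets_M: "sets M = sets (restrict_space borel S)"
  using gauss by (simp add: zero_mean_gaussian_def)

lemma space_M: "space M = S"
  using sets_eq_imp_space_eq[OF sets_M] by (simp add: space_restrict_space)

lemma Lin_measurable[measurable_dest]: "Lin L \<Longrightarrow> L \<in> borel_measurable M"
  using borel_measurable_continuous_on_restrict[OF cont_lin_functional_continuous[OF subsp]]
  by (simp add: measurable_cong_sets[OF sets_M refl])

lemma Lin_gauss: "Lin L \<Longrightarrow> centered_gaussian_real (distr M borel L)"
  using gauss by (simp add: zero_mean_gaussian_def)

lemma Lin_power_integrable: "Lin L \<Longrightarrow> integrable M (\<lambda>f. L f ^ k)"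
  using centered_gaussian_moments(2)[OF Lin_gauss, of L k] Lin_measurable[of L]
  by (simp add: integrable_distr_eq)

lemma Lin_integrable: "Lin L \<Longrightarrow> integrable M L"
  using Lin_power_integrable[of L 1] by simp

lemma Lin_mult_integrable: "Lin L \<Longrightarrow> Lin L' \<Longrightarrow> integrable M (\<lambda>f. L f * L' f)"
  by (rule integrable_mult_of_squares) (auto intro: Lin_power_integrable Lin_measurable)

lemma Lin_fourth_moment: "Lin L \<Longrightarrow> (\<integral>f. L f ^ 4 \<partial>M) = 3 * (\<integral>f. (L f)\<^sup>2 \<partial>M)\<^sup>2"
  using centered_gaussian_moments(3)[OF Lin_gauss, of L] Lin_measurable[of L]
  by (simp add: integral_distr)

text \<open>This is the access to joint behaviour: it is applied to different combinations of two
  functionals that have equal variance.\<close>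

lemma Lin_equal_law:
  assumes L: "Lin L" "Lin L'" and eq: "(\<integral>f. (L f)\<^sup>2 \<partial>M) = (\<integral>f. (L' f)\<^sup>2 \<partial>M)"
    and g: "g \<in> borel_measurable borel"
  shows "(\<integral>f. g (L f) \<partial>M) = (\<integral>f. g (L' f) \<partial>M :: real)"
proof -
  note [measurable] = L[THEN Lin_measurable] g
  have "distr M borel L = distr M borel L'"
    by (rule centered_gaussian_eqI[OF Lin_gauss Lin_gauss]) (use L eq in \<open>auto simp: integral_distr\<close>)
  then have "(\<integral>x. g x \<partial>distr M borel L) = (\<integral>x. g x \<partial>distr M borel L')" by simp
  then show ?thesis by (simp add: integral_distr)
qed

lemma Lin_sin: "Lin L \<Longrightarrow> (\<integral>f. sin (L f) \<partial>M) = 0"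
  using Lin_equal_law[of L "\<lambda>f. (-1) * L f + 0 * L f" sin] cont_lin_functional_add_scale[of S L L "-1" 0]
  by simp

text \<open>Replacing \<open>X\<close> by \<open>- X\<close> does not change the variance, hence not the law, of \<open>a Z + X\<close>;
  this gives the claim for \<open>sin (a Z)\<close> instead of \<open>Z\<close>, and one lets \<open>a\<close> tend to \<open>0\<close>.\<close>

lemma uncorrelated_trig:
  assumes Z: "Lin Z" and X: "Lin X" and ZX: "(\<integral>f. Z f * X f \<partial>M) = 0"
  shows "(\<integral>f. Z f * cos (X f) \<partial>M) = 0" "(\<integral>f. Z f * sin (X f) \<partial>M) = 0"
proof -
  note [measurable] = Z[THEN Lin_measurable] X[THEN Lin_measurable]
  have L: "Lin (\<lambda>f. a * Z f + b * X f)" for a b by (rule cont_lin_functional_add_scale[OF Z X])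
  have var: "(\<integral>f. (a * Z f + b * X f)\<^sup>2 \<partial>M) = a\<^sup>2 * (\<integral>f. (Z f)\<^sup>2 \<partial>M) + b\<^sup>2 * (\<integral>f. (X f)\<^sup>2 \<partial>M)" for a b
  proof -
    have "(a * Z f + b * X f)\<^sup>2 = a\<^sup>2 * (Z f)\<^sup>2 + b\<^sup>2 * (X f)\<^sup>2 + 2 * a * b * (Z f * X f)" for f
      by (simp add: power2_eq_square algebra_simps)
    then show ?thesis
      using Lin_power_integrable[OF Z, of 2] Lin_power_integrable[OF X, of 2] Lin_mult_integrable[OF Z X] ZX
      by simp
  qed
  have ic: "integrable M (\<lambda>f. cos (h f))" and isn: "integrable M (\<lambda>f. sin (h f))"
    if [measurable]: "h \<in> borel_measurable M" for h :: "'f \<Rightarrow> real"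
    by - (rule integrable_const_bound[where B=1]; simp)+
  have 1: "(\<integral>f. sin (a * Z f) * sin (X f) \<partial>M) = 0" for a
  proof -
    have "(\<integral>f. cos (a * Z f + 1 * X f) \<partial>M) = (\<integral>f. cos (a * Z f + (-1) * X f) \<partial>M)"
      by (rule Lin_equal_law[OF L L]) (auto simp only: var, auto)
    moreover have eq: "sin (a * Z f) * sin (X f) = (cos (a * Z f + (-1) * X f) - cos (a * Z f + 1 * X f)) / 2" for f
      by (simp add: cos_add cos_diff)
    ultimately show ?thesis
      unfolding eq by (simp add: ic)
  qed
  \<comment> \<open>A sign change of \<open>X\<close> gives nothing here, cosine being even. Instead
    the product is half a sum of sines of two centred Gaussian variables, and each of these has mean
    0 by symmetry.\<close>
  have 2: "(\<integral>f. sin (a * Z f) * cos (X f) \<partial>M) = 0" for a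
  proof -
    have eq: "sin (a * Z f) * cos (X f) = (sin (a * Z f + 1 * X f) + sin (a * Z f + (-1) * X f)) / 2" for f
      by (simp add: sin_add sin_diff)
    show ?thesis
      unfolding eq using Lin_sin[OF L[of a 1]] Lin_sin[OF L[of a "-1"]] by (simp add: isn)
  qed
  have lim: "(\<integral>f. Z f * h f \<partial>M) = 0"
    if z: "\<And>a. (\<integral>f. sin (a * Z f) * h f \<partial>M) = 0" and [measurable]: "h \<in> borel_measurable M" and h: "\<And>f. \<bar>h f\<bar> \<le> 1" for h
  proof -
    have "(\<lambda>n. \<integral>f. real (Suc n) * sin (inverse (real (Suc n)) * Z f) * h f \<partial>M) \<longlonglongrightarrow> (\<integral>f. Z f * h f \<partial>M)"
    proof (rule integral_dominated_convergence[where w = "\<lambda>f. \<bar>Z f\<bar>"])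
      show "integrable M (\<lambda>f. \<bar>Z f\<bar>)" using Lin_integrable[OF Z] by simp
      show "AE f in M. norm (real (Suc n) * sin (inverse (real (Suc n)) * Z f) * h f) \<le> \<bar>Z f\<bar>" for n
      proof (rule AE_I2)
        fix f
        have "\<bar>sin (inverse (real (Suc n)) * Z f)\<bar> \<le> \<bar>inverse (real (Suc n)) * Z f\<bar>" by (rule abs_sin_x_le_abs_x)
        then have "real (Suc n) * \<bar>sin (inverse (real (Suc n)) * Z f)\<bar> \<le> \<bar>Z f\<bar>"
          by (simp add: abs_mult field_simps)
        then have "(real (Suc n) * \<bar>sin (inverse (real (Suc n)) * Z f)\<bar>) * \<bar>h f\<bar> \<le> \<bar>Z f\<bar> * 1"
          using h by (intro mult_mono) auto
        then show "norm (real (Suc n) * sin (inverse (real (Suc n)) * Z f) * h f) \<le> \<bar>Z f\<bar>"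
          by (simp add: abs_mult)
      qed
      show "AE f in M. (\<lambda>n. real (Suc n) * sin (inverse (real (Suc n)) * Z f) * h f) \<longlonglongrightarrow> Z f * h f"
      proof (intro AE_I2 tendsto_mult tendsto_const)
        fix f
        have "((\<lambda>x. sin (x * Z f)) has_field_derivative Z f) (at 0)"
          by (auto intro!: derivative_eq_intros)
        then have "((\<lambda>h. sin (h * Z f) / h) \<longlongrightarrow> Z f) (at 0)"
          by (simp add: DERIV_def)
        then have "(\<lambda>n. sin (inverse (real (Suc n)) * Z f) / inverse (real (Suc n))) \<longlonglongrightarrow> Z f"
          by (rule filterlim_compose) (rule filterlim_atI[OF LIMSEQ_inverse_real_of_nat], simp)
        then show "(\<lambda>n. real (Suc n) * sin (inverse (real (Suc n)) * Z f)) \<longlonglongrightarrow> Z f"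
          by (simp add: field_simps)
      qed
    qed measurable
    moreover have "(\<integral>f. real (Suc n) * sin (inverse (real (Suc n)) * Z f) * h f \<partial>M) = 0" for n
      using z[of "inverse (real (Suc n))"] by (simp add: mult.assoc del: of_nat_Suc)
    ultimately show ?thesis by (simp add: LIMSEQ_const_iff)
  qed
  show "(\<integral>f. Z f * cos (X f) \<partial>M) = 0" by (rule lim[OF 2]) auto
  show "(\<integral>f. Z f * sin (X f) \<partial>M) = 0" by (rule lim[OF 1]) auto
qed

text \<open>\<open>Z\<close> is uncorrelated with every linear combination of the
  \<open>L i\<close>, so its trigonometric moments against them vanish and it is orthogonal to
  functions of the information. Hence no correction computed from the information, linear or not,
  decreases the mean square of \<open>Z\<close>.\<close>

lemma uncorrelated_error_le:
  fixes n :: nat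
  assumes Z: "Lin Z" and L: "\<And>i. i < n \<Longrightarrow> Lin (L i)"
    and ZL: "\<And>i. i < n \<Longrightarrow> (\<integral>f. Z f * L i f \<partial>M) = 0"
    and \<psi>[measurable]: "\<psi> \<in> borel_measurable (PiM {..<n} (\<lambda>_. lborel))"
  shows "(\<integral>\<^sup>+f. ennreal ((Z f)\<^sup>2) \<partial>M) \<le> (\<integral>\<^sup>+f. ennreal ((Z f + \<psi> (\<lambda>i\<in>{..<n}. L i f))\<^sup>2) \<partial>M)"
proof (rule nn_integral_square_orthogonal_le)
  have LX: "Lin (\<lambda>f. \<Sum>i<n. b i * L i f)" for b by (rule cont_lin_functional_sum) (auto intro: L)
  have ZX: "(\<integral>f. Z f * (\<Sum>i<n. b i * L i f) \<partial>M) = 0" for b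
  proof -
    have "(\<integral>f. Z f * (\<Sum>i<n. b i * L i f) \<partial>M) = (\<integral>f. (\<Sum>i<n. b i * (Z f * L i f)) \<partial>M)"
      by (simp add: sum_distrib_left mult_ac)
    also have "\<dots> = (\<Sum>i<n. b i * (\<integral>f. Z f * L i f \<partial>M))"
      by (subst Bochner_Integration.integral_sum) (use L Z in \<open>auto intro!: Lin_mult_integrable\<close>)
    finally show ?thesis using ZL by simp
  qed
  show "Z \<in> borel_measurable M" "integrable M (\<lambda>f. (Z f)\<^sup>2)"
    using Z by (auto intro: Lin_measurable Lin_power_integrable)
  have "(\<lambda>f. \<lambda>i\<in>{..<n}. L i f) \<in> M \<rightarrow>\<^sub>M PiM {..<n} (\<lambda>_. lborel)"
    by (rule measurable_restrict) (use L Lin_measurable in auto)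
  then show "(\<lambda>f. \<psi> (\<lambda>i\<in>{..<n}. L i f)) \<in> borel_measurable M"
    by measurable
  assume int: "integrable M (\<lambda>f. Z f * \<psi> (\<lambda>i\<in>{..<n}. L i f))"
  then show "(\<integral>f. Z f * \<psi> (\<lambda>i\<in>{..<n}. L i f) \<partial>M) = 0"
    by (intro fourier_orthogonal Lin_integrable[OF Z] prob_space_axioms Z uncorrelated_trig LX ZX \<psi> int)
       (use L Lin_measurable in auto)
qed

end

section \<open>Gaussian random functions on a probability space, for one fixed dimension\<close>

locale gaussian_approximation = gaussian_space M S + N: prob_space N
  for M :: "'f::real_normed_vector measure" and S and N :: "'x measure" +
  fixes ev :: "'f \<Rightarrow> 'x \<Rightarrow> real"
  assumes separable: "\<exists>C. countable C \<and> C \<subseteq> S \<and> S \<subseteq> closure C"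
    and ev_Lin: "x \<in> space N \<Longrightarrow> Lin (\<lambda>f. ev f x)"
    and ev_measurable: "f \<in> S \<Longrightarrow> ev f \<in> borel_measurable N"
    and ev_bounded: "\<exists>C. \<forall>f\<in>S. (\<integral>\<^sup>+x. ennreal ((ev f x)\<^sup>2) \<partial>N) \<le> ennreal ((C * norm f)\<^sup>2)"
begin

sublocale MN: pair_prob_space M N ..

lemma continuous_measurable_M:
  assumes "continuous_on UNIV g"
  shows "g \<in> borel_measurable M"
proof -
  have "g \<in> borel_measurable (restrict_space borel S)"
    by (intro measurable_restrict_space1 borel_measurable_continuous_onI assms)
  then show ?thesis by (simp add: measurable_cong_sets[OF sets_M refl])
qed

lemma norm_measurable: "norm \<in> borel_measurable M"
  by (rule continuous_measurable_M) (intro continuous_intros)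

text \<open>Evaluation is measurable in the point and continuous in \<open>f\<close>. Replacing
  \<open>f\<close> by the first member of a dense sequence within distance 1/(n+1) gives
  approximations with countably many values of the first argument, which are jointly measurable and
  converge pointwise.\<close>

lemma ev_joint: "(\<lambda>z. ev (fst z) (snd z)) \<in> borel_measurable (M \<Otimes>\<^sub>M N)"
proof -
  from separable obtain C where C: "countable C" "C \<subseteq> S" "S \<subseteq> closure C" by blast
  have "0 \<in> S" using subsp by (rule subspace_0)
  with C have "C \<noteq> {}" by auto
  define c where "c = from_nat_into C"
  have rc: "range c = C" unfolding c_def by (rule range_from_nat_into[OF \<open>C \<noteq> {}\<close> C(1)])
  have cS: "c i \<in> S" for i using rc C by auto
  define k where "k n f = (LEAST i. dist f (c i) < 1 / real (Suc n))" for n f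
  have [measurable]: "(\<lambda>f. dist f (c i)) \<in> borel_measurable M" for i
    by (rule continuous_measurable_M) (intro continuous_intros)
  have k[measurable]: "k n \<in> M \<rightarrow>\<^sub>M count_space UNIV" for n
    unfolding k_def[abs_def] by measurable
  have kd: "dist f (c (k n f)) < 1 / real (Suc n)" if "f \<in> S" for f n
  proof -
    have "f \<in> closure C" using that C by auto
    moreover have "0 < 1 / real (Suc n)" by simp
    ultimately obtain y where y: "y \<in> C" "dist y f < 1 / real (Suc n)"
      unfolding closure_approachable by blast
    then obtain i where "y = c i" using rc by blast
    with y have "dist f (c i) < 1 / real (Suc n)" by (simp add: dist_commute)
    then show ?thesis unfolding k_def by (rule LeastI)
  qed
  show ?thesis
  proof (rule borel_measurable_LIMSEQ_real)
    fix n
    show "(\<lambda>z. ev (c (k n (fst z))) (snd z)) \<in> borel_measurable (M \<Otimes>\<^sub>M N)"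
    proof (rule measurable_compose_countable[where f = "\<lambda>i z. ev (c i) (snd z)" and g = "\<lambda>z. k n (fst z)"])
      fix i
      note ev_measurable[OF cS, measurable]
      show "(\<lambda>z. ev (c i) (snd z)) \<in> borel_measurable (M \<Otimes>\<^sub>M N)" by measurable
    qed measurable
  next
    fix z assume "z \<in> space (M \<Otimes>\<^sub>M N)"
    then have f: "fst z \<in> S" and x: "snd z \<in> space N" by (auto simp: space_pair_measure space_M)
    have "(\<lambda>n. dist (c (k n (fst z))) (fst z)) \<longlonglongrightarrow> 0"
    proof (rule tendsto_sandwich[OF _ _ tendsto_const LIMSEQ_inverse_real_of_nat])
      show "\<forall>\<^sub>F n in sequentially. dist (c (k n (fst z))) (fst z) \<le> inverse (real (Suc n))"
        using kd[OF f] by (auto simp: dist_commute inverse_eq_divide intro!: always_eventually less_imp_le)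
    qed simp
    then have "(\<lambda>n. c (k n (fst z))) \<longlonglongrightarrow> fst z" by (rule tendsto_dist_iff[THEN iffD2])
    moreover have "continuous_on S (\<lambda>f. ev f (snd z))"
      by (rule cont_lin_functional_continuous[OF subsp ev_Lin[OF x]])
    ultimately show "(\<lambda>n. ev (c (k n (fst z))) (snd z)) \<longlonglongrightarrow> ev (fst z) (snd z)"
      using continuous_on_tendsto_compose[of S "\<lambda>f. ev f (snd z)" "\<lambda>n. c (k n (fst z))" "fst z" sequentially] f cS
      by simp
  qed
qed

lemma ev_measurable2[measurable (raw)]:
  assumes "g \<in> K \<rightarrow>\<^sub>M M" "h \<in> K \<rightarrow>\<^sub>M N"
  shows "(\<lambda>z. ev (g z) (h z)) \<in> borel_measurable K"
  using measurable_compose[OF measurable_Pair[OF assms] ev_joint] by simp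

text \<open>The variance function is integrable because, for a Gaussian variable, cutting off an event of
  probability at most \<open>1/12\<close> removes at most half of the second moment
  (the fourth moment is three times the squared second one).\<close>

lemma variance_integrable: "integrable N (\<lambda>x. \<integral>f. (ev f x)\<^sup>2 \<partial>M)"
proof -
  define v where "v x = (\<integral>f. (ev f x)\<^sup>2 \<partial>M)" for x
  have [measurable]: "v \<in> borel_measurable N" unfolding v_def[abs_def] by measurable
  note [measurable] = norm_measurable
  define A where "A n = {f \<in> space M. norm f \<le> real n}" for n
  have [measurable]: "A n \<in> sets M" for n unfolding A_def by measurable
  have "(\<lambda>n. prob (A n)) \<longlonglongrightarrow> prob (\<Union>n. A n)"
    by (rule finite_Lim_measure_incseq) (auto simp: A_def incseq_def)
  moreover have "(\<Union>n. A n) = space M"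
    using real_arch_simple by (auto simp: A_def)
  ultimately have "(\<lambda>n. prob (A n)) \<longlonglongrightarrow> 1" by (simp add: prob_space)
  then have "\<forall>\<^sub>F n in sequentially. prob (A n) > 11/12"
    by (rule order_tendstoD) simp
  then obtain n where n: "prob (A n) > 11/12"
    by (auto simp: eventually_sequentially)
  have nc: "prob (space M - A n) \<le> 1/12"
    using n by (subst prob_compl) auto
  have half: "v x \<le> 2 * (\<integral>f. indicator (A n) f * (ev f x)\<^sup>2 \<partial>M)" if x: "x \<in> space N" for x
  proof -
    note L = ev_Lin[OF x]
    have [measurable]: "(\<lambda>f. ev f x) \<in> borel_measurable M" by (rule Lin_measurable[OF L])
    have i2: "integrable M (\<lambda>f. (ev f x)\<^sup>2)" and i4: "integrable M (\<lambda>f. (ev f x) ^ 4)"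
      by (rule Lin_power_integrable[OF L])+
    have iA: "integrable M (\<lambda>f. indicator B f * (ev f x)\<^sup>2)" if [measurable]: "B \<in> sets M" for B
      using integrable_mult_bounded[OF i2, of "indicator B" 1] by (simp add: mult.commute indicator_def)
    have v0: "v x \<ge> 0" unfolding v_def by simp
    have "v x = (\<integral>f. indicator (A n) f * (ev f x)\<^sup>2 + indicator (space M - A n) f * (ev f x)\<^sup>2 \<partial>M)"
      unfolding v_def by (rule Bochner_Integration.integral_cong) (auto simp: indicator_def)
    also have "\<dots> = (\<integral>f. indicator (A n) f * (ev f x)\<^sup>2 \<partial>M) + (\<integral>f. indicator (space M - A n) f * (ev f x)\<^sup>2 \<partial>M)"
      by (simp add: iA)
    finally have split: "v x = (\<integral>f. indicator (A n) f * (ev f x)\<^sup>2 \<partial>M) + (\<integral>f. indicator (space M - A n) f * (ev f x)\<^sup>2 \<partial>M)" .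
    have iB: "integrable M (\<lambda>f. 36 * (v x)\<^sup>2 * indicator (space M - A n) f)"
      by (intro integrable_mult_right integrable_real_indicator) (auto simp: less_top[symmetric])
    \<comment> \<open>With \<open>y = (ev f x)\<^sup>2\<close> this integrates
      \<open>12 * v * y \<le> 36 * v\<^sup>2 + y\<^sup>2\<close> over the complement of the ball.
      The factor is chosen so that both terms on the right contribute \<open>3 * v\<^sup>2\<close>:
      36/12 from the probability, 3 from the fourth moment. The part cut off is thus at most
      \<open>v / 2\<close>.\<close>
    have "(\<integral>f. 12 * v x * (indicator (space M - A n) f * (ev f x)\<^sup>2) \<partial>M) \<le>
          (\<integral>f. 36 * (v x)\<^sup>2 * indicator (space M - A n) f + (ev f x) ^ 4 \<partial>M)"
    proof (rule integral_mono)
      show "integrable M (\<lambda>f. 12 * v x * (indicator (space M - A n) f * (ev f x)\<^sup>2))"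
        using iA[of "space M - A n"] by simp
      show "integrable M (\<lambda>f. 36 * (v x)\<^sup>2 * indicator (space M - A n) f + (ev f x) ^ 4)"
        by (rule Bochner_Integration.integrable_add[OF iB i4])
      fix f
      have "0 \<le> (6 * v x - (ev f x)\<^sup>2)\<^sup>2" by simp
      then have "12 * v x * (ev f x)\<^sup>2 \<le> 36 * (v x)\<^sup>2 + (ev f x) ^ 4"
        by (simp add: power2_eq_square power4_eq_xxxx algebra_simps)
      then show "12 * v x * (indicator (space M - A n) f * (ev f x)\<^sup>2) \<le>
          36 * (v x)\<^sup>2 * indicator (space M - A n) f + (ev f x) ^ 4"
        by (auto simp: indicator_def)
    qed
    also have "\<dots> = 36 * (v x)\<^sup>2 * prob (space M - A n) + 3 * (v x)\<^sup>2"
      unfolding Bochner_Integration.integral_add[OF iB i4] Lin_fourth_moment[OF L] by (simp add: v_def)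
    also have "\<dots> \<le> 36 * (v x)\<^sup>2 * (1/12) + 3 * (v x)\<^sup>2"
      by (intro add_right_mono mult_left_mono nc) simp
    finally have "12 * v x * (\<integral>f. indicator (space M - A n) f * (ev f x)\<^sup>2 \<partial>M) \<le> 12 * v x * (v x / 2)"
      by (simp add: power2_eq_square)
    then show ?thesis using split v0
      by (cases "v x = 0") (auto simp: mult_le_cancel_left_pos)
  qed
  obtain C where C: "\<And>f. f \<in> S \<Longrightarrow> (\<integral>\<^sup>+x. ennreal ((ev f x)\<^sup>2) \<partial>N) \<le> ennreal ((C * norm f)\<^sup>2)"
    using ev_bounded by blast
  have "(\<integral>\<^sup>+x. ennreal (v x) \<partial>N) \<le> (\<integral>\<^sup>+x. 2 * (\<integral>\<^sup>+f. indicator (A n) f * ennreal ((ev f x)\<^sup>2) \<partial>M) \<partial>N)"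
  proof (rule nn_integral_mono)
    fix x assume x: "x \<in> space N"
    have [measurable]: "(\<lambda>f. ev f x) \<in> borel_measurable M" by (rule Lin_measurable[OF ev_Lin[OF x]])
    have iA: "integrable M (\<lambda>f. indicator (A n) f * (ev f x)\<^sup>2)"
      using integrable_mult_bounded[OF Lin_power_integrable[OF ev_Lin[OF x], of 2], of "indicator (A n)" 1]
      by (simp add: mult.commute indicator_def)
    have "ennreal (v x) \<le> ennreal (2 * (\<integral>f. indicator (A n) f * (ev f x)\<^sup>2 \<partial>M))"
      by (rule ennreal_leI[OF half[OF x]])
    also have "\<dots> = 2 * (\<integral>\<^sup>+f. ennreal (indicator (A n) f * (ev f x)\<^sup>2) \<partial>M)"
      by (subst nn_integral_eq_integral[OF iA]) (auto simp: ennreal_mult')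
    also have "\<dots> = 2 * (\<integral>\<^sup>+f. indicator (A n) f * ennreal ((ev f x)\<^sup>2) \<partial>M)"
      by (intro arg_cong2[where f="(*)"] nn_integral_cong) (auto simp: indicator_def)
    finally show "ennreal (v x) \<le> 2 * (\<integral>\<^sup>+f. indicator (A n) f * ennreal ((ev f x)\<^sup>2) \<partial>M)" .
  qed
  also have "\<dots> = 2 * (\<integral>\<^sup>+x. (\<integral>\<^sup>+f. indicator (A n) f * ennreal ((ev f x)\<^sup>2) \<partial>M) \<partial>N)"
    by (rule nn_integral_cmult) measurable
  also have "(\<integral>\<^sup>+x. (\<integral>\<^sup>+f. indicator (A n) f * ennreal ((ev f x)\<^sup>2) \<partial>M) \<partial>N) =
      (\<integral>\<^sup>+f. (\<integral>\<^sup>+x. indicator (A n) f * ennreal ((ev f x)\<^sup>2) \<partial>N) \<partial>M)"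
    by (rule MN.Fubini') measurable
  \<comment> \<open>This is what the cut-off is for: with the integrals exchanged, the embedding
    bounds the inner one by a constant on the ball of radius \<open>n\<close>.\<close>
  also have "\<dots> \<le> (\<integral>\<^sup>+f. ennreal ((C * real n)\<^sup>2) \<partial>M)"
  proof (rule nn_integral_mono)
    fix f assume f: "f \<in> space M"
    have [measurable]: "ev f \<in> borel_measurable N" using f by (simp add: ev_measurable space_M)
    show "(\<integral>\<^sup>+x. indicator (A n) f * ennreal ((ev f x)\<^sup>2) \<partial>N) \<le> ennreal ((C * real n)\<^sup>2)"
    proof (cases "f \<in> A n")
      case True
      then have "(C * norm f)\<^sup>2 \<le> (C * real n)\<^sup>2"
        by (auto simp: A_def power_mult_distrib intro!: mult_left_mono power_mono)
      then show ?thesis using True C[of f] f by (auto simp: space_M intro: order_trans ennreal_leI)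
    qed simp
  qed
  also have "\<dots> = ennreal ((C * real n)\<^sup>2)" by (simp add: emeasure_space_1)
  finally have "(\<integral>\<^sup>+x. ennreal (v x) \<partial>N) \<le> 2 * ennreal ((C * real n)\<^sup>2)"
    by (simp add: mult_left_mono)
  also have "\<dots> < \<infinity>" by (simp add: ennreal_mult_less_top)
  finally have "(\<integral>\<^sup>+x. ennreal (v x) \<partial>N) < \<infinity>" .
  then have "integrable N v"
    by (intro integrableI_nonneg) (auto simp: v_def)
  then show ?thesis by (simp add: v_def[abs_def])
qed

end

lemma integral_linear_combination:
  fixes g :: "'i \<Rightarrow> 'a \<Rightarrow> real"
  assumes "\<And>j. j \<in> I \<Longrightarrow> integrable M (g j)"
  shows "integrable M (\<lambda>x. \<Sum>j\<in>I. a j * g j x)"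
    and "(\<integral>x. (\<Sum>j\<in>I. a j * g j x) \<partial>M) = (\<Sum>j\<in>I. a j * (\<integral>x. g j x \<partial>M))"
  using assms by (auto simp: Bochner_Integration.integral_sum intro!: Bochner_Integration.integrable_sum)

section \<open>Reduction of arbitrary algorithms to linear ones\<close>

context gaussian_approximation
begin

text \<open>Two orthogonalisations: that of the functionals in L_2 of the Gaussian measure yields,
  for each point \<open>x\<close>, the regression of \<open>ev f x\<close> as the sum of
  \<open>c j x * K j f\<close>; that of the coefficient functions \<open>c j\<close> in L_2 of
  \<open>N\<close> rewrites this sum with orthonormal \<open>v k\<close>. Optimality holds for each
  \<open>x\<close> separately and is then integrated over \<open>x\<close>.\<close>

lemma linear_algorithm_le:
  fixes n :: nat
  assumes Lin: "\<forall>i<n. Lin (L i)"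
    and \<phi>: "(\<lambda>(y, x). \<phi> y x) \<in> borel_measurable (PiM {..<n} (\<lambda>_. lborel) \<Otimes>\<^sub>M N)"
  shows "\<exists>m\<le>n. \<exists>v p. (\<forall>k<m. v k \<in> borel_measurable N \<and> integrable N (\<lambda>x. (v k x)\<^sup>2) \<and> Lin (p k)) \<and>
      (\<forall>i<m. \<forall>j<m. (\<integral>x. v i x * v j x \<partial>N) = (if i = j then 1 else 0)) \<and>
      (\<integral>\<^sup>+f. (\<integral>\<^sup>+x. ennreal ((ev f x - (\<Sum>k<m. p k f * v k x))\<^sup>2) \<partial>N) \<partial>M) \<le>
      (\<integral>\<^sup>+f. (\<integral>\<^sup>+x. ennreal ((ev f x - \<phi> (\<lambda>i\<in>{..<n}. L i f) x)\<^sup>2) \<partial>N) \<partial>M)"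
proof -
  have L: "\<And>i. i < n \<Longrightarrow> Lin (L i)" using Lin by blast
  let ?B = "\<lambda>f g :: 'f \<Rightarrow> real. \<integral>x. f x * g x \<partial>M"
  have "\<exists>m\<le>n. \<exists>v a. (\<forall>j<m. v j \<in> Collect Lin) \<and>
           (\<forall>i<m. \<forall>j<m. ?B (v i) (v j) = (if i = j then 1 else 0)) \<and>
           (\<forall>i<n. (\<lambda>x. L i x - (\<Sum>j<m. a i j * v j x)) \<in> Collect Lin \<and>
              ?B (\<lambda>x. L i x - (\<Sum>j<m. a i j * v j x)) (\<lambda>x. L i x - (\<Sum>j<m. a i j * v j x)) = 0)"
  proof (rule gram_schmidt_semidefinite[where B = ?B and S = "Collect Lin"])
    fix a b and f g h :: "'f \<Rightarrow> real"
    assume fgh: "f \<in> Collect Lin" "g \<in> Collect Lin" "h \<in> Collect Lin"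
    have "?B (\<lambda>x. a * f x + b * g x) h = (\<integral>x. a * (f x * h x) + b * (g x * h x) \<partial>M)"
      by (simp add: algebra_simps)
    then show "?B (\<lambda>x. a * f x + b * g x) h = a * ?B f h + b * ?B g h"
      using fgh Lin_mult_integrable[of f h] Lin_mult_integrable[of g h] by simp
  qed (use L in \<open>auto simp: mult.commute intro: cont_lin_functional_add_scale\<close>)
  then obtain m K a where m: "m \<le> n" and K: "\<And>j. j < m \<Longrightarrow> Lin (K j)"
    and onK: "\<And>i j. i < m \<Longrightarrow> j < m \<Longrightarrow> ?B (K i) (K j) = (if i = j then 1 else 0)"
    and rL: "\<And>i. i < n \<Longrightarrow> Lin (\<lambda>x. L i x - (\<Sum>j<m. a i j * K j x))"
    and r0: "\<And>i. i < n \<Longrightarrow> ?B (\<lambda>x. L i x - (\<Sum>j<m. a i j * K j x)) (\<lambda>x. L i x - (\<Sum>j<m. a i j * K j x)) = 0"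
    by (elim exE conjE) (simp only: mem_Collect_eq, blast)
  note [measurable] = K[THEN Lin_measurable] L[THEN Lin_measurable]

  define c where "c j x = (\<integral>f. ev f x * K j f \<partial>M)" for j x
  have c_meas[measurable]: "c j \<in> borel_measurable N" if "j < m" for j
  proof -
    have [measurable]: "K j \<in> borel_measurable M" using K that by (simp add: Lin_measurable)
    show ?thesis unfolding c_def[abs_def] by measurable
  qed
  define Z where "Z x f = ev f x - (\<Sum>j<m. c j x * K j f)" for x f
  have ZLin: "Lin (Z x)" if x: "x \<in> space N" for x
  proof -
    have "Lin (\<lambda>f. 1 * ev f x + (-1) * (\<Sum>j<m. c j x * K j f))"
      by (intro cont_lin_functional_add_scale ev_Lin[OF x] cont_lin_functional_sum) (use K in auto)
    then show ?thesis by (simp add: Z_def[abs_def])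
  qed
  have ZK: "(\<integral>f. Z x f * K i f \<partial>M) = 0" if x: "x \<in> space N" and i: "i < m" for x i
  proof -
    have 1: "integrable M (\<lambda>f. ev f x * K i f)" by (intro Lin_mult_integrable ev_Lin x K i)
    have 2: "integrable M (\<lambda>f. K j f * K i f)" if "j < m" for j
      using Lin_mult_integrable[OF K[OF that] K[OF i]] by simp
    have "(\<integral>f. Z x f * K i f \<partial>M) = (\<integral>f. ev f x * K i f - (\<Sum>j<m. c j x * (K j f * K i f)) \<partial>M)"
      by (simp add: Z_def left_diff_distrib sum_distrib_right mult.assoc)
    also have "\<dots> = c i x - (\<Sum>j<m. c j x * (\<integral>f. K j f * K i f \<partial>M))"
      by (subst Bochner_Integration.integral_diff[OF 1 integral_linear_combination(1)], rule 2, simp,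
          subst integral_linear_combination(2), rule 2, simp, simp add: c_def)
    also have "(\<Sum>j<m. c j x * (\<integral>f. K j f * K i f \<partial>M)) = (\<Sum>j<m. if j = i then c j x else 0)"
      by (rule sum.cong) (use onK i in auto)
    finally show ?thesis using i by simp
  qed
  \<comment> \<open>Each \<open>L i\<close> is a combination of the \<open>K j\<close> only almost
    surely, which is enough for the covariances with \<open>Z x\<close>.\<close>
  have ZL: "(\<integral>f. Z x f * L i f \<partial>M) = 0" if x: "x \<in> space N" and i: "i < n" for x i
  proof -
    let ?r = "\<lambda>f. L i f - (\<Sum>j<m. a i j * K j f)"
    have "integrable M (\<lambda>f. ?r f * ?r f)" by (rule Lin_mult_integrable[OF rL[OF i] rL[OF i]])
    then have "AE f in M. ?r f * ?r f = 0"
      using r0[OF i] by (subst (asm) integral_nonneg_eq_0_iff_AE) auto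
    then have AE: "AE f in M. ?r f = 0" by simp
    have 2: "integrable M (\<lambda>f. Z x f * K j f)" if "j < m" for j
      using Lin_mult_integrable[OF ZLin[OF x] K[OF that]] by simp
    have "(\<integral>f. Z x f * L i f \<partial>M) = (\<integral>f. (\<Sum>j<m. a i j * (Z x f * K j f)) \<partial>M)"
    proof (rule integral_cong_AE)
      show "(\<lambda>f. Z x f * L i f) \<in> borel_measurable M"
        using Lin_mult_integrable[OF ZLin[OF x] L[OF i]] by auto
      show "(\<lambda>f. \<Sum>j<m. a i j * (Z x f * K j f)) \<in> borel_measurable M"
        using 2 by (intro borel_measurable_integrable integral_linear_combination(1)) auto
      show "AE f in M. Z x f * L i f = (\<Sum>j<m. a i j * (Z x f * K j f))"
        using AE by eventually_elim (simp add: sum_distrib_left mult_ac)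
    qed
    also have "\<dots> = (\<Sum>j<m. a i j * (\<integral>f. Z x f * K j f \<partial>M))"
      using 2 by (intro integral_linear_combination(2)) auto
    finally show ?thesis using ZK[OF x] by simp
  qed

  \<comment> \<open>Bessel's inequality for one orthonormal functional; together with the integrable
    variance it places \<open>c j\<close> in L_2.\<close>
  have c_bound: "(c j x)\<^sup>2 \<le> (\<integral>f. (ev f x)\<^sup>2 \<partial>M)" if x: "x \<in> space N" and j: "j < m" for x j
  proof -
    have "0 \<le> (\<integral>f. (ev f x - c j x * K j f)\<^sup>2 \<partial>M)" by simp
    also have "\<dots> = (\<integral>f. (ev f x)\<^sup>2 - 2 * c j x * (ev f x * K j f) + (c j x)\<^sup>2 * (K j f * K j f) \<partial>M)"
      by (simp add: power2_eq_square algebra_simps)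
    also have "\<dots> = (\<integral>f. (ev f x)\<^sup>2 \<partial>M) - 2 * c j x * c j x + (c j x)\<^sup>2 * 1"
      using Lin_power_integrable[OF ev_Lin[OF x], of 2] Lin_mult_integrable[OF ev_Lin[OF x] K[OF j]]
        Lin_mult_integrable[OF K[OF j] K[OF j]] onK[OF j j] by (simp add: c_def)
    finally show ?thesis by (simp add: power2_eq_square)
  qed
  have c_int: "integrable N (\<lambda>x. (c j x)\<^sup>2)" if j: "j < m" for j
  proof (rule Bochner_Integration.integrable_bound[OF variance_integrable])
    show "(\<lambda>x. (c j x)\<^sup>2) \<in> borel_measurable N" using c_meas[OF j] by simp
    show "AE x in N. norm ((c j x)\<^sup>2) \<le> norm (\<integral>f. (ev f x)\<^sup>2 \<partial>M)"
      using c_bound j by (intro AE_I2) fastforce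
  qed

  let ?S = "{g :: 'x \<Rightarrow> real. g \<in> borel_measurable N \<and> integrable N (\<lambda>x. (g x)\<^sup>2)}"
  let ?C = "\<lambda>f g :: 'x \<Rightarrow> real. \<integral>x. f x * g x \<partial>N"
  have prodI: "integrable N (\<lambda>x. f x * g x)" if "f \<in> ?S" "g \<in> ?S" for f g
    using that by (intro integrable_mult_of_squares) auto
  have "\<exists>m'\<le>m. \<exists>v b. (\<forall>j<m'. v j \<in> ?S) \<and>
           (\<forall>i<m'. \<forall>j<m'. ?C (v i) (v j) = (if i = j then 1 else 0)) \<and>
           (\<forall>i<m. (\<lambda>x. c i x - (\<Sum>j<m'. b i j * v j x)) \<in> ?S \<and>
              ?C (\<lambda>x. c i x - (\<Sum>j<m'. b i j * v j x)) (\<lambda>x. c i x - (\<Sum>j<m'. b i j * v j x)) = 0)"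
  proof (rule gram_schmidt_semidefinite[where B = ?C and S = ?S])
    fix a b and f g :: "'x \<Rightarrow> real"
    assume fg: "f \<in> ?S" "g \<in> ?S"
    have "(a * f x + b * g x)\<^sup>2 = a\<^sup>2 * (f x)\<^sup>2 + b\<^sup>2 * (g x)\<^sup>2 + 2 * a * b * (f x * g x)" for x
      by (simp add: power2_eq_square algebra_simps)
    then show "(\<lambda>x. a * f x + b * g x) \<in> ?S"
      using fg prodI[OF fg] by (auto intro!: borel_measurable_add borel_measurable_times)
  next
    fix a b and f g h :: "'x \<Rightarrow> real"
    assume fgh: "f \<in> ?S" "g \<in> ?S" "h \<in> ?S"
    have "?C (\<lambda>x. a * f x + b * g x) h = (\<integral>x. a * (f x * h x) + b * (g x * h x) \<partial>N)"
      by (simp add: algebra_simps)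
    then show "?C (\<lambda>x. a * f x + b * g x) h = a * ?C f h + b * ?C g h"
      using prodI[of f h] prodI[of g h] fgh by simp
  qed (use c_int c_meas in \<open>auto simp: mult.commute\<close>)
  then obtain m' v b where m': "m' \<le> m" and v: "\<And>j. j < m' \<Longrightarrow> v j \<in> ?S"
    and onv: "\<And>i j. i < m' \<Longrightarrow> j < m' \<Longrightarrow> ?C (v i) (v j) = (if i = j then 1 else 0)"
    and rS: "\<And>i. i < m \<Longrightarrow> (\<lambda>x. c i x - (\<Sum>j<m'. b i j * v j x)) \<in> ?S"
    and r0': "\<And>i. i < m \<Longrightarrow> ?C (\<lambda>x. c i x - (\<Sum>j<m'. b i j * v j x)) (\<lambda>x. c i x - (\<Sum>j<m'. b i j * v j x)) = 0"
    by (elim exE conjE) blast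
  define p where "p k f = (\<Sum>j<m. b j k * K j f)" for k f
  have pLin: "Lin (p k)" for k
    unfolding p_def[abs_def] by (rule cont_lin_functional_sum) (use K in auto)
  have AEc: "AE x in N. \<forall>j<m. c j x = (\<Sum>k<m'. b j k * v k x)"
  proof -
    have "AE x in N. c j x = (\<Sum>k<m'. b j k * v k x)" if j: "j < m" for j
    proof -
      have "AE x in N. (c j x - (\<Sum>k<m'. b j k * v k x)) * (c j x - (\<Sum>k<m'. b j k * v k x)) = 0"
        using r0'[OF j] prodI[OF rS[OF j] rS[OF j]] by (subst (asm) integral_nonneg_eq_0_iff_AE) auto
      then show ?thesis by simp
    qed
    then have "AE x in N. \<forall>j\<in>{..<m}. c j x = (\<Sum>k<m'. b j k * v k x)"
      by (intro AE_finite_allI) auto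
    then show ?thesis by (simp only: Ball_def lessThan_iff)
  qed
  \<comment> \<open>The null set where the \<open>c j\<close> differ from their expansions does not
    depend on \<open>f\<close>, so this identity is available for every \<open>f\<close>.\<close>
  have Z_eq: "(\<integral>\<^sup>+x. ennreal ((ev f x - (\<Sum>k<m'. p k f * v k x))\<^sup>2) \<partial>N) = (\<integral>\<^sup>+x. ennreal ((Z x f)\<^sup>2) \<partial>N)" for f
  proof (rule nn_integral_cong_AE)
    show "AE x in N. ennreal ((ev f x - (\<Sum>k<m'. p k f * v k x))\<^sup>2) = ennreal ((Z x f)\<^sup>2)"
      using AEc
    proof eventually_elim
      case (elim x)
      have "(\<Sum>k<m'. p k f * v k x) = (\<Sum>k<m'. \<Sum>j<m. b j k * v k x * K j f)"
        by (simp add: p_def sum_distrib_left sum_distrib_right mult_ac)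
      also have "\<dots> = (\<Sum>j<m. \<Sum>k<m'. b j k * v k x * K j f)" by (rule sum.swap)
      also have "\<dots> = (\<Sum>j<m. c j x * K j f)"
        using elim by (simp add: sum_distrib_right)
      finally show ?case by (simp add: Z_def)
    qed
  qed

  have mP[measurable]: "(\<lambda>f. \<lambda>i\<in>{..<n}. L i f) \<in> M \<rightarrow>\<^sub>M PiM {..<n} (\<lambda>_. lborel)"
    by (rule measurable_restrict) (use L Lin_measurable in auto)
  have pointwise: "(\<integral>\<^sup>+f. ennreal ((Z x f)\<^sup>2) \<partial>M) \<le>
      (\<integral>\<^sup>+f. ennreal ((ev f x - \<phi> (\<lambda>i\<in>{..<n}. L i f) x)\<^sup>2) \<partial>M)" if x: "x \<in> space N" for x
  proof -
    \<comment> \<open>The regression has to be expressed through the information, but the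
      orthogonalisation gives the \<open>L i\<close> in terms of the \<open>K j\<close> and not
      conversely. So the information is enlarged by the \<open>K j\<close>, with which
      \<open>Z x\<close> is uncorrelated too. \<open>\<psi>\<close> adds the regression back and
      subtracts the given algorithm.\<close>
    define L' where "L' i = (if i < n then L i else K (i - n))" for i
    define \<psi> where "\<psi> y = (\<Sum>j<m. c j x * y (n + j)) - \<phi> (restrict y {..<n}) x" for y :: "nat \<Rightarrow> real"
    have r: "(\<lambda>y. restrict y {..<n}) \<in> PiM {..<n + m} (\<lambda>_. lborel) \<rightarrow>\<^sub>M PiM {..<n} (\<lambda>_. lborel :: real measure)"
      by (rule measurable_restrict_subset) auto
    have "(\<lambda>y. (restrict y {..<n}, x)) \<in> PiM {..<n + m} (\<lambda>_. lborel) \<rightarrow>\<^sub>M PiM {..<n} (\<lambda>_. lborel :: real measure) \<Otimes>\<^sub>M N"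
      using r x by (intro measurable_Pair) auto
    from measurable_compose[OF this \<phi>]
    have \<phi>'[measurable]: "(\<lambda>y. \<phi> (restrict y {..<n}) x) \<in> borel_measurable (PiM {..<n + m} (\<lambda>_. lborel))" by simp
    have [measurable]: "\<psi> \<in> borel_measurable (PiM {..<n + m} (\<lambda>_. lborel))"
      unfolding \<psi>_def[abs_def]
      by (intro borel_measurable_diff borel_measurable_sum borel_measurable_times \<phi>' borel_measurable_const)
         (auto intro!: measurable_component_singleton[where M="\<lambda>_. lborel", simplified])
    have "(\<integral>\<^sup>+f. ennreal ((Z x f)\<^sup>2) \<partial>M) \<le> (\<integral>\<^sup>+f. ennreal ((Z x f + \<psi> (\<lambda>i\<in>{..<n + m}. L' i f))\<^sup>2) \<partial>M)"
    proof (rule uncorrelated_error_le[OF ZLin[OF x]])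
      fix i assume i: "i < n + m"
      show "Lin (L' i)" using i L K by (auto simp: L'_def)
      show "(\<integral>f. Z x f * L' i f \<partial>M) = 0" using i ZL[OF x] ZK[OF x] by (auto simp: L'_def)
    qed measurable
    also have "\<dots> = (\<integral>\<^sup>+f. ennreal ((ev f x - \<phi> (\<lambda>i\<in>{..<n}. L i f) x)\<^sup>2) \<partial>M)"
    proof (rule nn_integral_cong)
      fix f
      have "restrict (\<lambda>i\<in>{..<n + m}. L' i f) {..<n} = (\<lambda>i\<in>{..<n}. L i f)"
        by (auto simp: L'_def restrict_def)
      then have "Z x f + \<psi> (\<lambda>i\<in>{..<n + m}. L' i f) = ev f x - \<phi> (\<lambda>i\<in>{..<n}. L i f) x"
        by (simp add: Z_def \<psi>_def L'_def)
      then show "ennreal ((Z x f + \<psi> (\<lambda>i\<in>{..<n + m}. L' i f))\<^sup>2) = ennreal ((ev f x - \<phi> (\<lambda>i\<in>{..<n}. L i f) x)\<^sup>2)"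
        by simp
    qed
    finally show ?thesis .
  qed
  have KK[measurable]: "K j \<in> borel_measurable M" if "j < m" for j using K that by (simp add: Lin_measurable)
  have ZM: "(\<lambda>z. ennreal ((Z (snd z) (fst z))\<^sup>2)) \<in> borel_measurable (M \<Otimes>\<^sub>M N)"
  proof -
    have "(\<lambda>z. \<Sum>j<m. c j (snd z) * K j (fst z)) \<in> borel_measurable (M \<Otimes>\<^sub>M N)"
    proof (rule borel_measurable_sum)
      fix j assume "j \<in> {..<m}"
      then have [measurable]: "c j \<in> borel_measurable N" "K j \<in> borel_measurable M"
        using c_meas KK by auto
      show "(\<lambda>z. c j (snd z) * K j (fst z)) \<in> borel_measurable (M \<Otimes>\<^sub>M N)" by measurable
    qed
    note [measurable] = this
    show ?thesis unfolding Z_def by measurable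
  qed
  have "(\<lambda>z. (\<lambda>i\<in>{..<n}. L i (fst z), snd z)) \<in> M \<Otimes>\<^sub>M N \<rightarrow>\<^sub>M PiM {..<n} (\<lambda>_. lborel) \<Otimes>\<^sub>M N"
    using measurable_compose[OF measurable_fst mP, of N] by (intro measurable_Pair) auto
  from measurable_compose[OF this \<phi>]
  have \<phi>2[measurable]: "(\<lambda>z. \<phi> (\<lambda>i\<in>{..<n}. L i (fst z)) (snd z)) \<in> borel_measurable (M \<Otimes>\<^sub>M N)" by simp
  have eM: "(\<lambda>z. ennreal ((ev (fst z) (snd z) - \<phi> (\<lambda>i\<in>{..<n}. L i (fst z)) (snd z))\<^sup>2)) \<in> borel_measurable (M \<Otimes>\<^sub>M N)"
    by measurable
  have "(\<integral>\<^sup>+f. (\<integral>\<^sup>+x. ennreal ((ev f x - (\<Sum>k<m'. p k f * v k x))\<^sup>2) \<partial>N) \<partial>M) =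
      (\<integral>\<^sup>+f. (\<integral>\<^sup>+x. ennreal ((Z x f)\<^sup>2) \<partial>N) \<partial>M)"
    by (simp add: Z_eq)
  also have "\<dots> = (\<integral>\<^sup>+x. (\<integral>\<^sup>+f. ennreal ((Z x f)\<^sup>2) \<partial>M) \<partial>N)"
    using MN.Fubini'[of "\<lambda>f x. ennreal ((Z x f)\<^sup>2)"] ZM by (simp add: split_beta')
  also have "\<dots> \<le> (\<integral>\<^sup>+x. (\<integral>\<^sup>+f. ennreal ((ev f x - \<phi> (\<lambda>i\<in>{..<n}. L i f) x)\<^sup>2) \<partial>M) \<partial>N)"
    by (rule nn_integral_mono) (rule pointwise)
  also have "\<dots> = (\<integral>\<^sup>+f. (\<integral>\<^sup>+x. ennreal ((ev f x - \<phi> (\<lambda>i\<in>{..<n}. L i f) x)\<^sup>2) \<partial>N) \<partial>M)"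
    using MN.Fubini'[of "\<lambda>f x. ennreal ((ev f x - \<phi> (\<lambda>i\<in>{..<n}. L i f) x)\<^sup>2)"] eM by (simp add: split_beta')
  finally show ?thesis
    using m m' v onv pLin by (intro exI[of _ m'] conjI exI[of _ v] exI[of _ p]) auto
qed

end

section \<open>Well-conditioned sampling points\<close>

text \<open>With respect to the probability density \<open>w\<close> the mean of \<open>q\<close> is
  at most \<open>\<kappa>\<close>, so \<open>q\<close> cannot exceed \<open>\<kappa>\<close>
  everywhere; equality is excluded because a strictly positive function has no zero integral on a
  probability space.\<close>

lemma (in prob_space) exists_le_weighted_average:
  fixes q w :: "'a \<Rightarrow> real"
  assumes w: "\<And>x. x \<in> space M \<Longrightarrow> 0 < w x" "integrable M w" "(\<integral>x. w x \<partial>M) = 1"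
    and q: "has_bochner_integral M (\<lambda>x. q x * w x) I" and I: "I \<le> \<kappa>"
  shows "\<exists>x\<in>space M. q x \<le> \<kappa>"
proof (rule ccontr)
  assume "\<not> ?thesis"
  then have gt: "\<And>x. x \<in> space M \<Longrightarrow> \<kappa> < q x" by force
  have qi: "integrable M (\<lambda>x. q x * w x)" and qI: "(\<integral>x. q x * w x \<partial>M) = I"
    using q by (auto simp: has_bochner_integral_iff)
  have int: "integrable M (\<lambda>x. q x * w x - \<kappa> * w x)" using qi w by simp
  have pos: "0 < q x * w x - \<kappa> * w x" if "x \<in> space M" for x
    using mult_strict_right_mono[OF gt[OF that] w(1)[OF that]] by simp
  have "(\<integral>x. q x * w x - \<kappa> * w x \<partial>M) = I - \<kappa>" using qi w qI by simp
  moreover have "0 \<le> (\<integral>x. q x * w x - \<kappa> * w x \<partial>M)"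
    by (rule Bochner_Integration.integral_nonneg) (use pos less_imp_le in blast)
  ultimately have "(\<integral>x. q x * w x - \<kappa> * w x \<partial>M) = 0" using I by simp
  moreover have "AE x in M. 0 \<le> q x * w x - \<kappa> * w x"
    by (rule AE_I2) (use pos less_imp_le in blast)
  ultimately have "AE x in M. q x * w x - \<kappa> * w x = 0"
    using integral_nonneg_eq_0_iff_AE[OF int] by blast
  moreover have "AE x in M. q x * w x - \<kappa> * w x > 0" using pos by (rule AE_I2)
  ultimately have "AE x in M. False" by eventually_elim linarith
  then show False using AE_False by simp
qed

locale orthonormal_system = prob_space N for N :: "'x measure" +
  fixes m :: nat and v :: "nat \<Rightarrow> 'x \<Rightarrow> real"
  assumes v_meas: "\<And>k. k < m \<Longrightarrow> v k \<in> borel_measurable N"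
    and v_sq: "\<And>k. k < m \<Longrightarrow> integrable N (\<lambda>x. (v k x)\<^sup>2)"
    and v_on: "\<And>k l. k < m \<Longrightarrow> l < m \<Longrightarrow> (\<integral>x. v k x * v l x \<partial>N) = (if k = l then 1 else 0)"
begin

text \<open>The normalised Christoffel function of the system; the summand \<open>1\<close> keeps it away from zero.\<close>

definition \<omega> :: "'x \<Rightarrow> real" where
  "\<omega> x = ((\<Sum>k<m. (v k x)\<^sup>2) + 1) / (real m + 1)"

lemma \<omega>_pos: "0 < \<omega> x"
proof -
  have "0 \<le> (\<Sum>k<m. (v k x)\<^sup>2)" by (rule sum_nonneg) simp
  then show ?thesis by (simp add: \<omega>_def)
qed

lemma \<omega>_meas[measurable]: "\<omega> \<in> borel_measurable N"
  unfolding \<omega>_def[abs_def] using v_meas by simp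

lemma v_prod: "k < m \<Longrightarrow> l < m \<Longrightarrow> integrable N (\<lambda>x. v k x * v l x)"
  by (rule integrable_mult_of_squares) (auto intro: v_meas v_sq)

lemma v_sq_integral: "k < m \<Longrightarrow> (\<integral>x. (v k x)\<^sup>2 \<partial>N) = 1"
  using v_on[of k k] by (simp add: power2_eq_square)

lemma \<omega>_integrable: "integrable N \<omega>" and \<omega>_integral: "(\<integral>x. \<omega> x \<partial>N) = 1"
proof -
  have i: "integrable N (\<lambda>x. \<Sum>k<m. (v k x)\<^sup>2)" using v_sq by auto
  then show "integrable N \<omega>" unfolding \<omega>_def[abs_def] by simp
  have "(\<integral>x. (\<Sum>k<m. (v k x)\<^sup>2) \<partial>N) = (\<Sum>k<m. (\<integral>x. (v k x)\<^sup>2 \<partial>N))"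
    by (rule Bochner_Integration.integral_sum) (use v_sq in auto)
  also have "\<dots> = real m" using v_sq_integral by simp
  finally show "(\<integral>x. \<omega> x \<partial>N) = 1"
    unfolding \<omega>_def[abs_def] using i by (simp add: prob_space)
qed

lemma sum_sq_le_\<omega>: "(\<Sum>k<m. (v k x)\<^sup>2) \<le> (real m + 1) * \<omega> x"
  by (simp add: \<omega>_def)

lemma fourth_order_integrable:
  assumes k: "k < m" and l: "l < m"
  shows "integrable N (\<lambda>x. (v k x * v l x)\<^sup>2 / \<omega> x)"
proof (rule Bochner_Integration.integrable_bound)
  show "integrable N (\<lambda>x. (real m + 1) * (v k x)\<^sup>2)" using v_sq[OF k] by simp
  have [measurable]: "v k \<in> borel_measurable N" "v l \<in> borel_measurable N" using v_meas k l by auto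
  show "(\<lambda>x. (v k x * v l x)\<^sup>2 / \<omega> x) \<in> borel_measurable N" by measurable
  show "AE x in N. norm ((v k x * v l x)\<^sup>2 / \<omega> x) \<le> norm ((real m + 1) * (v k x)\<^sup>2)"
  proof (rule AE_I2)
    fix x
    have "(v l x)\<^sup>2 \<le> (\<Sum>k<m. (v k x)\<^sup>2)"
      by (rule member_le_sum) (use l in auto)
    then have "(v l x)\<^sup>2 \<le> (real m + 1) * \<omega> x" using sum_sq_le_\<omega>[of x] by linarith
    then have "(v k x)\<^sup>2 * (v l x)\<^sup>2 \<le> (v k x)\<^sup>2 * ((real m + 1) * \<omega> x)" by (rule mult_left_mono) simp
    then show "norm ((v k x * v l x)\<^sup>2 / \<omega> x) \<le> norm ((real m + 1) * (v k x)\<^sup>2)"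
      using \<omega>_pos[of x] by (simp add: power_mult_distrib divide_le_eq mult_ac)
  qed
qed

text \<open>The left side is the mean squared Frobenius norm of the matrix
  \<open>v k x * v l x / \<omega> x\<close> for \<open>x\<close> of density \<open>\<omega>\<close>.
  With V the sum of the squares of the \<open>v k x\<close>, the integrand is
  \<open>V\<^sup>2 / \<omega>\<close>. Since V is at most \<open>(m + 1) * \<omega>\<close>, one
  factor V cancels and second moments of the \<open>v k\<close> suffice.\<close>

lemma fourth_order_integral_le:
  "(\<Sum>k<m. \<Sum>l<m. (\<integral>x. (v k x * v l x)\<^sup>2 / \<omega> x \<partial>N)) \<le> (real m + 1) * real m"
proof -
  have "(\<Sum>k<m. \<Sum>l<m. (\<integral>x. (v k x * v l x)\<^sup>2 / \<omega> x \<partial>N)) =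
      (\<integral>x. (\<Sum>k<m. \<Sum>l<m. (v k x * v l x)\<^sup>2 / \<omega> x) \<partial>N)"
  proof -
    have "(\<integral>x. (\<Sum>k<m. \<Sum>l<m. (v k x * v l x)\<^sup>2 / \<omega> x) \<partial>N) =
        (\<Sum>k<m. (\<integral>x. (\<Sum>l<m. (v k x * v l x)\<^sup>2 / \<omega> x) \<partial>N))"
      by (rule Bochner_Integration.integral_sum) (auto intro!: Bochner_Integration.integrable_sum fourth_order_integrable)
    also have "\<dots> = (\<Sum>k<m. \<Sum>l<m. (\<integral>x. (v k x * v l x)\<^sup>2 / \<omega> x \<partial>N))"
      by (intro sum.cong refl Bochner_Integration.integral_sum) (auto intro!: fourth_order_integrable)
    finally show ?thesis ..
  qed
  also have "\<dots> \<le> (\<integral>x. (real m + 1) * (\<Sum>k<m. (v k x)\<^sup>2) \<partial>N)"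
  proof (rule integral_mono)
    show "integrable N (\<lambda>x. \<Sum>k<m. \<Sum>l<m. (v k x * v l x)\<^sup>2 / \<omega> x)"
      by (intro Bochner_Integration.integrable_sum fourth_order_integrable) auto
    show "integrable N (\<lambda>x. (real m + 1) * (\<Sum>k<m. (v k x)\<^sup>2))" using v_sq by auto
    fix x
    let ?V = "\<Sum>k<m. (v k x)\<^sup>2"
    have "(\<Sum>k<m. \<Sum>l<m. (v k x * v l x)\<^sup>2 / \<omega> x) = ?V * ?V / \<omega> x"
      by (simp add: sum_product power_mult_distrib sum_divide_distrib)
    also have "\<dots> \<le> ((real m + 1) * \<omega> x) * ?V / \<omega> x"
      using \<omega>_pos[of x] sum_sq_le_\<omega>[of x]
      by (intro divide_right_mono mult_right_mono sum_nonneg) auto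
    finally show "(\<Sum>k<m. \<Sum>l<m. (v k x * v l x)\<^sup>2 / \<omega> x) \<le> (real m + 1) * ?V"
      using \<omega>_pos[of x] by simp
  qed
  also have "\<dots> = (real m + 1) * (\<Sum>k<m. (\<integral>x. (v k x)\<^sup>2 \<partial>N))"
    by (subst Bochner_Integration.integral_mult_right_zero, subst Bochner_Integration.integral_sum) (use v_sq in auto)
  finally show ?thesis using v_sq_integral by simp
qed

text \<open>The points are chosen one after the other.  For \<open>x\<close> drawn with density \<open>\<omega>\<close> the matrix
  \<open>v k x * v l x / \<omega> x\<close> has the identity as its mean, so on average adding a point changes the
  squared Frobenius norm of the accumulated deviation by at most \<open>m (m + 1)\<close>.\<close>

lemma greedy_points:
  assumes R: "integrable N R" and \<beta>: "0 \<le> \<beta>"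
  shows "\<exists>\<xi>. (\<forall>i<n. \<xi> i \<in> space N) \<and>
    (\<Sum>k<m. \<Sum>l<m. (\<Sum>i<n. v k (\<xi> i) * v l (\<xi> i) / \<omega> (\<xi> i) - (if k = l then 1 else 0))\<^sup>2)
      + \<beta> * (\<Sum>i<n. R (\<xi> i) / \<omega> (\<xi> i))
    \<le> real n * ((real m + 1) * real m + \<beta> * (\<integral>x. R x \<partial>N))"
proof (induction n)
  case 0
  then show ?case by simp
next
  case (Suc n)
  let ?\<delta> = "\<lambda>k l::nat. if k = l then 1 else 0 :: real"
  let ?A = "\<lambda>k l x. v k x * v l x / \<omega> x - ?\<delta> k l"
  from Suc obtain \<xi> where \<xi>: "\<And>i. i < n \<Longrightarrow> \<xi> i \<in> space N"
    and le: "(\<Sum>k<m. \<Sum>l<m. (\<Sum>i<n. ?A k l (\<xi> i))\<^sup>2) + \<beta> * (\<Sum>i<n. R (\<xi> i) / \<omega> (\<xi> i))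
      \<le> real n * ((real m + 1) * real m + \<beta> * (\<integral>x. R x \<partial>N))" by blast
  define T where "T k l = (\<Sum>i<n. ?A k l (\<xi> i))" for k l
  define J where "J k l = (\<integral>x. (v k x * v l x)\<^sup>2 / \<omega> x \<partial>N)" for k l
  \<comment> \<open>The increase of the potential when \<open>x\<close> is added. Stability and
    smallness of \<open>R\<close> are measured by one sum because the same point has to serve
    both.\<close>
  define q where "q x = (\<Sum>k<m. \<Sum>l<m. 2 * T k l * ?A k l x + (?A k l x)\<^sup>2) + \<beta> * (R x / \<omega> x)" for x
  \<comment> \<open>For density \<open>\<omega>\<close> the deviation \<open>?A k l\<close> has mean
    0, which removes the term with \<open>T k l\<close>; its second moment is J - 2 \<delta> +
    \<delta>.\<close>
  have q1: "has_bochner_integral N (\<lambda>x. (2 * T k l * ?A k l x + (?A k l x)\<^sup>2) * \<omega> x) (J k l - ?\<delta> k l)"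
    if k: "k < m" and l: "l < m" for k l
  proof -
    have "(2 * T k l * ?A k l x + (?A k l x)\<^sup>2) * \<omega> x =
      2 * (T k l - ?\<delta> k l) * (v k x * v l x) + (?\<delta> k l - 2 * T k l * ?\<delta> k l) * \<omega> x + (v k x * v l x)\<^sup>2 / \<omega> x" for x
      using \<omega>_pos[of x] by (simp add: field_simps power2_eq_square)
    moreover have "has_bochner_integral N (\<lambda>x. 2 * (T k l - ?\<delta> k l) * (v k x * v l x) +
        (?\<delta> k l - 2 * T k l * ?\<delta> k l) * \<omega> x + (v k x * v l x)\<^sup>2 / \<omega> x)
       (2 * (T k l - ?\<delta> k l) * ?\<delta> k l + (?\<delta> k l - 2 * T k l * ?\<delta> k l) * 1 + J k l)"
      using v_prod[OF k l] v_on[OF k l] \<omega>_integrable \<omega>_integral fourth_order_integrable[OF k l]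
      by (intro has_bochner_integral_add has_bochner_integral_mult_right) (auto simp: has_bochner_integral_iff J_def)
    moreover have "2 * (T k l - ?\<delta> k l) * ?\<delta> k l + (?\<delta> k l - 2 * T k l * ?\<delta> k l) * 1 + J k l = J k l - ?\<delta> k l"
      by simp
    ultimately show ?thesis by (simp only:)
  qed
  have "has_bochner_integral N (\<lambda>x. (\<Sum>k<m. \<Sum>l<m. (2 * T k l * ?A k l x + (?A k l x)\<^sup>2) * \<omega> x) + \<beta> * R x)
      ((\<Sum>k<m. \<Sum>l<m. J k l - ?\<delta> k l) + \<beta> * (\<integral>x. R x \<partial>N))"
    using R by (intro has_bochner_integral_add has_bochner_integral_sum has_bochner_integral_mult_right q1)
      (auto simp: has_bochner_integral_iff)
  moreover have "(\<Sum>k<m. \<Sum>l<m. (2 * T k l * ?A k l x + (?A k l x)\<^sup>2) * \<omega> x) + \<beta> * R x = q x * \<omega> x" for x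
    using \<omega>_pos[of x] by (simp add: q_def sum_distrib_right distrib_right)
  ultimately have q: "has_bochner_integral N (\<lambda>x. q x * \<omega> x) ((\<Sum>k<m. \<Sum>l<m. J k l - ?\<delta> k l) + \<beta> * (\<integral>x. R x \<partial>N))"
    by simp
  have "(\<Sum>k<m. \<Sum>l<m. J k l - ?\<delta> k l) \<le> (\<Sum>k<m. \<Sum>l<m. J k l)"
    by (intro sum_mono) auto
  then have "(\<Sum>k<m. \<Sum>l<m. J k l - ?\<delta> k l) + \<beta> * (\<integral>x. R x \<partial>N) \<le> (real m + 1) * real m + \<beta> * (\<integral>x. R x \<partial>N)"
    using fourth_order_integral_le by (simp add: J_def)
  from exists_le_weighted_average[OF \<omega>_pos \<omega>_integrable \<omega>_integral q this]
  obtain x where x: "x \<in> space N" and qx: "q x \<le> (real m + 1) * real m + \<beta> * (\<integral>x. R x \<partial>N)" by blast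
  define \<xi>' where "\<xi>' = \<xi>(n := x)"
  have \<xi>'n: "\<xi>' n = x" and \<xi>'i: "\<And>i. i < n \<Longrightarrow> \<xi>' i = \<xi> i" by (auto simp: \<xi>'_def)
  have s1: "(\<Sum>i<Suc n. ?A k l (\<xi>' i)) = T k l + ?A k l x" for k l
    using \<xi>'n \<xi>'i by (simp add: T_def)
  have s2: "(\<Sum>i<Suc n. R (\<xi>' i) / \<omega> (\<xi>' i)) = (\<Sum>i<n. R (\<xi> i) / \<omega> (\<xi> i)) + R x / \<omega> x"
    using \<xi>'n \<xi>'i by simp
  have "(\<Sum>k<m. \<Sum>l<m. (\<Sum>i<Suc n. ?A k l (\<xi>' i))\<^sup>2) + \<beta> * (\<Sum>i<Suc n. R (\<xi>' i) / \<omega> (\<xi>' i))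
      = ((\<Sum>k<m. \<Sum>l<m. (T k l)\<^sup>2) + \<beta> * (\<Sum>i<n. R (\<xi> i) / \<omega> (\<xi> i))) + q x"
    unfolding s1 s2 q_def
    by (simp add: power2_sum sum.distrib distrib_left add_ac mult_ac)
  also have "\<dots> \<le> real n * ((real m + 1) * real m + \<beta> * (\<integral>x. R x \<partial>N)) + ((real m + 1) * real m + \<beta> * (\<integral>x. R x \<partial>N))"
    using le qx by (intro add_mono) (simp_all add: T_def)
  finally have "(\<Sum>k<m. \<Sum>l<m. (\<Sum>i<Suc n. ?A k l (\<xi>' i))\<^sup>2) + \<beta> * (\<Sum>i<Suc n. R (\<xi>' i) / \<omega> (\<xi>' i))
      \<le> real (Suc n) * ((real m + 1) * real m + \<beta> * (\<integral>x. R x \<partial>N))"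
    by (simp add: algebra_simps)
  moreover have "\<forall>i<Suc n. \<xi>' i \<in> space N"
    using \<xi> x by (auto simp: \<xi>'_def less_Suc_eq)
  ultimately show ?case by blast
qed

text \<open>If the accumulated deviation from n times the identity has Frobenius norm at most n/2,
  the Gram matrix with weights \<open>1 / (n * \<omega>)\<close> is at least half the identity; this
  is the factor 2 in the last inequality. \<open>R\<close> will be the mean square of the residual
  of an approximation.\<close>

lemma well_conditioned_points:
  assumes R: "integrable N R" "\<And>x. x \<in> space N \<Longrightarrow> 0 \<le> R x"
    and \<tau>: "(\<integral>x. R x \<partial>N) \<le> \<tau>" "0 < \<tau>"
    and n: "8 * (m + 1)\<^sup>2 \<le> n"
  shows "\<exists>\<xi> w. (\<forall>i<n. \<xi> i \<in> space N \<and> 0 < w i) \<and> (\<Sum>i<n. w i * R (\<xi> i)) \<le> 2 * \<tau> \<and>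
    (\<forall>a. (\<Sum>k<m. (a k)\<^sup>2) \<le> 2 * (\<Sum>i<n. w i * (\<Sum>k<m. a k * v k (\<xi> i))\<^sup>2))"
proof -
  define P where "P = (real m + 1)\<^sup>2"
  have P: "P > 0" "(real m + 1) * real m \<le> P" by (auto simp: P_def power2_eq_square)
  have nP: "8 * P \<le> real n"
  proof -
    have "real (8 * (m + 1)\<^sup>2) \<le> real n" using n by (simp only: of_nat_le_iff)
    then show ?thesis by (simp add: P_def add.commute)
  qed
  with P have n0: "0 < real n" by simp
  let ?\<delta> = "\<lambda>k l::nat. if k = l then 1 else 0 :: real"
  \<comment> \<open>The weight \<open>P / \<tau>\<close> balances the two aims: on average a point
    adds at most \<open>P\<close> for the matrix and at most \<open>P\<close> for \<open>R\<close>.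
    Neither part is negative, so each is bounded by the total \<open>2 * n * P\<close>.\<close>
  obtain \<xi> where \<xi>: "\<And>i. i < n \<Longrightarrow> \<xi> i \<in> space N"
    and le: "(\<Sum>k<m. \<Sum>l<m. (\<Sum>i<n. v k (\<xi> i) * v l (\<xi> i) / \<omega> (\<xi> i) - ?\<delta> k l)\<^sup>2)
      + P / \<tau> * (\<Sum>i<n. R (\<xi> i) / \<omega> (\<xi> i))
    \<le> real n * ((real m + 1) * real m + P / \<tau> * (\<integral>x. R x \<partial>N))"
    using greedy_points[OF R(1), of "P / \<tau>" n] P \<tau> by auto
  define T where "T k l = (\<Sum>i<n. v k (\<xi> i) * v l (\<xi> i) / \<omega> (\<xi> i) - ?\<delta> k l)" for k l
  define Y where "Y = (\<Sum>i<n. R (\<xi> i) / \<omega> (\<xi> i))"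
  have "P / \<tau> * (\<integral>x. R x \<partial>N) \<le> P / \<tau> * \<tau>" using P \<tau> by (intro mult_left_mono) auto
  then have "real n * ((real m + 1) * real m + P / \<tau> * (\<integral>x. R x \<partial>N)) \<le> real n * (2 * P)"
    using P \<tau> by (intro mult_left_mono) auto
  with le have le': "(\<Sum>k<m. \<Sum>l<m. (T k l)\<^sup>2) + P / \<tau> * Y \<le> real n * (2 * P)"
    by (simp add: T_def Y_def)
  have T0: "0 \<le> (\<Sum>k<m. \<Sum>l<m. (T k l)\<^sup>2)" by (intro sum_nonneg) auto
  have "0 \<le> Y" unfolding Y_def using \<xi> R(2) \<omega>_pos by (intro sum_nonneg divide_nonneg_pos) auto
  then have Y0: "0 \<le> P / \<tau> * Y" using P \<tau> by auto
  \<comment> \<open>Here the constant 8 enters: \<open>8 * P \<le> n\<close> makes the total at most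
    \<open>n\<^sup>2 / 4\<close>.\<close>
  have Tle: "(\<Sum>k<m. \<Sum>l<m. (T k l)\<^sup>2) \<le> (real n / 2)\<^sup>2"
  proof -
    have "real n * (2 * P) \<le> real n * (real n / 4)" using nP by (intro mult_left_mono) auto
    then show ?thesis using le' Y0 by (simp add: power2_eq_square)
  qed
  have Yle: "Y \<le> 2 * \<tau> * real n"
  proof -
    have "P / \<tau> * Y \<le> P / \<tau> * (2 * \<tau> * real n)" using le' T0 \<tau> by (simp add: mult_ac)
    moreover have "0 < P / \<tau>" using P \<tau> by simp
    ultimately show ?thesis by (simp only: mult_le_cancel_left_pos)
  qed
  define w where "w i = 1 / (real n * \<omega> (\<xi> i))" for i
  have w: "0 < w i" for i using \<omega>_pos n0 by (simp add: w_def)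
  have "(\<Sum>i<n. w i * R (\<xi> i)) = Y / real n"
    by (simp add: w_def Y_def sum_divide_distrib field_simps)
  then have 1: "(\<Sum>i<n. w i * R (\<xi> i)) \<le> 2 * \<tau>" using Yle n0 by (simp add: divide_le_eq)
  have 2: "(\<Sum>k<m. (a k)\<^sup>2) \<le> 2 * (\<Sum>i<n. w i * (\<Sum>k<m. a k * v k (\<xi> i))\<^sup>2)" for a
  proof -
    define Q where "Q = {..<m} \<times> {..<m}"
    define a2 where "a2 = (\<Sum>k<m. (a k)\<^sup>2)"
    have a20: "0 \<le> a2" unfolding a2_def by (rule sum_nonneg) simp
    \<comment> \<open>The quadratic form of the deviation matrix at \<open>a\<close>. The
      Cauchy-Schwarz inequality over pairs of indices bounds it by the squared length of
      \<open>a\<close> times the Frobenius norm.\<close>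
    define X where "X = (\<Sum>(k,l)\<in>Q. (a k * a l) * T k l)"
    have "X\<^sup>2 \<le> (\<Sum>(k,l)\<in>Q. (a k * a l)\<^sup>2) * (\<Sum>(k,l)\<in>Q. (T k l)\<^sup>2)"
      unfolding X_def using Cauchy_Schwarz_ineq_sum[of "\<lambda>(k,l). a k * a l" "\<lambda>(k,l). T k l" Q]
      by (simp add: split_beta')
    also have "(\<Sum>(k,l)\<in>Q. (a k * a l)\<^sup>2) = a2\<^sup>2"
      unfolding Q_def sum.cartesian_product[symmetric] a2_def
      by (simp add: power2_eq_square[of "sum _ _"] sum_product power_mult_distrib)
    also have "(\<Sum>(k,l)\<in>Q. (T k l)\<^sup>2) = (\<Sum>k<m. \<Sum>l<m. (T k l)\<^sup>2)"
      unfolding Q_def sum.cartesian_product[symmetric] ..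
    also have "a2\<^sup>2 * \<dots> \<le> a2\<^sup>2 * (real n / 2)\<^sup>2" by (intro mult_left_mono Tle) simp
    finally have "X\<^sup>2 \<le> (a2 * (real n / 2))\<^sup>2" by (simp only: power_mult_distrib)
    then have "\<bar>X\<bar> \<le> a2 * (real n / 2)"
      using a20 n0 abs_le_square_iff[of X "a2 * (real n / 2)"] by simp
    then have X: "- (a2 * (real n / 2)) \<le> X" by simp
    have "X = (\<Sum>k<m. \<Sum>l<m. (\<Sum>i<n. a k * a l * (v k (\<xi> i) * v l (\<xi> i) / \<omega> (\<xi> i))) - real n * (a k * a l * ?\<delta> k l))"
      unfolding X_def Q_def sum.cartesian_product[symmetric] T_def
      by (simp add: sum_subtractf right_diff_distrib sum_distrib_left mult_ac)
    also have "\<dots> = (\<Sum>k<m. \<Sum>l<m. \<Sum>i<n. a k * a l * (v k (\<xi> i) * v l (\<xi> i) / \<omega> (\<xi> i)))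
        - real n * (\<Sum>k<m. \<Sum>l<m. a k * a l * ?\<delta> k l)"
      by (simp only: sum_subtractf sum_distrib_left)
    also have "(\<Sum>k<m. \<Sum>l<m. a k * a l * ?\<delta> k l) = a2"
    proof -
      have "(\<Sum>l<m. a k * a l * ?\<delta> k l) = (a k)\<^sup>2" if "k < m" for k
      proof -
        have "(\<Sum>l<m. a k * a l * ?\<delta> k l) = (\<Sum>l<m. if k = l then a k * a l else 0)"
          by (rule sum.cong) auto
        then show ?thesis using that by (simp add: power2_eq_square)
      qed
      then show ?thesis by (simp add: a2_def)
    qed
    also have "(\<Sum>k<m. \<Sum>l<m. \<Sum>i<n. a k * a l * (v k (\<xi> i) * v l (\<xi> i) / \<omega> (\<xi> i))) =
        (\<Sum>k<m. \<Sum>i<n. \<Sum>l<m. a k * a l * (v k (\<xi> i) * v l (\<xi> i) / \<omega> (\<xi> i)))"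
      by (intro sum.cong refl sum.swap)
    also have "\<dots> = (\<Sum>i<n. \<Sum>k<m. \<Sum>l<m. a k * a l * (v k (\<xi> i) * v l (\<xi> i) / \<omega> (\<xi> i)))"
      by (rule sum.swap)
    also have "\<dots> = (\<Sum>i<n. (\<Sum>k<m. a k * v k (\<xi> i))\<^sup>2 / \<omega> (\<xi> i))"
      by (simp add: power2_eq_square sum_product sum_divide_distrib mult_ac)
    also have "\<dots> = real n * (\<Sum>i<n. w i * (\<Sum>k<m. a k * v k (\<xi> i))\<^sup>2)"
      using n0 by (simp add: w_def sum_distrib_left)
    finally have "real n * a2 \<le> real n * (2 * (\<Sum>i<n. w i * (\<Sum>k<m. a k * v k (\<xi> i))\<^sup>2))"
      using X by (simp add: algebra_simps)
    then show ?thesis using n0 by (simp add: a2_def)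
  qed
  show ?thesis using \<xi> w 1 2 by blast
qed

end

section \<open>Weighted least squares\<close>

context orthonormal_system
begin

lemma norm_linear_combination:
  "integrable N (\<lambda>x. (\<Sum>k<m. a k * v k x)\<^sup>2)"
  "(\<integral>x. (\<Sum>k<m. a k * v k x)\<^sup>2 \<partial>N) = (\<Sum>k<m. (a k)\<^sup>2)"
proof -
  have eq: "(\<Sum>k<m. a k * v k x)\<^sup>2 = (\<Sum>k<m. \<Sum>l<m. (a k * a l) * (v k x * v l x))" for x
    by (simp add: power2_eq_square sum_product mult_ac)
  have i: "integrable N (\<lambda>x. \<Sum>l<m. (a k * a l) * (v k x * v l x))" if "k < m" for k
    by (rule integral_linear_combination(1)) (use v_prod that in auto)
  show "integrable N (\<lambda>x. (\<Sum>k<m. a k * v k x)\<^sup>2)"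
    unfolding eq by (rule Bochner_Integration.integrable_sum) (use i in auto)
  have "(\<integral>x. (\<Sum>k<m. a k * v k x)\<^sup>2 \<partial>N) = (\<Sum>k<m. (\<integral>x. (\<Sum>l<m. (a k * a l) * (v k x * v l x)) \<partial>N))"
    unfolding eq by (rule Bochner_Integration.integral_sum) (use i in auto)
  also have "\<dots> = (\<Sum>k<m. (a k)\<^sup>2)"
  proof (rule sum.cong[OF refl])
    fix k assume "k \<in> {..<m}"
    then have k: "k < m" by simp
    have "(\<integral>x. (\<Sum>l<m. (a k * a l) * (v k x * v l x)) \<partial>N) = (\<Sum>l<m. (a k * a l) * (\<integral>x. v k x * v l x \<partial>N))"
      by (rule integral_linear_combination(2)) (use v_prod k in auto)
    also have "\<dots> = (\<Sum>l<m. if k = l then a k * a l else 0)"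
      by (rule sum.cong) (use v_on k in auto)
    finally show "(\<integral>x. (\<Sum>l<m. (a k * a l) * (v k x * v l x)) \<partial>N) = (a k)\<^sup>2"
      using k by (simp add: power2_eq_square)
  qed
  finally show "(\<integral>x. (\<Sum>k<m. a k * v k x)\<^sup>2 \<partial>N) = (\<Sum>k<m. (a k)\<^sup>2)" .
qed

text \<open>Least squares: Gram-Schmidt with respect to the empirical inner product
  yields a projection onto the span of the \<open>v k\<close> that only uses function values.\<close>

lemma least_squares:
  fixes \<xi> :: "nat \<Rightarrow> 'x" and w :: "nat \<Rightarrow> real"
  assumes w: "\<And>i. i < n \<Longrightarrow> 0 < w i"
    and frame: "\<And>a. (\<Sum>k<m. (a k)\<^sup>2) \<le> 2 * (\<Sum>i<n. w i * (\<Sum>k<m. a k * v k (\<xi> i))\<^sup>2)"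
  shows "\<exists>(r::nat) u. (\<forall>j<r. u j \<in> borel_measurable N) \<and>
    (\<forall>a (h :: 'x \<Rightarrow> real). h \<in> borel_measurable N \<longrightarrow>
      (\<integral>\<^sup>+x. ennreal (((\<Sum>k<m. a k * v k x) + h x
          - (\<Sum>j<r. (\<Sum>i<n. w i * ((\<Sum>k<m. a k * v k (\<xi> i)) + h (\<xi> i)) * u j (\<xi> i)) * u j x))\<^sup>2) \<partial>N)
      \<le> 2 * (\<integral>\<^sup>+x. ennreal ((h x)\<^sup>2) \<partial>N) + ennreal (4 * (\<Sum>i<n. w i * (h (\<xi> i))\<^sup>2)))"
proof -
  define S where "S = range (\<lambda>a x. \<Sum>k<m. a k * v k x)"
  define B where "B f g = (\<Sum>i<n. w i * f (\<xi> i) * g (\<xi> i))" for f g :: "'x \<Rightarrow> real"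
  have B_sym: "B f g = B g f" for f g by (simp add: B_def mult_ac)
  have B_lin: "B (\<lambda>x. a * f x + b * g x) h = a * B f h + b * B g h" for a b f g h
    by (simp add: B_def algebra_simps sum.distrib sum_distrib_left)
  have B_nonneg: "0 \<le> B f f" for f
    unfolding B_def by (rule sum_nonneg) (use w in \<open>auto simp: mult.assoc less_imp_le\<close>)
  have B_sum: "B (\<lambda>x. \<Sum>j\<in>I. c j * f j x) g = (\<Sum>j\<in>I. c j * B (f j) g)" for I :: "nat set" and c f g
    unfolding B_def sum_distrib_left sum_distrib_right by (subst sum.swap) (simp add: mult_ac)
  have B_zero: "f (\<xi> i) = 0" if "B f f = 0" "i < n" for f i
  proof -
    have "\<forall>i\<in>{..<n}. w i * f (\<xi> i) * f (\<xi> i) = 0"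
      using that(1) unfolding B_def
      by (subst (asm) sum_nonneg_eq_0_iff) (use w in \<open>auto simp: mult.assoc less_imp_le\<close>)
    then have "w i * f (\<xi> i) * f (\<xi> i) = 0" using that(2) by blast
    with w[OF that(2)] show ?thesis by simp
  qed
  have S_closed: "(\<lambda>x. a * f x + b * g x) \<in> S" if fg: "f \<in> S" "g \<in> S" for a b f g
  proof -
    obtain c d where c: "f = (\<lambda>x. \<Sum>k<m. c k * v k x)" and d: "g = (\<lambda>x. \<Sum>k<m. d k * v k x)"
      using fg by (auto simp: S_def)
    have "(\<lambda>x. a * f x + b * g x) = (\<lambda>x. \<Sum>k<m. (a * c k + b * d k) * v k x)"
      by (simp add: c d distrib_right sum.distrib sum_distrib_left mult.assoc)
    then show ?thesis unfolding S_def by (intro range_eqI[where x = "\<lambda>k. a * c k + b * d k"])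
  qed
  have S_zero: "(\<lambda>x. 0) \<in> S" unfolding S_def by (rule range_eqI[of _ _ "\<lambda>_. 0"]) simp
  have S_sum: "(\<lambda>x. \<Sum>j\<in>I. c j * f j x) \<in> S" if "finite I" "\<And>j. j \<in> I \<Longrightarrow> f j \<in> S" for I :: "nat set" and c f
    using that
  proof (induction I rule: finite_induct)
    case (insert j I)
    then show ?case using S_closed[of "f j" "\<lambda>x. \<Sum>j\<in>I. c j * f j x" "c j" 1] by simp
  qed (simp add: S_zero)
  have vS: "v k \<in> S" if "k < m" for k
  proof -
    have "v k = (\<lambda>x. \<Sum>l<m. (if l = k then 1 else 0) * v l x)"
    proof
      fix x
      have "(\<Sum>l<m. (if l = k then 1 else 0) * v l x) = (\<Sum>l<m. if l = k then v l x else 0)"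
        by (rule sum.cong) auto
      then show "v k x = (\<Sum>l<m. (if l = k then 1 else 0) * v l x)" using that by simp
    qed
    then show ?thesis unfolding S_def by (intro range_eqI[where x = "\<lambda>l. if l = k then 1 else 0"])
  qed
  have S_meas: "f \<in> borel_measurable N" if "f \<in> S" for f
    using that v_meas by (auto simp: S_def intro!: borel_measurable_sum borel_measurable_times)
  have S_frame: "integrable N (\<lambda>x. (f x)\<^sup>2) \<and> (\<integral>x. (f x)\<^sup>2 \<partial>N) \<le> 2 * B f f" if "f \<in> S" for f
  proof -
    obtain c where c: "f = (\<lambda>x. \<Sum>k<m. c k * v k x)" using \<open>f \<in> S\<close> by (auto simp: S_def)
    show ?thesis
      using frame[of c] norm_linear_combination[of c] by (simp add: c B_def power2_eq_square mult.assoc)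
  qed
  have "\<exists>r\<le>m. \<exists>u e. (\<forall>j<r. u j \<in> S) \<and>
           (\<forall>i<r. \<forall>j<r. B (u i) (u j) = (if i = j then 1 else 0)) \<and>
           (\<forall>k<m. (\<lambda>x. v k x - (\<Sum>j<r. e k j * u j x)) \<in> S \<and>
              B (\<lambda>x. v k x - (\<Sum>j<r. e k j * u j x)) (\<lambda>x. v k x - (\<Sum>j<r. e k j * u j x)) = 0)"
    by (rule gram_schmidt_semidefinite) (auto intro: S_closed B_sym B_nonneg vS simp: B_lin)
  then obtain r :: nat and u e where u: "\<And>j. j < r \<Longrightarrow> u j \<in> S"
    and onu: "\<And>i j. i < r \<Longrightarrow> j < r \<Longrightarrow> B (u i) (u j) = (if i = j then 1 else 0)"
    and \<rho>S: "\<And>k. k < m \<Longrightarrow> (\<lambda>x. v k x - (\<Sum>j<r. e k j * u j x)) \<in> S"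
    and \<rho>0: "\<And>k. k < m \<Longrightarrow> B (\<lambda>x. v k x - (\<Sum>j<r. e k j * u j x)) (\<lambda>x. v k x - (\<Sum>j<r. e k j * u j x)) = 0"
    by (elim exE conjE) blast
  have v_pts: "v k (\<xi> i) = (\<Sum>j<r. e k j * u j (\<xi> i))" if "k < m" "i < n" for k i
    using B_zero[OF \<rho>0[OF that(1)] that(2)] by simp
  have Bvu: "B (v k) (u j) = e k j" if k: "k < m" and j: "j < r" for k j
  proof -
    have "B (v k) (u j) = B (\<lambda>x. \<Sum>j<r. e k j * u j x) (u j)"
      unfolding B_def using v_pts[OF k] by (intro sum.cong) auto
    also have "\<dots> = (\<Sum>i<r. if i = j then e k i else 0)"
      unfolding B_sum by (rule sum.cong) (use onu j in auto)
    finally show ?thesis using j by simp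
  qed
  \<comment> \<open>The remainder vanishes at the sample points, that is, its empirical norm is 0.
    The frame inequality transfers this to the L_2 norm, so the expansion in the \<open>u j\<close>
    holds almost everywhere.\<close>
  have AEv: "AE x in N. \<forall>k\<in>{..<m}. v k x = (\<Sum>j<r. e k j * u j x)"
  proof (rule AE_finite_allI)
    fix k assume "k \<in> {..<m}"
    then have k: "k < m" by simp
    let ?g = "\<lambda>x. v k x - (\<Sum>j<r. e k j * u j x)"
    have "integrable N (\<lambda>x. (?g x)\<^sup>2)" and "(\<integral>x. (?g x)\<^sup>2 \<partial>N) \<le> 0"
      using S_frame[OF \<rho>S[OF k]] \<rho>0[OF k] by auto
    then have "(\<integral>x. (?g x)\<^sup>2 \<partial>N) = 0" by (intro antisym) auto
    then have "AE x in N. (?g x)\<^sup>2 = 0"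
      using \<open>integrable N (\<lambda>x. (?g x)\<^sup>2)\<close> by (subst (asm) integral_nonneg_eq_0_iff_AE) auto
    then show "AE x in N. v k x = (\<Sum>j<r. e k j * u j x)" by simp
  qed simp
  have main: "(\<integral>\<^sup>+x. ennreal (((\<Sum>k<m. a k * v k x) + h x
          - (\<Sum>j<r. (\<Sum>i<n. w i * ((\<Sum>k<m. a k * v k (\<xi> i)) + h (\<xi> i)) * u j (\<xi> i)) * u j x))\<^sup>2) \<partial>N)
      \<le> 2 * (\<integral>\<^sup>+x. ennreal ((h x)\<^sup>2) \<partial>N) + ennreal (4 * (\<Sum>i<n. w i * (h (\<xi> i))\<^sup>2))"
    if h[measurable]: "h \<in> borel_measurable N" for a and h :: "'x \<Rightarrow> real"
  proof -
    \<comment> \<open>The empirical projection of \<open>h\<close>. The part in the span is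
      reproduced almost everywhere, so the error of the method is \<open>h - Q\<close>, whatever the
      coefficients \<open>a\<close> are.\<close>
    define Q where "Q x = (\<Sum>j<r. B h (u j) * u j x)" for x
    have QS: "Q \<in> S" unfolding Q_def[abs_def] by (rule S_sum) (use u in auto)
    note [measurable] = S_meas[OF QS]
    have coef: "(\<Sum>i<n. w i * ((\<Sum>k<m. a k * v k (\<xi> i)) + h (\<xi> i)) * u j (\<xi> i)) =
        (\<Sum>k<m. a k * e k j) + B h (u j)" if "j < r" for j
    proof -
      have "(\<Sum>i<n. w i * ((\<Sum>k<m. a k * v k (\<xi> i)) + h (\<xi> i)) * u j (\<xi> i)) =
          B (\<lambda>x. \<Sum>k<m. a k * v k x) (u j) + B h (u j)"
        by (simp add: B_def distrib_left distrib_right sum.distrib)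
      also have "B (\<lambda>x. \<Sum>k<m. a k * v k x) (u j) = (\<Sum>k<m. a k * e k j)"
        unfolding B_sum using Bvu that by (intro sum.cong) auto
      finally show ?thesis .
    qed
    have Bhu: "B Q (u j) = B h (u j)" if j: "j < r" for j
    proof -
      have "B Q (u j) = (\<Sum>i<r. if i = j then B h (u i) else 0)"
        unfolding Q_def[abs_def] B_sum by (rule sum.cong) (use onu j in auto)
      then show ?thesis using j by simp
    qed
    have BQ: "B Q f = (\<Sum>j<r. B h (u j) * B (u j) f)" for f
      unfolding Q_def[abs_def] B_sum ..
    have BQQ: "B Q Q = B Q h"
      unfolding BQ using Bhu by (intro sum.cong) (auto simp: B_sym)
    have "0 \<le> B (\<lambda>x. 1 * h x + (-1) * Q x) (\<lambda>x. 1 * h x + (-1) * Q x)" by (rule B_nonneg)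
    also have "\<dots> = B h h - 2 * B Q h + B Q Q"
      unfolding B_lin by (subst (1 2) B_sym) (simp only: B_lin B_sym[of h Q], simp)
    finally have bessel: "B Q Q \<le> B h h" using BQQ by simp
    \<comment> \<open>The constant 4 in the bound is 2 * 2: one factor splits the square of
      \<open>h - Q\<close>, the other is the frame constant applied to \<open>Q\<close>; Bessel's
      inequality then replaces \<open>Q\<close> by \<open>h\<close> in the empirical norm.\<close>
    have "(\<integral>\<^sup>+x. ennreal (((\<Sum>k<m. a k * v k x) + h x
          - (\<Sum>j<r. (\<Sum>i<n. w i * ((\<Sum>k<m. a k * v k (\<xi> i)) + h (\<xi> i)) * u j (\<xi> i)) * u j x))\<^sup>2) \<partial>N)
      \<le> (\<integral>\<^sup>+x. 2 * ennreal ((h x)\<^sup>2) + 2 * ennreal ((Q x)\<^sup>2) \<partial>N)"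
    proof (rule nn_integral_mono_AE)
      show "AE x in N. ennreal (((\<Sum>k<m. a k * v k x) + h x
          - (\<Sum>j<r. (\<Sum>i<n. w i * ((\<Sum>k<m. a k * v k (\<xi> i)) + h (\<xi> i)) * u j (\<xi> i)) * u j x))\<^sup>2)
        \<le> 2 * ennreal ((h x)\<^sup>2) + 2 * ennreal ((Q x)\<^sup>2)"
        using AEv
      proof eventually_elim
        case (elim x)
        have "(\<Sum>j<r. (\<Sum>i<n. w i * ((\<Sum>k<m. a k * v k (\<xi> i)) + h (\<xi> i)) * u j (\<xi> i)) * u j x)
            = (\<Sum>j<r. (\<Sum>k<m. a k * e k j) * u j x) + Q x"
          by (simp add: coef Q_def distrib_right sum.distrib)
        also have "(\<Sum>j<r. (\<Sum>k<m. a k * e k j) * u j x) = (\<Sum>k<m. a k * (\<Sum>j<r. e k j * u j x))"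
          unfolding sum_distrib_left sum_distrib_right by (subst sum.swap) (simp add: mult_ac)
        also have "\<dots> = (\<Sum>k<m. a k * v k x)"
          using elim by (intro sum.cong) auto
        finally have "((\<Sum>k<m. a k * v k x) + h x
          - (\<Sum>j<r. (\<Sum>i<n. w i * ((\<Sum>k<m. a k * v k (\<xi> i)) + h (\<xi> i)) * u j (\<xi> i)) * u j x))\<^sup>2
          = (h x - Q x)\<^sup>2" by simp
        also have "\<dots> \<le> 2 * (h x)\<^sup>2 + 2 * (Q x)\<^sup>2"
          using zero_le_power2[of "h x + Q x"] by (simp add: power2_eq_square algebra_simps)
        finally show ?case
          by (rule order_trans[OF ennreal_leI]) (simp add: ennreal_mult')
      qed
    qed
    also have "\<dots> = 2 * (\<integral>\<^sup>+x. ennreal ((h x)\<^sup>2) \<partial>N) + 2 * (\<integral>\<^sup>+x. ennreal ((Q x)\<^sup>2) \<partial>N)"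
      by (simp add: nn_integral_add nn_integral_cmult)
    also have "(\<integral>\<^sup>+x. ennreal ((Q x)\<^sup>2) \<partial>N) = ennreal (\<integral>x. (Q x)\<^sup>2 \<partial>N)"
      by (rule nn_integral_eq_integral) (use S_frame[OF QS] in auto)
    also have "2 * ennreal (\<integral>x. (Q x)\<^sup>2 \<partial>N) = ennreal (2 * (\<integral>x. (Q x)\<^sup>2 \<partial>N))"
      by (simp add: ennreal_mult')
    also have "\<dots> \<le> ennreal (4 * B h h)"
      using S_frame[OF QS] bessel by (intro ennreal_leI) simp
    also have "B h h = (\<Sum>i<n. w i * (h (\<xi> i))\<^sup>2)"
      by (simp add: B_def power2_eq_square mult.assoc)
    finally show ?thesis by (simp add: add_left_mono)
  qed
  show ?thesis
    by (intro exI[of _ r] exI[of _ u] conjI allI impI main) (simp_all add: S_meas u)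
qed

end

section \<open>The sampling algorithm and its average case error\<close>

context gaussian_approximation
begin

text \<open>The functionals \<open>p k\<close> are not accessible from samples, but least squares
  reproduces the span, so they enter only through the residual \<open>h\<close>. Averaging the least
  squares bound over \<open>f\<close> gives 2 \<tau> for the L_2 part and 4 * 2 \<tau> for the
  discrete part.\<close>

lemma standard_algorithm:
  fixes m n :: nat
  assumes v: "\<And>k. k < m \<Longrightarrow> v k \<in> borel_measurable N" "\<And>k. k < m \<Longrightarrow> integrable N (\<lambda>x. (v k x)\<^sup>2)"
    and on: "\<And>i j. i < m \<Longrightarrow> j < m \<Longrightarrow> (\<integral>x. v i x * v j x \<partial>N) = (if i = j then 1 else 0)"
    and p: "\<And>k. k < m \<Longrightarrow> Lin (p k)"
    and err: "(\<integral>\<^sup>+f. (\<integral>\<^sup>+x. ennreal ((ev f x - (\<Sum>k<m. p k f * v k x))\<^sup>2) \<partial>N) \<partial>M) \<le> ennreal \<tau>"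
    and \<tau>: "0 < \<tau>" and n: "8 * (m + 1)\<^sup>2 \<le> n"
  shows "\<exists>\<xi> \<phi>. (\<forall>i<n. \<xi> i \<in> space N) \<and>
    (\<lambda>(y, x). \<phi> y x) \<in> borel_measurable (PiM {..<n} (\<lambda>_. lborel) \<Otimes>\<^sub>M N) \<and>
    (\<integral>\<^sup>+f. (\<integral>\<^sup>+x. ennreal ((ev f x - \<phi> (\<lambda>i\<in>{..<n}. ev f (\<xi> i)) x)\<^sup>2) \<partial>N) \<partial>M) \<le> ennreal (10 * \<tau>)"
proof -
  interpret V: orthonormal_system N m v by standard (use v on in auto)
  define h where "h f x = ev f x - (\<Sum>k<m. p k f * v k x)" for f x
  have hLin: "Lin (\<lambda>f. h f x)" if x: "x \<in> space N" for x
  proof -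
    have "Lin (\<lambda>f. 1 * ev f x + (-1) * (\<Sum>k<m. v k x * p k f))"
      by (intro cont_lin_functional_add_scale ev_Lin[OF x] cont_lin_functional_sum) (use p in auto)
    then show ?thesis by (simp add: h_def[abs_def] mult.commute)
  qed
  have h_joint: "(\<lambda>z. h (fst z) (snd z)) \<in> borel_measurable (M \<Otimes>\<^sub>M N)"
  proof -
    have "(\<lambda>z. \<Sum>k<m. p k (fst z) * v k (snd z)) \<in> borel_measurable (M \<Otimes>\<^sub>M N)"
    proof (rule borel_measurable_sum)
      fix k assume "k \<in> {..<m}"
      then have [measurable]: "v k \<in> borel_measurable N" "p k \<in> borel_measurable M"
        using v p Lin_measurable by auto
      show "(\<lambda>z. p k (fst z) * v k (snd z)) \<in> borel_measurable (M \<Otimes>\<^sub>M N)" by measurable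
    qed
    note [measurable] = this
    show ?thesis unfolding h_def by measurable
  qed
  have hN: "h f \<in> borel_measurable N" if "f \<in> S" for f
    using measurable_compose[OF measurable_Pair1' h_joint, of f] that by (simp add: space_M)
  \<comment> \<open>The mean square of the residual at a point. Passing to this function before
    choosing points makes the choice independent of \<open>f\<close>.\<close>
  define R where "R x = (\<integral>f. (h f x)\<^sup>2 \<partial>M)" for x
  have hR: "(\<integral>\<^sup>+f. ennreal ((h f x)\<^sup>2) \<partial>M) = ennreal (R x)" if "x \<in> space N" for x
    unfolding R_def by (rule nn_integral_eq_integral[OF Lin_power_integrable[OF hLin[OF that]]]) auto
  have R_meas[measurable]: "R \<in> borel_measurable N"
  proof -
    have "(\<lambda>(x, f). (h f x)\<^sup>2) \<in> borel_measurable (N \<Otimes>\<^sub>M M)"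
      using borel_measurable_power[OF measurable_compose[OF measurable_pair_swap' h_joint], of 2]
      by (simp add: split_beta')
    then show ?thesis unfolding R_def[abs_def] by (rule borel_measurable_lebesgue_integral)
  qed
  have R0: "0 \<le> R x" for x unfolding R_def by simp
  have sq_joint: "(\<lambda>z. ennreal ((h (fst z) (snd z))\<^sup>2)) \<in> borel_measurable (M \<Otimes>\<^sub>M N)"
    using h_joint by measurable
  have Rle: "(\<integral>\<^sup>+x. ennreal (R x) \<partial>N) \<le> ennreal \<tau>"
  proof -
    have "(\<integral>\<^sup>+x. ennreal (R x) \<partial>N) = (\<integral>\<^sup>+x. (\<integral>\<^sup>+f. ennreal ((h f x)\<^sup>2) \<partial>M) \<partial>N)"
      by (rule nn_integral_cong) (simp add: hR)
    also have "\<dots> = (\<integral>\<^sup>+f. (\<integral>\<^sup>+x. ennreal ((h f x)\<^sup>2) \<partial>N) \<partial>M)"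
      using MN.Fubini'[of "\<lambda>f x. ennreal ((h f x)\<^sup>2)"] sq_joint by (simp add: split_beta')
    finally show ?thesis using err by (simp add: h_def)
  qed
  have Ri: "integrable N R"
    by (rule integrableI_nonneg) (use R0 Rle in \<open>auto intro: le_less_trans\<close>)
  have RI: "(\<integral>x. R x \<partial>N) \<le> \<tau>"
    using Rle \<tau> R0 by (simp add: nn_integral_eq_integral[OF Ri] integral_nonneg)
  obtain \<xi> w where \<xi>: "\<And>i. i < n \<Longrightarrow> \<xi> i \<in> space N" and w: "\<And>i. i < n \<Longrightarrow> 0 < w i"
    and wR: "(\<Sum>i<n. w i * R (\<xi> i)) \<le> 2 * \<tau>"
    and frame: "\<And>a. (\<Sum>k<m. (a k)\<^sup>2) \<le> 2 * (\<Sum>i<n. w i * (\<Sum>k<m. a k * v k (\<xi> i))\<^sup>2)"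
    using V.well_conditioned_points[OF Ri R0 RI \<tau> n] by blast
  obtain r :: nat and u where u: "\<And>j. j < r \<Longrightarrow> u j \<in> borel_measurable N"
    and ls: "\<And>a g. g \<in> borel_measurable N \<Longrightarrow>
      (\<integral>\<^sup>+x. ennreal (((\<Sum>k<m. a k * v k x) + g x
          - (\<Sum>j<r. (\<Sum>i<n. w i * ((\<Sum>k<m. a k * v k (\<xi> i)) + g (\<xi> i)) * u j (\<xi> i)) * u j x))\<^sup>2) \<partial>N)
      \<le> 2 * (\<integral>\<^sup>+x. ennreal ((g x)\<^sup>2) \<partial>N) + ennreal (4 * (\<Sum>i<n. w i * (g (\<xi> i))\<^sup>2))"
    using V.least_squares[of n w \<xi>, OF w frame] by blast
  define \<phi> where "\<phi> y x = (\<Sum>j<r. (\<Sum>i<n. w i * y i * u j (\<xi> i)) * u j x)" for y :: "nat \<Rightarrow> real" and x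
  have "(\<lambda>z. \<phi> (fst z) (snd z)) \<in> borel_measurable (PiM {..<n} (\<lambda>_. lborel) \<Otimes>\<^sub>M N)"
    unfolding \<phi>_def
  proof (rule borel_measurable_sum)
    fix j assume "j \<in> {..<r}"
    then have [measurable]: "u j \<in> borel_measurable N" using u by simp
    have "(\<lambda>y. \<Sum>i<n. w i * y i * u j (\<xi> i)) \<in> borel_measurable (PiM {..<n} (\<lambda>_. lborel :: real measure))"
      by (intro borel_measurable_sum borel_measurable_times borel_measurable_const)
         (auto intro!: measurable_component_singleton[where M="\<lambda>_. lborel", simplified])
    note [measurable] = this
    show "(\<lambda>z. (\<Sum>i<n. w i * fst z i * u j (\<xi> i)) * u j (snd z)) \<in> borel_measurable (PiM {..<n} (\<lambda>_. lborel) \<Otimes>\<^sub>M N)"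
      by (intro borel_measurable_times measurable_compose[OF measurable_fst \<open>(\<lambda>y. \<Sum>i<n. w i * y i * u j (\<xi> i)) \<in> _\<close>]) measurable
  qed
  then have \<phi>_meas: "(\<lambda>(y, x). \<phi> y x) \<in> borel_measurable (PiM {..<n} (\<lambda>_. lborel) \<Otimes>\<^sub>M N)"
    by (simp add: split_beta')
  have step: "(\<integral>\<^sup>+x. ennreal ((ev f x - \<phi> (\<lambda>i\<in>{..<n}. ev f (\<xi> i)) x)\<^sup>2) \<partial>N)
      \<le> 2 * (\<integral>\<^sup>+x. ennreal ((h f x)\<^sup>2) \<partial>N) + (\<Sum>i<n. ennreal (4 * w i) * ennreal ((h f (\<xi> i))\<^sup>2))"
    if f: "f \<in> S" for f
  proof -
    have ev: "ev f x = (\<Sum>k<m. p k f * v k x) + h f x" for x by (simp add: h_def)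
    have "\<phi> (\<lambda>i\<in>{..<n}. ev f (\<xi> i)) x =
        (\<Sum>j<r. (\<Sum>i<n. w i * ((\<Sum>k<m. p k f * v k (\<xi> i)) + h f (\<xi> i)) * u j (\<xi> i)) * u j x)" for x
      by (simp add: \<phi>_def ev)
    then have "(\<integral>\<^sup>+x. ennreal ((ev f x - \<phi> (\<lambda>i\<in>{..<n}. ev f (\<xi> i)) x)\<^sup>2) \<partial>N)
      \<le> 2 * (\<integral>\<^sup>+x. ennreal ((h f x)\<^sup>2) \<partial>N) + ennreal (4 * (\<Sum>i<n. w i * (h f (\<xi> i))\<^sup>2))"
      using ls[OF hN[OF f], of "\<lambda>k. p k f"] by (simp add: ev)
    also have "ennreal (4 * (\<Sum>i<n. w i * (h f (\<xi> i))\<^sup>2)) = (\<Sum>i<n. ennreal (4 * w i) * ennreal ((h f (\<xi> i))\<^sup>2))"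
    proof -
      have "ennreal (4 * w i) * ennreal ((h f (\<xi> i))\<^sup>2) = ennreal (4 * w i * (h f (\<xi> i))\<^sup>2)" if "i < n" for i
        using w[OF that] by (simp add: ennreal_mult)
      then have "(\<Sum>i<n. ennreal (4 * w i) * ennreal ((h f (\<xi> i))\<^sup>2)) = (\<Sum>i<n. ennreal (4 * w i * (h f (\<xi> i))\<^sup>2))"
        by (intro sum.cong) auto
      also have "\<dots> = ennreal (\<Sum>i<n. 4 * w i * (h f (\<xi> i))\<^sup>2)"
        by (rule sum_ennreal) (use w in \<open>auto simp: less_imp_le\<close>)
      finally show ?thesis by (simp add: sum_distrib_left mult.assoc)
    qed
    finally show ?thesis .
  qed
  have h_pt: "(\<lambda>f. h f (\<xi> i)) \<in> borel_measurable M" if "i < n" for i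
    by (rule Lin_measurable[OF hLin[OF \<xi>[OF that]]])
  have hI_meas: "(\<lambda>f. \<integral>\<^sup>+x. ennreal ((h f x)\<^sup>2) \<partial>N) \<in> borel_measurable M"
    using N.borel_measurable_nn_integral[of "\<lambda>f x. ennreal ((h f x)\<^sup>2)" M] sq_joint by (simp add: split_beta')
  have "(\<integral>\<^sup>+f. (\<integral>\<^sup>+x. ennreal ((ev f x - \<phi> (\<lambda>i\<in>{..<n}. ev f (\<xi> i)) x)\<^sup>2) \<partial>N) \<partial>M)
      \<le> (\<integral>\<^sup>+f. 2 * (\<integral>\<^sup>+x. ennreal ((h f x)\<^sup>2) \<partial>N) + (\<Sum>i<n. ennreal (4 * w i) * ennreal ((h f (\<xi> i))\<^sup>2)) \<partial>M)"
    by (rule nn_integral_mono) (simp add: step space_M)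
  also have "\<dots> = (\<integral>\<^sup>+f. 2 * (\<integral>\<^sup>+x. ennreal ((h f x)\<^sup>2) \<partial>N) \<partial>M) +
      (\<integral>\<^sup>+f. (\<Sum>i<n. ennreal (4 * w i) * ennreal ((h f (\<xi> i))\<^sup>2)) \<partial>M)"
    by (rule nn_integral_add) (use hI_meas h_pt in \<open>auto intro!: borel_measurable_sum borel_measurable_times_ennreal measurable_compose[OF _ measurable_ennreal]\<close>)
  also have "(\<integral>\<^sup>+f. 2 * (\<integral>\<^sup>+x. ennreal ((h f x)\<^sup>2) \<partial>N) \<partial>M) = 2 * (\<integral>\<^sup>+f. (\<integral>\<^sup>+x. ennreal ((h f x)\<^sup>2) \<partial>N) \<partial>M)"
    by (rule nn_integral_cmult[OF hI_meas])
  also have "(\<integral>\<^sup>+f. (\<Sum>i<n. ennreal (4 * w i) * ennreal ((h f (\<xi> i))\<^sup>2)) \<partial>M) =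
      (\<Sum>i<n. (\<integral>\<^sup>+f. ennreal (4 * w i) * ennreal ((h f (\<xi> i))\<^sup>2) \<partial>M))"
    by (rule nn_integral_sum) (use h_pt in \<open>auto intro!: borel_measurable_times_ennreal measurable_compose[OF _ measurable_ennreal]\<close>)
  also have "\<dots> = (\<Sum>i<n. ennreal (4 * w i * R (\<xi> i)))"
  proof (rule sum.cong[OF refl])
    fix i assume "i \<in> {..<n}"
    then have i: "i < n" by simp
    have "(\<integral>\<^sup>+f. ennreal (4 * w i) * ennreal ((h f (\<xi> i))\<^sup>2) \<partial>M) = ennreal (4 * w i) * ennreal (R (\<xi> i))"
      unfolding hR[OF \<xi>[OF i], symmetric] by (rule nn_integral_cmult) (use h_pt[OF i] in measurable)
    also have "\<dots> = ennreal (4 * w i * R (\<xi> i))" using w[OF i] R0 by (simp add: ennreal_mult)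
    finally show "(\<integral>\<^sup>+f. ennreal (4 * w i) * ennreal ((h f (\<xi> i))\<^sup>2) \<partial>M) = ennreal (4 * w i * R (\<xi> i))" .
  qed
  also have "\<dots> = ennreal (4 * (\<Sum>i<n. w i * R (\<xi> i)))"
    by (subst sum_ennreal) (use w R0 in \<open>auto simp: less_imp_le sum_distrib_left mult.assoc\<close>)
  also have "2 * (\<integral>\<^sup>+f. (\<integral>\<^sup>+x. ennreal ((h f x)\<^sup>2) \<partial>N) \<partial>M) + ennreal (4 * (\<Sum>i<n. w i * R (\<xi> i)))
      \<le> 2 * (\<integral>\<^sup>+f. (\<integral>\<^sup>+x. ennreal ((h f x)\<^sup>2) \<partial>N) \<partial>M) + ennreal (8 * \<tau>)"
    using wR by (intro add_left_mono ennreal_leI) simp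
  also have "\<dots> \<le> 2 * ennreal \<tau> + ennreal (8 * \<tau>)"
    by (intro add_right_mono mult_left_mono) (use err in \<open>auto simp: h_def\<close>)
  also have "\<dots> = ennreal (10 * \<tau>)"
  proof -
    have "2 * ennreal \<tau> = ennreal (2 * \<tau>)" using \<tau> by (simp add: ennreal_mult')
    then show ?thesis using \<tau> by (simp flip: ennreal_plus)
  qed
  finally show ?thesis using \<xi> \<phi>_meas by blast
qed

end

section \<open>Information complexity\<close>

lemma APP_setting_gaussian_approximation:
  assumes A: "APP_setting D \<rho> F evl \<mu>" and d: "d \<ge> 1"
  shows "gaussian_approximation (\<mu> d) (F d) (G_meas D \<rho> d) (evl d)"
    and "sets (G_meas D \<rho> d) = sets (restrict_space (lebesgue_d d) (D d))"
    and "space (G_meas D \<rho> d) = D d"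
proof -
  note A' = A[unfolded APP_setting_def, rule_format, OF d]
  let ?R = "restrict_space (lebesgue_d d) (D d)"
  show sets: "sets (G_meas D \<rho> d) = sets ?R" by (simp add: G_meas_def)
  have "D d \<subseteq> space (lebesgue_d d)" using A' by (intro sets.sets_into_space) auto
  then have spR: "space ?R = D d" by (auto simp: space_restrict_space)
  then show sp: "space (G_meas D \<rho> d) = D d" by (simp add: G_meas_def)
  have \<rho>: "\<rho> d \<in> borel_measurable ?R" and \<rho>1: "(\<integral>\<^sup>+ x. ennreal (\<rho> d x) \<partial>?R) = 1"
    using A' by auto
  have "prob_space (G_meas D \<rho> d)"
  proof
    have "emeasure (G_meas D \<rho> d) (space ?R) = (\<integral>\<^sup>+ x. ennreal (\<rho> d x) * indicator (space ?R) x \<partial>?R)"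
      unfolding G_meas_def using \<rho> by (subst emeasure_density) auto
    also have "\<dots> = (\<integral>\<^sup>+ x. ennreal (\<rho> d x) \<partial>?R)"
      by (rule nn_integral_cong) simp
    finally show "emeasure (G_meas D \<rho> d) (space (G_meas D \<rho> d)) = 1"
      using \<rho>1 by (simp add: sp spR)
  qed
  moreover have "zero_mean_gaussian (F d) (\<mu> d)" "subspace (F d)" using A' by auto
  moreover from this have "prob_space (\<mu> d)" by (simp add: zero_mean_gaussian_def)
  moreover have "cont_lin_functional (F d) (\<lambda>f. evl d f x)" if "x \<in> space (G_meas D \<rho> d)" for x
    using A' that unfolding sp cont_lin_functional_def by simp
  moreover have "evl d f \<in> borel_measurable (G_meas D \<rho> d)" if "f \<in> F d" for f
    using A' that by (simp add: measurable_cong_sets[OF sets refl])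
  moreover have "\<exists>C. countable C \<and> C \<subseteq> F d \<and> F d \<subseteq> closure C"
    and "\<exists>C. \<forall>f\<in>F d. (\<integral>\<^sup>+ x. ennreal ((evl d f x)\<^sup>2) \<partial>G_meas D \<rho> d) \<le> ennreal ((C * norm f)\<^sup>2)"
    using A' by simp_all
  ultimately show "gaussian_approximation (\<mu> d) (F d) (G_meas D \<rho> d) (evl d)"
    by (intro gaussian_approximation.intro gaussian_space.intro gaussian_space_axioms.intro
        gaussian_approximation_axioms.intro) auto
qed

lemma Lambda_std_subset_all:
  assumes "APP_setting D \<rho> F evl \<mu>" "d \<ge> 1"
  shows "Lambda_std D evl d \<subseteq> Lambda_all F d"
proof -
  interpret gaussian_approximation "\<mu> d" "F d" "G_meas D \<rho> d" "evl d"
    by (rule APP_setting_gaussian_approximation[OF assms])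
  show ?thesis
    using ev_Lin APP_setting_gaussian_approximation(3)[OF assms]
    by (auto simp: Lambda_std_def Lambda_all_def)
qed

lemma avg_err_sq_mono:
  assumes "\<Lambda> d \<subseteq> \<Lambda>' d"
  shows "avg_err_sq D \<rho> evl \<mu> \<Lambda>' d n \<le> avg_err_sq D \<rho> evl \<mu> \<Lambda> d n"
  unfolding avg_err_sq_def by (rule INF_superset_mono) (use assms in auto)

text \<open>The infimum need not be attained; the strict inequality provides an algorithm with
  squared error below \<open>\<tau>\<close>. The number of samples is expressed by \<open>n\<close>
  because the rank \<open>m\<close> depends on the algorithm picked.\<close>

lemma avg_err_sq_std_le:
  assumes A: "APP_setting D \<rho> F evl \<mu>" and d: "d \<ge> 1"
    and less: "avg_err_sq D \<rho> evl \<mu> (Lambda_all F) d n < ennreal \<tau>"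
  shows "avg_err_sq D \<rho> evl \<mu> (Lambda_std D evl) d (8 * (n + 1)\<^sup>2) \<le> ennreal (10 * \<tau>)"
proof -
  note G = APP_setting_gaussian_approximation[OF A d]
  interpret gaussian_approximation "\<mu> d" "F d" "G_meas D \<rho> d" "evl d" by (rule G)
  have cong: "borel_measurable (PiM {..<k} (\<lambda>_. lborel) \<Otimes>\<^sub>M restrict_space (lebesgue_d d) (D d)) =
      (borel_measurable (PiM {..<k} (\<lambda>_. lborel) \<Otimes>\<^sub>M G_meas D \<rho> d) :: ((nat \<Rightarrow> real) \<times> _ \<Rightarrow> real) set)" for k :: nat
    by (intro measurable_cong_sets sets_pair_measure_cong G(2)[symmetric] refl)
  have \<tau>: "0 < \<tau>" using less by (metis ennreal_eq_0_iff not_less not_less_zero)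
  from less obtain L \<phi> where L: "\<And>i. i < n \<Longrightarrow> L i \<in> Lambda_all F d"
    and \<phi>: "(\<lambda>(y, x). \<phi> y x) \<in> borel_measurable (PiM {..<n} (\<lambda>_. lborel) \<Otimes>\<^sub>M G_meas D \<rho> d)"
    and err: "alg_err_sq D \<rho> evl \<mu> d n L \<phi> < ennreal \<tau>"
    unfolding avg_err_sq_def INF_less_iff cong by auto
  have "\<forall>i<n. cont_lin_functional (F d) (L i)" using L by (simp add: Lambda_all_def)
  from linear_algorithm_le[OF this \<phi>] obtain m v p where m: "m \<le> n"
    and vp: "\<forall>k<m. v k \<in> borel_measurable (G_meas D \<rho> d) \<and>
      integrable (G_meas D \<rho> d) (\<lambda>x. (v k x)\<^sup>2) \<and> cont_lin_functional (F d) (p k)"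
    and on: "\<forall>i<m. \<forall>j<m. (\<integral>x. v i x * v j x \<partial>G_meas D \<rho> d) = (if i = j then 1 else 0)"
    and le: "(\<integral>\<^sup>+f. (\<integral>\<^sup>+x. ennreal ((evl d f x - (\<Sum>k<m. p k f * v k x))\<^sup>2) \<partial>G_meas D \<rho> d) \<partial>\<mu> d) \<le>
      (\<integral>\<^sup>+f. (\<integral>\<^sup>+x. ennreal ((evl d f x - \<phi> (\<lambda>i\<in>{..<n}. L i f) x)\<^sup>2) \<partial>G_meas D \<rho> d) \<partial>\<mu> d)"
    by (elim exE conjE) (rule that)
  have v: "\<And>k. k < m \<Longrightarrow> v k \<in> borel_measurable (G_meas D \<rho> d)"
      "\<And>k. k < m \<Longrightarrow> integrable (G_meas D \<rho> d) (\<lambda>x. (v k x)\<^sup>2)"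
      "\<And>i j. i < m \<Longrightarrow> j < m \<Longrightarrow> (\<integral>x. v i x * v j x \<partial>G_meas D \<rho> d) = (if i = j then 1 else 0)"
    and p: "\<And>k. k < m \<Longrightarrow> cont_lin_functional (F d) (p k)"
    using vp on by simp_all
  let ?N = "8 * (n + 1)\<^sup>2"
  have N: "8 * (m + 1)\<^sup>2 \<le> ?N" using m by (intro mult_left_mono power_mono) auto
  have "(\<integral>\<^sup>+f. (\<integral>\<^sup>+x. ennreal ((evl d f x - (\<Sum>k<m. p k f * v k x))\<^sup>2) \<partial>G_meas D \<rho> d) \<partial>\<mu> d) \<le> ennreal \<tau>"
    using le err unfolding alg_err_sq_def by (rule order_trans[OF _ less_imp_le])
  from standard_algorithm[OF v p this \<tau> N] obtain \<xi> \<psi> where \<xi>: "\<And>i. i < ?N \<Longrightarrow> \<xi> i \<in> D d"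
    and \<psi>: "(\<lambda>(y, x). \<psi> y x) \<in> borel_measurable (PiM {..<?N} (\<lambda>_. lborel) \<Otimes>\<^sub>M G_meas D \<rho> d)"
    and err': "(\<integral>\<^sup>+f. (\<integral>\<^sup>+x. ennreal ((evl d f x - \<psi> (\<lambda>i\<in>{..<?N}. evl d f (\<xi> i)) x)\<^sup>2) \<partial>G_meas D \<rho> d) \<partial>\<mu> d)
      \<le> ennreal (10 * \<tau>)"
    unfolding G(3) by blast
  show ?thesis
    unfolding avg_err_sq_def cong
  proof (rule INF_lower2)
    show "(\<lambda>i f. evl d f (\<xi> i), \<psi>) \<in> {(L, \<phi>). (\<forall>i<?N. L i \<in> Lambda_std D evl d) \<and>
        (\<lambda>(y, x). \<phi> y x) \<in> borel_measurable (PiM {..<?N} (\<lambda>_. lborel) \<Otimes>\<^sub>M G_meas D \<rho> d) \<and>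
        (?N = 0 \<longrightarrow> \<phi> = (\<lambda>y x. 0))}"
      using \<xi> \<psi> by (auto simp: Lambda_std_def)
  qed (use err' in \<open>simp add: alg_err_sq_def\<close>)
qed

text \<open>A \<open>LEAST\<close> is informative only if some number qualifies, hence finiteness is
  both assumed at \<epsilon>/4 and delivered at \<epsilon>.\<close>

lemma std_complexity_le:
  assumes A: "APP_setting D \<rho> F evl \<mu>" and d: "d \<ge> 1" and \<epsilon>: "0 < \<epsilon>"
    and fin: "\<exists>n. avg_err_sq D \<rho> evl \<mu> (Lambda_all F) d n \<le> ennreal ((\<epsilon> / 4)\<^sup>2)"
  shows "\<exists>n. avg_err_sq D \<rho> evl \<mu> (Lambda_std D evl) d n \<le> ennreal (\<epsilon>\<^sup>2)"
    and "n_ABS D \<rho> evl \<mu> (Lambda_std D evl) \<epsilon> d \<le> 8 * (n_ABS D \<rho> evl \<mu> (Lambda_all F) (\<epsilon> / 4) d + 1)\<^sup>2"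
proof -
  let ?n = "n_ABS D \<rho> evl \<mu> (Lambda_all F) (\<epsilon> / 4) d"
  have "avg_err_sq D \<rho> evl \<mu> (Lambda_all F) d ?n \<le> ennreal ((\<epsilon> / 4)\<^sup>2)"
    unfolding n_ABS_def by (rule LeastI_ex[OF fin])
  \<comment> \<open>1/16 < 1/10 supplies the strict inequality, and the factor 10 lost by sampling
    restores \<open>\<epsilon>\<^sup>2\<close>.\<close>
  also have "\<dots> < ennreal (\<epsilon>\<^sup>2 / 10)"
    using \<epsilon> by (intro ennreal_lessI) (simp_all add: power_divide field_simps)
  finally have le: "avg_err_sq D \<rho> evl \<mu> (Lambda_std D evl) d (8 * (?n + 1)\<^sup>2) \<le> ennreal (\<epsilon>\<^sup>2)"
    using avg_err_sq_std_le[OF A d, of ?n "\<epsilon>\<^sup>2 / 10"] by simp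
  then show "\<exists>n. avg_err_sq D \<rho> evl \<mu> (Lambda_std D evl) d n \<le> ennreal (\<epsilon>\<^sup>2)" by blast
  show "n_ABS D \<rho> evl \<mu> (Lambda_std D evl) \<epsilon> d \<le> 8 * (?n + 1)\<^sup>2"
    unfolding n_ABS_def[where \<Lambda> = "Lambda_std D evl"] by (rule Least_le) (rule le)
qed

section \<open>From the complexity bound to weak tractability\<close>

lemma weak_tractability_transfer:
  fixes nA nS :: "real \<Rightarrow> nat \<Rightarrow> nat" and s t :: real
  assumes s: "0 < s" and t: "0 < t"
    and le: "\<And>\<epsilon> d. 0 < \<epsilon> \<Longrightarrow> \<epsilon> < 1 \<Longrightarrow> d \<ge> 1 \<Longrightarrow> nS \<epsilon> d \<le> 8 * (nA (\<epsilon> / 4) d + 1)\<^sup>2"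
    and wt: "\<forall>\<eta>>0. \<exists>M. \<forall>d\<ge>1. \<forall>\<epsilon>. 0 < \<epsilon> \<and> \<epsilon> < 1 \<and> 1 / \<epsilon> + real d > M \<longrightarrow>
        ln (real (nA \<epsilon> d)) / ((1 + ln (1 / \<epsilon>)) powr s + real d powr t) < \<eta>"
  shows "\<forall>\<eta>>0. \<exists>M. \<forall>d\<ge>1. \<forall>\<epsilon>. 0 < \<epsilon> \<and> \<epsilon> < 1 \<and> 1 / \<epsilon> + real d > M \<longrightarrow>
        ln (real (nS \<epsilon> d)) / ((1 + ln (1 / \<epsilon>)) powr s + real d powr t) < \<eta>"
proof (intro allI impI)
  fix \<eta> :: real assume \<eta>: "0 < \<eta>"
  \<comment> \<open>The price of passing from \<epsilon> to \<epsilon>/4: since ln 4 \<le> 3, 1 + ln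
    (4/\<epsilon>) is at most 4 (1 + ln (1/\<epsilon>)), and the power \<open>s\<close> of 4 comes
    out.\<close>
  define c where "c = (4::real) powr s"
  have c: "1 \<le> c" unfolding c_def using s by (intro ge_one_powr_ge_zero) auto
  \<comment> \<open>The square in the bound doubles the logarithm and the denominator grows by
    \<open>c\<close>; so this choice uses up \<eta>/2. The other half is for the constant ln
    32.\<close>
  have "0 < \<eta> / (4 * c)" using \<eta> c by simp
  from wt[rule_format, OF this] obtain M where
    "\<forall>d\<ge>1. \<forall>\<epsilon>. 0 < \<epsilon> \<and> \<epsilon> < 1 \<and> 1 / \<epsilon> + real d > M \<longrightarrow>
      ln (real (nA \<epsilon> d)) / ((1 + ln (1 / \<epsilon>)) powr s + real d powr t) < \<eta> / (4 * c)" ..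
  then have M: "\<And>d \<epsilon>. d \<ge> 1 \<Longrightarrow> 0 < \<epsilon> \<Longrightarrow> \<epsilon> < 1 \<Longrightarrow> 1 / \<epsilon> + real d > M \<Longrightarrow>
      ln (real (nA \<epsilon> d)) / ((1 + ln (1 / \<epsilon>)) powr s + real d powr t) < \<eta> / (4 * c)" by simp
  define K where "K = 2 * ln 32 / \<eta>"
  have K: "0 < K" using \<eta> by (simp add: K_def)
  show "\<exists>M. \<forall>d\<ge>1. \<forall>\<epsilon>. 0 < \<epsilon> \<and> \<epsilon> < 1 \<and> 1 / \<epsilon> + real d > M \<longrightarrow>
        ln (real (nS \<epsilon> d)) / ((1 + ln (1 / \<epsilon>)) powr s + real d powr t) < \<eta>"
  \<comment> \<open>If the denominator were below \<open>K\<close>, both summands would be, which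
    bounds 1/\<epsilon> by the exponential and \<open>d\<close> by the second root. Beyond their sum
    the denominator is at least \<open>K\<close>, so ln 32 is at most \<eta>/2 times it.\<close>
  proof (intro exI[of _ "max M (exp (K powr (1 / s)) + K powr (1 / t))"] allI impI, elim conjE)
    fix d :: nat and \<epsilon> :: real
    assume d: "d \<ge> 1" and \<epsilon>: "0 < \<epsilon>" "\<epsilon> < 1"
      and big: "1 / \<epsilon> + real d > max M (exp (K powr (1 / s)) + K powr (1 / t))"
    define l where "l = ln (1 / \<epsilon>)"
    have l: "0 \<le> l" unfolding l_def using \<epsilon> by simp
    define E where "E = (1 + l) powr s + real d powr t"
    have E0: "0 < E" unfolding E_def using l by (intro add_pos_nonneg) auto
    have EK: "K \<le> E"
    proof (rule ccontr)
      assume "\<not> K \<le> E"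
      then have "(1 + l) powr s < K" "real d powr t < K"
        unfolding E_def using powr_ge_zero[of "1 + l" s] powr_ge_zero[of "real d" t] by linarith+
      have root: "x < K powr (1 / r)" if "x powr r < K" "0 < r" for x r :: real
      proof (rule ccontr)
        assume "\<not> x < K powr (1 / r)"
        then have "(K powr (1 / r)) powr r \<le> x powr r" using that by (intro powr_mono2) auto
        then show False using that K by (simp add: powr_powr)
      qed
      have "l < K powr (1 / s)" using root[OF \<open>(1 + l) powr s < K\<close> s] l by simp
      then have "exp l < exp (K powr (1 / s))" by simp
      moreover have "exp l = 1 / \<epsilon>" using \<epsilon> by (simp add: l_def)
      moreover have "real d < K powr (1 / t)" by (rule root[OF \<open>real d powr t < K\<close> t])
      ultimately show False using big by simp
    qed
    define k where "k = nA (\<epsilon> / 4) d"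
    have nA: "ln (real k) < \<eta> / (4 * c) * (c * E)"
    proof -
      have "1 / \<epsilon> \<le> 1 / (\<epsilon> / 4)" using \<epsilon> by (simp add: field_simps)
      then have "ln (real k) / ((1 + ln (1 / (\<epsilon> / 4))) powr s + real d powr t) < \<eta> / (4 * c)"
        unfolding k_def using d \<epsilon> big by (intro M) auto
      moreover have "ln (1 / (\<epsilon> / 4)) = ln 4 + l"
        using \<epsilon> by (simp add: l_def ln_div)
      ultimately have q: "ln (real k) / ((1 + (ln 4 + l)) powr s + real d powr t) < \<eta> / (4 * c)" by simp
      have ln4: "0 \<le> ln (4::real)" "ln (4::real) \<le> 3" using ln_le_minus_one[of 4] by auto
      have "(1 + (ln 4 + l)) powr s \<le> (4 * (1 + l)) powr s"
        using s l ln4 by (intro powr_mono2) auto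
      also have "\<dots> = c * (1 + l) powr s" unfolding c_def by (rule powr_mult)
      finally have "(1 + (ln 4 + l)) powr s + real d powr t \<le> c * (1 + l) powr s + c * real d powr t"
        using c mult_right_mono[of 1 c "real d powr t"] by simp
      then have le: "(1 + (ln 4 + l)) powr s + real d powr t \<le> c * E"
        by (simp add: E_def distrib_left)
      have pos: "0 < (1 + (ln 4 + l)) powr s + real d powr t"
      proof -
        have "1 + (ln 4 + l) \<noteq> 0" using l ln4 by linarith
        then show ?thesis by (intro add_pos_nonneg) simp_all
      qed
      have "ln (real k) < \<eta> / (4 * c) * ((1 + (ln 4 + l)) powr s + real d powr t)"
        using q pos by (simp only: pos_divide_less_eq)
      also have "\<dots> \<le> \<eta> / (4 * c) * (c * E)"
        using le \<eta> c by (intro mult_left_mono) auto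
      finally show ?thesis .
    qed
    \<comment> \<open>From k + 1 \<le> 2 max(1, k), so 32 = 8 * 4. As ln 0 = 0, max(1, k) and k have
      the same logarithm even for k = 0.\<close>
    have "ln (real (nS \<epsilon> d)) \<le> ln 32 + 2 * ln (real k)"
    proof (cases "nS \<epsilon> d = 0")
      case True
      have "0 \<le> ln (real k)" by (cases "k = 0") auto
      then show ?thesis using True by simp
    next
      case False
      define k' where "k' = max 1 (real k)"
      have "real (nS \<epsilon> d) \<le> real (8 * (k + 1)\<^sup>2)" using le[OF \<epsilon> d] unfolding k_def of_nat_le_iff .
      also have "\<dots> = 8 * (real k + 1)\<^sup>2" by simp
      also have "\<dots> \<le> 8 * (2 * k')\<^sup>2" unfolding k'_def by (intro mult_left_mono power_mono) auto
      also have "\<dots> = 32 * k'\<^sup>2" by (simp add: power_mult_distrib)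
      finally have "ln (real (nS \<epsilon> d)) \<le> ln (32 * k'\<^sup>2)"
        using False by (intro ln_mono) auto
      also have "\<dots> = ln 32 + 2 * ln k'" by (simp add: k'_def ln_mult ln_realpow)
      also have "ln k' = ln (real k)" by (cases "k = 0") (auto simp: k'_def max_def)
      finally show ?thesis .
    qed
    also have "\<dots> < \<eta> / 2 * K + 2 * (\<eta> / (4 * c) * (c * E))"
      using nA \<eta> by (simp add: K_def)
    also have "\<dots> = \<eta> / 2 * K + \<eta> / 2 * E" using c by simp
    also have "\<dots> \<le> \<eta> / 2 * E + \<eta> / 2 * E" using EK \<eta> by (intro add_right_mono mult_left_mono) auto
    also have "\<dots> = \<eta> * E" by simp
    finally show "ln (real (nS \<epsilon> d)) / ((1 + ln (1 / \<epsilon>)) powr s + real d powr t) < \<eta>"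
      using E0 by (simp add: E_def l_def pos_divide_less_eq)
  qed
qed

text \<open>From function values to arbitrary functionals one only enlarges the class, which lowers
  the complexity; the converse is the quadratic bound. Finiteness is carried along each time, since
  the complexities are compared through \<open>LEAST\<close>.\<close>

lemma EXP_WT_all_iff_std:
  fixes s t :: real
  assumes A: "APP_setting D \<rho> F evl \<mu>" and s: "0 < s" and t: "0 < t"
  shows "EXP_WT s t D \<rho> evl \<mu> (Lambda_all F) \<longleftrightarrow> EXP_WT s t D \<rho> evl \<mu> (Lambda_std D evl)"
proof
  assume all: "EXP_WT s t D \<rho> evl \<mu> (Lambda_all F)"
  then have fin: "\<exists>n. avg_err_sq D \<rho> evl \<mu> (Lambda_all F) d n \<le> ennreal ((\<epsilon> / 4)\<^sup>2)"
    if "d \<ge> 1" "0 < \<epsilon>" "\<epsilon> < 1" for d and \<epsilon> :: real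
    using that unfolding EXP_WT_def by simp
  show "EXP_WT s t D \<rho> evl \<mu> (Lambda_std D evl)"
    unfolding EXP_WT_def
  proof (rule conjI)
    show "\<forall>d\<ge>1. \<forall>\<epsilon>. 0 < \<epsilon> \<and> \<epsilon> < 1 \<longrightarrow> (\<exists>n. avg_err_sq D \<rho> evl \<mu> (Lambda_std D evl) d n \<le> ennreal (\<epsilon>\<^sup>2))"
      using std_complexity_le(1)[OF A _ _ fin] by blast
    show "\<forall>\<eta>>0. \<exists>M. \<forall>d\<ge>1. \<forall>\<epsilon>. 0 < \<epsilon> \<and> \<epsilon> < 1 \<and> 1 / \<epsilon> + real d > M \<longrightarrow>
        ln (real (n_ABS D \<rho> evl \<mu> (Lambda_std D evl) \<epsilon> d)) / ((1 + ln (1 / \<epsilon>)) powr s + real d powr t) < \<eta>"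
      by (rule weak_tractability_transfer[OF s t, where nA = "n_ABS D \<rho> evl \<mu> (Lambda_all F)"])
         (use std_complexity_le(2)[OF A _ _ fin] all in \<open>simp_all add: EXP_WT_def\<close>)
  qed
next
  assume std: "EXP_WT s t D \<rho> evl \<mu> (Lambda_std D evl)"
  have mono: "avg_err_sq D \<rho> evl \<mu> (Lambda_all F) d n \<le> avg_err_sq D \<rho> evl \<mu> (Lambda_std D evl) d n"
    if "d \<ge> 1" for d n
    by (rule avg_err_sq_mono) (rule Lambda_std_subset_all[OF A that])
  have fin: "\<exists>n. avg_err_sq D \<rho> evl \<mu> (Lambda_std D evl) d n \<le> ennreal (\<epsilon>\<^sup>2)"
    if "d \<ge> 1" "0 < \<epsilon>" "\<epsilon> < 1" for d and \<epsilon> :: real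
    using std that unfolding EXP_WT_def by simp
  have n_le: "n_ABS D \<rho> evl \<mu> (Lambda_all F) \<epsilon> d \<le> n_ABS D \<rho> evl \<mu> (Lambda_std D evl) \<epsilon> d"
    if "d \<ge> 1" "0 < \<epsilon>" "\<epsilon> < 1" for d and \<epsilon> :: real
    unfolding n_ABS_def
    by (rule Least_le, rule order_trans[OF mono[OF that(1)]], rule LeastI_ex, rule fin) (use that in auto)
  have ln_le: "ln (real (n_ABS D \<rho> evl \<mu> (Lambda_all F) \<epsilon> d)) / ((1 + ln (1 / \<epsilon>)) powr s + real d powr t)
      \<le> ln (real (n_ABS D \<rho> evl \<mu> (Lambda_std D evl) \<epsilon> d)) / ((1 + ln (1 / \<epsilon>)) powr s + real d powr t)"
    if "d \<ge> 1" "0 < \<epsilon>" "\<epsilon> < 1" for d and \<epsilon> :: real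
  proof (rule divide_right_mono)
    \<comment> \<open>With ln 0 = 0 the logarithm is monotone on all natural numbers, zero
      included.\<close>
    have "ln (real a) \<le> ln (real b)" if "a \<le> b" for a b :: nat
      using that by (cases "a = 0"; cases "b = 0") auto
    then show "ln (real (n_ABS D \<rho> evl \<mu> (Lambda_all F) \<epsilon> d)) \<le> ln (real (n_ABS D \<rho> evl \<mu> (Lambda_std D evl) \<epsilon> d))"
      using n_le[OF that] .
  qed simp
  show "EXP_WT s t D \<rho> evl \<mu> (Lambda_all F)"
    unfolding EXP_WT_def
  proof (intro conjI allI impI)
    fix d :: nat and \<epsilon> :: real
    assume "d \<ge> 1" "0 < \<epsilon> \<and> \<epsilon> < 1"
    then show "\<exists>n. avg_err_sq D \<rho> evl \<mu> (Lambda_all F) d n \<le> ennreal (\<epsilon>\<^sup>2)"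
      using fin[of d \<epsilon>] order_trans[OF mono[of d]] by blast
  next
    fix \<eta> :: real assume "0 < \<eta>"
    from std[unfolded EXP_WT_def, THEN conjunct2, rule_format, OF this] obtain M where
      "\<forall>d\<ge>1. \<forall>\<epsilon>. 0 < \<epsilon> \<and> \<epsilon> < 1 \<and> 1 / \<epsilon> + real d > M \<longrightarrow>
        ln (real (n_ABS D \<rho> evl \<mu> (Lambda_std D evl) \<epsilon> d)) / ((1 + ln (1 / \<epsilon>)) powr s + real d powr t) < \<eta>" ..
    then show "\<exists>M. \<forall>d\<ge>1. \<forall>\<epsilon>. 0 < \<epsilon> \<and> \<epsilon> < 1 \<and> 1 / \<epsilon> + real d > M \<longrightarrow>
        ln (real (n_ABS D \<rho> evl \<mu> (Lambda_all F) \<epsilon> d)) / ((1 + ln (1 / \<epsilon>)) powr s + real d powr t) < \<eta>"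
      by (intro exI[of _ M] allI impI) (auto intro: le_less_trans[OF ln_le])
  qed
qed

theorem theorem5p5:
  fixes D :: "nat \<Rightarrow> (nat \<Rightarrow> real) set"
    and \<rho> :: "nat \<Rightarrow> (nat \<Rightarrow> real) \<Rightarrow> real"
    and F :: "nat \<Rightarrow> 'f::banach set"
    and evl :: "nat \<Rightarrow> 'f \<Rightarrow> (nat \<Rightarrow> real) \<Rightarrow> real"
    and \<mu> :: "nat \<Rightarrow> 'f measure"
    and s t :: real
  assumes "APP_setting D \<rho> F evl \<mu>"
    and "s > 0" and "t > 0"
  shows "(EXP_WT s t D \<rho> evl \<mu> (Lambda_all F) \<longleftrightarrow> EXP_WT s t D \<rho> evl \<mu> (Lambda_std D evl))
       \<and> (EXP_WT 1 1 D \<rho> evl \<mu> (Lambda_all F) \<longleftrightarrow> EXP_WT 1 1 D \<rho> evl \<mu> (Lambda_std D evl))"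
  using EXP_WT_all_iff_std[OF assms] EXP_WT_all_iff_std[OF assms(1), of 1 1] by simp

end
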